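(* Let $P\Sigma_n$ be the basis-conjugating (pure symmetric) automorphism group of the free group $F_n$. There is $k_0$ such that for all $k\ge k_0$, \[ \theta_k(P\Sigma_n)=(k-1)\binom{n}{2}+(k^2-1)\binom{n}{3}. \]
   Context: $F_n$ is free on $x_1,\dots,x_n$; $P\Sigma_n$ is the group of automorphisms of $F_n$ sending each $x_i$ to a conjugate of itself; it has McCool's presentation with generators $\beta_{i,j}$ ($1\le i\ne j\le n$; $\beta_{i,j}(x_i)=x_j^{-1}x_ix_j$, $\beta_{i,j}(x_k)=x_k$ for $k\ne i$) and relators $[\beta_{i,j},\beta_{k,l}]$, $[\beta_{i,k},\beta_{j,k}]$, $[\beta_{i,j},\beta_{i,k}\beta_{j,k}]$ with distinct indices, where $[u,v]=uvu^{-1}v^{-1}$. The Chen ranks are $\theta_k(G)=\operatorname{rank}\mathrm{gr}_k(G/G'')$, the ranks of lower central series quotients of $G/G''$. *)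

theory Defs
  imports "HOL-Algebra.Algebra"
begin

text \<open>A letter (i, True) stands for x_i, a letter (i, False) for x_i^{-1}.
  Elements of F_n are the freely reduced words in these letters.\<close>

type_synonym letter = "nat \<times> bool"

fun inverse_letters :: "letter \<Rightarrow> letter \<Rightarrow> bool" where
  "inverse_letters (i, b) (j, c) \<longleftrightarrow> i = j \<and> b \<noteq> c"

fun freduce :: "letter list \<Rightarrow> letter list" where
  "freduce [] = []"
| "freduce (a # w) =
     (case freduce w of
        [] \<Rightarrow> [a]
      | b # v \<Rightarrow> (if inverse_letters a b then v else a # b # v))"

definition free_group :: "nat \<Rightarrow> letter list monoid" where
  "free_group n =
     \<lparr> carrier = {w. (\<forall>l \<in> set w. fst l < n) \<and> freduce w = w},
       monoid.mult = (\<lambda>u v. freduce (u @ v)),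
       one = [] \<rparr>"

definition gen :: "nat \<Rightarrow> letter list" where
  "gen i = [(i, True)]"

definition PSigma :: "nat \<Rightarrow> (letter list \<Rightarrow> letter list) monoid" where
  "PSigma n =
     (AutoGroup (free_group n))
       \<lparr> carrier := {\<phi> \<in> auto (free_group n).
            \<forall>i < n. \<exists>w \<in> carrier (free_group n).
              \<phi> (gen i) = inv\<^bsub>free_group n\<^esub> w \<otimes>\<^bsub>free_group n\<^esub> gen i \<otimes>\<^bsub>free_group n\<^esub> w} \<rparr>"

definition commutator :: "('a, 'b) monoid_scheme \<Rightarrow> 'a \<Rightarrow> 'a \<Rightarrow> 'a" where
  "commutator G u v = u \<otimes>\<^bsub>G\<^esub> v \<otimes>\<^bsub>G\<^esub> inv\<^bsub>G\<^esub> u \<otimes>\<^bsub>G\<^esub> inv\<^bsub>G\<^esub> v"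

text \<open>Lower central series, indexed from 1: lcs G 1 = G, lcs G (k+1) = [lcs G k, G].
  (lcs G 0 is also set to the whole group.)\<close>
fun lcs :: "('a, 'b) monoid_scheme \<Rightarrow> nat \<Rightarrow> 'a set" where
  "lcs G 0 = carrier G"
| "lcs G (Suc 0) = carrier G"
| "lcs G (Suc (Suc k)) =
     generate G {commutator G u v | u v. u \<in> lcs G (Suc k) \<and> v \<in> carrier G}"

definition gr :: "('a, 'b) monoid_scheme \<Rightarrow> nat \<Rightarrow> 'a set monoid" where
  "gr G k = (G\<lparr>carrier := lcs G k\<rparr>) Mod (lcs G (Suc k))"

definition int_independent :: "('a, 'b) monoid_scheme \<Rightarrow> 'a set \<Rightarrow> bool" where
  "int_independent A S \<longleftrightarrow>
     (\<forall>c :: 'a \<Rightarrow> int. finprod A (\<lambda>x. x [^]\<^bsub>A\<^esub> c x) S = \<one>\<^bsub>A\<^esub> \<longrightarrow> (\<forall>x \<in> S. c x = 0))"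

text \<open>Rank of an abelian group: maximal size of a finite Z-linearly independent subset
  (i.e. the dimension of A tensor Q).\<close>
definition ab_rank :: "('a, 'b) monoid_scheme \<Rightarrow> nat" where
  "ab_rank A = Sup {card S | S. S \<subseteq> carrier A \<and> finite S \<and> int_independent A S}"

definition chen_rank :: "('a, 'b) monoid_scheme \<Rightarrow> nat \<Rightarrow> nat" where
  "chen_rank G k = ab_rank (gr (G Mod ((derived G ^^ 2) (carrier G))) k)"

end

theory Submission
  imports
    Defs
    "HOL-Library.Multiset"
    "HOL-Library.Function_Algebras"
    "HOL-Computational_Algebra.Formal_Power_Series"
begin

text \<open>
  Write G for the basis-conjugating automorphism group. A homomorphism from the k-th lower central
  quotient of G/G'' to the rationals is determined by its values on the iterated commutators
  [[a,b],g_3,...,g_k] of McCool generators; these values are antisymmetric in a, b, symmetric in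
  the g's, and satisfy the Jacobi identity and the linearised McCool relations. For k at least 5
  this forces all commutators whose indices involve four or more letters to vanish, and what
  remains is a free module of rank one over two variables for each pair of indices, and, for each triple
  of indices, the Chen module of a free group on three generators. This bounds the rank from above.

  For the lower bound, every pair of indices gives a homomorphism from G onto a free group of rank 2 and
  every triple one onto a free group of rank 3 (the outer basis-conjugating group of F_3).
  Composing them with one-parameter affine representations over real power series gives enough
  functionals to separate the spanning commutators. The maps to free groups are obtained by a ping-pong
  argument on the axes of the conjugates of x_i, x_j, x_k in the Cayley tree.

  McCool's theorem that the generators suffice is proved by length reduction: if no conjugator
  w_i can be shortened by a w_j, then the central letters in a reduced product of the
  conjugates of the x_i never cancel, so that surjectivity forces all w_i to be trivial.
\<close>

section \<open>Functionals on the Chen modules\<close>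

text \<open>The threshold comes from the four-letter terms. In weight \<open>k = m + 2\<close> a
  commutator is a bracket with \<open>m\<close> further entries; a three-letter bracket that has met
  a fourth letter dies after two more entries, so from \<open>m = 3\<close> on only pairs and
  triples of letters survive. A pair contributes the m + 1 monomials of degree m in two variables.
  On a triple the six generators act through three variables up to sign, and one cyclic relation
  removes a variable from one of the three brackets; this leaves (m + 1) + (m + 1)(m + 2) = (m +
  1)(m + 3) = k^2 - 1 monomials. The upper bound is phrased with functionals rather than modules: it
  suffices to name finitely many elements on which a nonzero functional cannot vanish, and this is a
  matter of rewriting the values \<open>C a b w\<close>. The obstacle for the lower bound is to
  define a map on a group of automorphisms from its values on generators. The subgroup of a product
  generated by the pairs (generator, value) is shown to be a graph: a word in the generators is
  followed through the conjugators that it produces, and from these the ping-pong argument recovers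
  a normal form of the value.\<close>

text \<open>C a b w is the value of a functional on the iterated commutator of [a,b] with the elements of w,
  where a pair (i,j) stands for the generator \<open>\<beta>\<^sub>i\<^sub>j\<close>.\<close>
locale chen_functional =
  fixes C :: "nat \<times> nat \<Rightarrow> nat \<times> nat \<Rightarrow> (nat \<times> nat) multiset \<Rightarrow> rat"
  assumes anti: "C a b w = - C b a w"
    and jacobi: "C a b (add_mset d w) + C b d (add_mset a w) + C d a (add_mset b w) = 0"
    and disj: "distinct [i, j, k, l] \<Longrightarrow> C (i, j) (k, l) w = 0"
    and same: "distinct [i, j, k] \<Longrightarrow> C (i, k) (j, k) w = 0"
    and mix: "distinct [i, j, k] \<Longrightarrow> C (i, j) (i, k) w + C (i, j) (j, k) w = 0"
    and loop: "C (i, i) b w = 0"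
    and loop_word: "(i, i) \<in># w \<Longrightarrow> C a b w = 0"
begin

text \<open>By the McCool relations every nonzero bracket on three distinct letters is
  \<open>R\<close> up to sign, and on two letters it is \<open>t\<close> up to sign. The first index
  of \<open>R\<close>, the letter moved by both generators, is called the centre below.\<close>

definition R where "R i j k w = C (i, j) (i, k) w"
definition t where "t i j w = C (i, j) (j, i) w"

lemma R_anti: "R i k j w = - R i j k w"
  unfolding R_def by (rule anti)

lemma t_anti: "t j i w = - t i j w"
  unfolding t_def by (rule anti)

lemma C_chain: "distinct [i, j, k] \<Longrightarrow> C (i, j) (j, k) w = - R i j k w"
  using mix[of i j k w] unfolding R_def by simp

lemma C_chain': "distinct [i, j, k] \<Longrightarrow> C (i, j) (k, i) w = - R k j i w"
  using C_chain[of k i j w] anti[of "(i,j)" "(k,i)" w] R_anti[of k i j w] by auto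

text \<open>Jacobi for a bracket on three letters and a generator that brings in the letter
  \<open>l\<close>: brackets of generators with disjoint indices or with the same second index drop
  out, and the surviving ones are rewritten as \<open>R\<close>. The identities let the fourth
  letter change its position.\<close>

lemma
  assumes "distinct [i, j, k, l]"
  shows R_A: "R i j k (add_mset (l, j) w) = 0"
    and R_A': "R i k j (add_mset (l, j) w) = 0"
    and R_B: "R i j k (add_mset (j, l) w) = R i l j (add_mset (i, k) w)"
    and R_D: "R i j k (add_mset (i, l) w) = R i l j (add_mset (j, k) w)"
    and R_D': "R i j k (add_mset (i, l) w) = R i k l (add_mset (k, j) w)"
    and R_E: "R i j k (add_mset (l, i) w) = R l j i (add_mset (j, k) w)"
    and R_F: "R i j k (add_mset (l, i) w) = R l k j (add_mset (l, i) w)"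
proof -
  have Z: "C (i, j) (k, l) w = 0" "C (i, k) (j, k) w = 0" if "distinct [i, j, k, l]" for i j k l w
    using disj[OF that] same[of i j k w] that by auto
  show A: "R i j k (add_mset (l, j) w) = 0"
    using jacobi[of "(i,j)" "(i,k)" "(l,j)" w] Z(1)[of i k l j "add_mset (i,j) w"]
      Z(2)[of l i j k "add_mset (i,k) w"] assms unfolding R_def by auto
  show "R i k j (add_mset (l, j) w) = 0" using A R_anti[of i k j] by simp
  show B: "R i j k (add_mset (j, l) w) = R i l j (add_mset (i, k) w)"
    using jacobi[of "(i,j)" "(i,k)" "(j,l)" w] assms C_chain'[of j l i "add_mset (i,k) w"]
      Z(1)[of i k j l "add_mset (i,j) w"]
    unfolding R_def by auto
  have D: "R i j k (add_mset (i, l) w) = R i l j (add_mset (j, k) w)"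
    if "distinct [i, j, k, l]" for i j k l w
    using jacobi[of "(i,j)" "(j,k)" "(i,l)" w] that C_chain[of i j k "add_mset (i,l) w"]
      Z(1)[of j k i l "add_mset (i,j) w"]
    unfolding R_def by auto
  from D[OF assms] show "R i j k (add_mset (i, l) w) = R i l j (add_mset (j, k) w)" .
  show D': "R i j k (add_mset (i, l) w) = R i k l (add_mset (k, j) w)"
    using D[of i k j l w] assms R_anti[of i j k "add_mset (i, l) w"] R_anti[of i k l "add_mset (k, j) w"]
    by auto
  have E: "R i j k (add_mset (l, i) w) = R l j i (add_mset (j, k) w)"
    if "distinct [i, j, k, l]" for i j k l w
    using jacobi[of "(i,j)" "(j,k)" "(l,i)" w] that C_chain[of i j k "add_mset (l,i) w"]
      C_chain[of l i j "add_mset (j,k) w"] R_anti[of l i j "add_mset (j,k) w"]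
      Z(1)[of j k l i "add_mset (i,j) w"]
    by auto
  from E[OF assms] show "R i j k (add_mset (l, i) w) = R l j i (add_mset (j, k) w)" .
  \<comment> \<open>Both sides of \<open>R_F\<close> equal \<open>R l i k\<close> with the
    additional letter \<open>(k, j)\<close>.\<close>
  have D2: "R l k j (add_mset (l, i) w) = R l i k (add_mset (k, j) w)"
    using assms by (intro D) auto
  have E2: "R i k j (add_mset (l, i) w) = R l k i (add_mset (k, j) w)"
    using assms by (intro E) auto
  show "R i j k (add_mset (l, i) w) = R l k j (add_mset (l, i) w)"
    using E2 D2 R_anti[of i j k "add_mset (l, i) w"] R_anti[of l i k "add_mset (k, j) w"] by linarith
qed

lemma R_disj: "distinct [i, j, k, p] \<Longrightarrow> q \<notin> {i, j, k} \<Longrightarrow> p \<noteq> q \<Longrightarrow> R i j k (add_mset (p, q) w) = 0"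
  using jacobi[of "(i,j)" "(i,k)" "(p,q)" w] disj[of i k p q "add_mset (i,j) w"]
    disj[of p q i j "add_mset (i,k) w"] unfolding R_def by auto

text \<open>On the free group of the three letters the product of the two generators conjugating by
  x_j is inner. The lemma is the trace of this fact for the two letters other than the centre:
  generators with the same second index act with opposite signs.\<close>

lemma y_off:
  assumes "distinct [i, j, k]"
  shows "R i j k (add_mset (i, j) w) = - R i j k (add_mset (k, j) w)"
    and "R i j k (add_mset (i, k) w) = - R i j k (add_mset (j, k) w)"
proof -
  have *: "R i j k (add_mset (i, j) w) = - R i j k (add_mset (k, j) w)"
    if "distinct [i, j, k]" for i j k
    using jacobi[of "(i,j)" "(k,j)" "(i,k)" w] that same[of i k j "add_mset (i,k) w"]
      C_chain[of i k j "add_mset (i,j) w"] R_anti[of i k j] anti[of "(i,j)" "(k,j)"]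
      anti[of "(i,k)" "(i,j)"] anti[of "(i,k)" "(k,j)"]
    unfolding R_def by auto
  show "R i j k (add_mset (i, j) w) = - R i j k (add_mset (k, j) w)" using * assms by blast
  show "R i j k (add_mset (i, k) w) = - R i j k (add_mset (j, k) w)"
    using *[of i k j] assms R_anti[of i j k] by auto
qed

text \<open>This is the relation x_1 [x_2, x_3] + x_2 [x_3, x_1] + x_3 [x_1, x_2] = 0 of the Chen
  module of a free group of rank 3. It later removes one letter from the words on one of the three
  brackets.\<close>

lemma cyc:
  assumes "distinct [i, j, k]"
  shows "R i j k (add_mset (k, i) w) = R j i k (add_mset (i, j) w) + R k j i (add_mset (j, k) w)"
  using jacobi[of "(i,j)" "(j,k)" "(k,i)" w] assms
    C_chain[of i j k "add_mset (k, i) w"] C_chain[of j k i "add_mset (i, j) w"]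
    C_chain[of k i j "add_mset (j, k) w"] R_anti[of j k i "add_mset (i, j) w"]
    R_anti[of k j i "add_mset (j, k) w"]
  by auto

text \<open>A generator joining \<open>i\<close> or \<open>j\<close> to a third letter turns a
  two-letter bracket into three-letter ones. Hence two-letter brackets only have to be tested on
  words in \<open>(i, j)\<close> and \<open>(j, i)\<close>.\<close>

lemma
  assumes "distinct [i, j, k]"
  shows t_ik: "t i j (add_mset (i, k) w) = R i j k (add_mset (j, i) w) + R j i k (add_mset (i, j) w)"
    and t_jk: "t i j (add_mset (j, k) w) = - R i j k (add_mset (j, i) w) - R j i k (add_mset (i, j) w)"
    and t_ki: "t i j (add_mset (k, i) w) = R k i j (add_mset (j, i) w)"
    and t_kj: "t i j (add_mset (k, j) w) = R k i j (add_mset (i, j) w)"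
proof -
  show "t i j (add_mset (i, k) w) = R i j k (add_mset (j, i) w) + R j i k (add_mset (i, j) w)"
    using jacobi[of "(i,j)" "(j,i)" "(i,k)" w] assms
      C_chain[of j i k "add_mset (i,j) w"] anti[of "(i,k)" "(i,j)" "add_mset (j,i) w"]
    unfolding t_def R_def by (auto simp: algebra_simps)
  show "t i j (add_mset (j, k) w) = - R i j k (add_mset (j, i) w) - R j i k (add_mset (i, j) w)"
    using jacobi[of "(i,j)" "(j,i)" "(j,k)" w] assms
      C_chain[of i j k "add_mset (j,i) w"] anti[of "(j,k)" "(i,j)" "add_mset (j,i) w"]
    unfolding t_def R_def by (auto simp: algebra_simps)
  show "t i j (add_mset (k, i) w) = R k i j (add_mset (j, i) w)"
    using jacobi[of "(i,j)" "(j,i)" "(k,i)" w] assms same[of j k i]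
      C_chain[of k i j "add_mset (j,i) w"]
    unfolding t_def by (auto simp: algebra_simps)
  show "t i j (add_mset (k, j) w) = R k i j (add_mset (i, j) w)"
    using jacobi[of "(i,j)" "(j,i)" "(k,j)" w] assms same[of k i j]
      C_chain'[of j i k "add_mset (i,j) w"]
    unfolding t_def by (auto simp: algebra_simps)
qed

section \<open>The two generators that conjugate by the centre\<close>

definition z where "z i j k w = R i j k (add_mset (j, i) w) + R i j k (add_mset (k, i) w)"

lemma z_anti: "z i k j w = - z i j k w"
  unfolding z_def using R_anti[of i j k] by simp

text \<open>\<open>z\<close> is the defect of the sign rule of \<open>y_off\<close> at the centre.
  The cyclic sum of the defects is the difference of the two instances of \<open>cyc\<close>, one
  for each orientation of the triple.\<close>

lemma z_sum:
  assumes "distinct [i, j, k]"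
  shows "z i j k w + z j k i w + z k i j w = 0"
proof -
  have 1: "R i j k (add_mset (k, i) w) = R j i k (add_mset (i, j) w) + R k j i (add_mset (j, k) w)"
    using assms by (rule cyc)
  have 2: "R i k j (add_mset (j, i) w) = R k i j (add_mset (i, k) w) + R j k i (add_mset (k, j) w)"
    using assms by (intro cyc) auto
  show ?thesis using 1 2 R_anti[of i j k "add_mset (j, i) w"] R_anti[of j i k "add_mset (i, j) w"]
      R_anti[of k i j "add_mset (j, k) w"]
    unfolding z_def by linarith
qed

text \<open>The two-letter term \<open>t i j\<close> is evaluated on \<open>(i, k)\<close> and
  \<open>(k, i)\<close> in both orders. Comparing the two expressions, rewritten by
  \<open>y_off\<close> and \<open>cyc\<close>, leaves exactly the defect.\<close>

lemma z_ji:
  assumes "distinct [i, j, k]"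
  shows "z k i j (add_mset (j, i) w) = 0"
proof -
  have 1: "t i j (add_mset (i, k) (add_mset (k, i) w)) = R i j k (add_mset (j, i) (add_mset (k, i) w)) + R j i k (add_mset (i, j) (add_mset (k, i) w))"
    by (rule t_ik[OF assms])
  have 2: "t i j (add_mset (k, i) (add_mset (i, k) w)) = R k i j (add_mset (j, i) (add_mset (i, k) w))"
    by (rule t_ki[OF assms])
  have 3: "R j i k (add_mset (k, i) (add_mset (i, j) w)) = - R j i k (add_mset (j, i) (add_mset (i, j) w))"
    using y_off(1)[of j i k] assms by auto
  have 4: "R i j k (add_mset (k, i) (add_mset (j, i) w)) = R j i k (add_mset (i, j) (add_mset (j, i) w)) + R k j i (add_mset (j, k) (add_mset (j, i) w))"
    by (rule cyc[OF assms])
  note c = add_mset_commute[of "(k, i)" "(i, k)"] add_mset_commute[of "(k, i)" "(j, i)"]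
    add_mset_commute[of "(k, i)" "(i, j)"] add_mset_commute[of "(j, i)" "(i, j)"]
    add_mset_commute[of "(j, k)" "(j, i)"] add_mset_commute[of "(i, k)" "(j, i)"]
  show ?thesis using 1 2 3 4 R_anti[of k j i "add_mset (j, k) (add_mset (j, i) w)"] unfolding z_def c by linarith
qed

lemma z_y:
  assumes "distinct [i, j, k]"
  shows "z k i j (add_mset (j, i) w) + z k i j (add_mset (k, i) w) = 0"
  using y_off(1)[of k i j "add_mset (i,k) w"] y_off(1)[of k i j "add_mset (j,k) w"] assms
  unfolding z_def add_mset_commute[of "(k, i)"] add_mset_commute[of "(j, i)"] by simp

text \<open>If the second index of the letter is not the centre, \<open>z_ji\<close> and
  \<open>z_y\<close> apply. If it is, \<open>z_sum\<close> passes to the defects at the other two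
  centres, where the first case applies.\<close>

lemma z_kill:
  assumes "distinct [i, j, k]" "p \<in> {i, j, k}" "q \<in> {i, j, k}"
  shows "z i j k (add_mset (p, q) w) = 0"
proof (cases "p = q")
  case True
  then show ?thesis unfolding z_def R_def by (simp add: loop_word[of q])
next
  case False
  have A: "z i j k (add_mset (p, q) w) = 0"
    if "distinct [i, j, k]" "p \<in> {i, j, k}" "q \<in> {i, j, k}" "q \<noteq> i" "p \<noteq> q" for i j k p q
    using that z_ji[of j k i w] z_ji[of k j i w] z_y[of j k i w] z_y[of k j i w]
      z_anti[of i j k] by (auto simp: insert_commute)
  show ?thesis
  proof (cases "q = i")
    case True
    then show ?thesis
      using A[of j k i p q] A[of k i j p q] z_sum[OF assms(1), of "add_mset (p,q) w"] assms False by auto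
  qed (use A assms False in blast)
qed

section \<open>Brackets that have met a fourth letter\<close>

definition E where "E i j k l w = R i j k (add_mset (i, l) w)"

lemma E_alt1: "distinct [i, j, k, l] \<Longrightarrow> E i j k l w = R i l j (add_mset (j, k) w)"
  unfolding E_def by (rule R_D)

lemma E_alt2: "distinct [i, j, k, l] \<Longrightarrow> E i j k l w = R i k l (add_mset (k, j) w)"
  unfolding E_def by (rule R_D')

text \<open>\<open>E\<close> has three forms, by \<open>E_alt1\<close> and \<open>E_alt2\<close>, in
  which \<open>j\<close>, \<open>k\<close>, \<open>l\<close> exchange their roles. For every letter
  avoiding the centre one of the forms makes it act by zero, through \<open>R_A\<close>,
  \<open>R_A'\<close> or \<open>R_disj\<close>.\<close>

lemma E_off_center:
  assumes d: "distinct [i, j, k, l]" and pq: "p \<noteq> q" "p \<noteq> i" "q \<noteq> i"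
  shows "E i j k l (add_mset (p, q) w) = 0"
proof -
  have e: "E i j k l (add_mset (p, q) w) = R i j k (add_mset (p, q) (add_mset (i, l) w))"
    "E i j k l (add_mset (p, q) w) = R i l j (add_mset (p, q) (add_mset (j, k) w))"
    "E i j k l (add_mset (p, q) w) = R i k l (add_mset (p, q) (add_mset (k, j) w))"
    using E_def[of i j k l "add_mset (p, q) w"] E_alt1[OF d, of "add_mset (p, q) w"] E_alt2[OF d, of "add_mset (p, q) w"]
    unfolding add_mset_commute[of _ "(p, q)"] by auto
  consider "q \<in> {j, k, l}" "p \<in> {j, k, l}" | "q \<in> {j, k, l}" "p \<notin> {i, j, k, l}" | "q \<notin> {i, j, k, l}"
    using pq by blast
  then show ?thesis
  proof cases
    case 1
    then consider "p = j" "q = k" | "p = j" "q = l" | "p = k" "q = j" | "p = k" "q = l" | "p = l" "q = j" | "p = l" "q = k"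
      using pq by auto
    then show ?thesis
    proof cases
      case 1 then show ?thesis using e(3) R_A[of i k l j] d by auto
    next
      case 2 then show ?thesis using e(3) R_A'[of i l k j] d by auto
    next
      case 3 then show ?thesis using e(2) R_A'[of i j l k] d by auto
    next
      case 4 then show ?thesis using e(2) R_A[of i l j k] d by auto
    next
      case 5 then show ?thesis using e(1) R_A[of i j k l] d by auto
    next
      case 6 then show ?thesis using e(1) R_A'[of i k j l] d by auto
    qed
  next
    case 2
    then consider "q = j" | "q = k" | "q = l" by auto
    then show ?thesis
    proof cases
      case 1 then show ?thesis using e(1) R_A[of i j k p] d 2 by auto
    next
      case 2 then show ?thesis using e(1) R_A'[of i k j p] d \<open>p \<notin> {i, j, k, l}\<close> by auto
    next
      case 3 then show ?thesis using e(2) R_A[of i l j p] d \<open>p \<notin> {i, j, k, l}\<close> by auto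
    qed
  next
    case 3
    have "p \<noteq> j \<and> p \<noteq> k \<or> p \<noteq> l \<and> p \<noteq> j \<or> p \<noteq> k \<and> p \<noteq> l" using d by auto
    then show ?thesis
    proof (elim disjE)
      assume "p \<noteq> j \<and> p \<noteq> k" then show ?thesis unfolding e(1) using d pq 3 by (intro R_disj) auto
    next
      assume "p \<noteq> l \<and> p \<noteq> j" then show ?thesis unfolding e(2) using d pq 3 by (intro R_disj) auto
    next
      assume "p \<noteq> k \<and> p \<noteq> l" then show ?thesis unfolding e(3) using d pq 3 by (intro R_disj) auto
    qed
  qed
qed

lemma E_off:
  assumes d: "distinct [i, j, k, l]" and pq: "p \<noteq> q" "q \<noteq> i"
  shows "E i j k l (add_mset (p, q) w) = 0"
proof (cases "p = i")
  case False
  then show ?thesis using E_off_center d pq by blast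
next
    case pi: True
    \<comment> \<open>For a letter starting at the centre, \<open>y_off\<close> in a suitable form
      of \<open>E\<close> replaces its first index by another one, so that the letter avoids the
      centre.\<close>
    have swap: "E i j k l (add_mset (i, j) w) = - E i j k l (add_mset (k, j) w)"
       "E i j k l (add_mset (i, k) w) = - E i j k l (add_mset (j, k) w)"
      unfolding E_def add_mset_commute[of "(i,l)"] using d by (auto intro!: y_off)
    have swapl: "E i j k l (add_mset (i, l) w) = - E i j k l (add_mset (j, l) w)"
      unfolding E_alt1[OF d] add_mset_commute[of "(j,k)"] using d by (auto intro!: y_off)
    consider "q = j" | "q = k" | "q = l" | "q \<notin> {j,k,l}" by blast
    then show ?thesis
    proof cases
      case 4
      then have d': "distinct [i,j,k,q]" "distinct [i,q,j,l]" "distinct [i, l, q, j]" "distinct [i,q,j,k]"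
        "distinct [i,l,q,k]" "distinct [i, j, l, q]" "distinct [i,q,j,l]"
        using d pq by auto
      \<comment> \<open>The fifth letter \<open>q\<close> is moved into the bracket until
        \<open>(j, k)\<close> is disjoint from the bracket on which it acts.\<close>
      have "E i j k l (add_mset (i, q) w) = R i j k (add_mset (i, q) (add_mset (i, l) w))"
        unfolding E_def by (simp add: add_mset_commute)
      also have "\<dots> = R i q j (add_mset (j, k) (add_mset (i, l) w))" by (rule R_D[OF d'(1)])
      also have "\<dots> = R i q j (add_mset (i, l) (add_mset (j, k) w))" by (simp add: add_mset_commute)
      also have "\<dots> = R i l q (add_mset (q, j) (add_mset (j, k) w))" by (rule R_D[OF d'(2)])
      also have "\<dots> = R i l q (add_mset (j, k) (add_mset (q, j) w))" by (simp add: add_mset_commute)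
      also have "\<dots> = 0" using d d' R_disj[of i l q j k] by auto
      finally show ?thesis using pi by simp
    next
      case 1 then show ?thesis using swap(1) E_off_center[OF d, of k j w] d pi by simp
    next
      case 2 then show ?thesis using swap(2) E_off_center[OF d, of j k w] d pi by simp
    next
      case 3 then show ?thesis using swapl E_off_center[OF d, of j l w] d pi by simp
    qed
qed

text \<open>As for a fifth letter in \<open>E_off\<close>, the bracket is transformed until
  \<open>(j, k)\<close> is disjoint from it, this time with the outer letter \<open>p\<close> as the
  centre.\<close>

lemma E_out:
  assumes d: "distinct [i, j, k, l]" and p: "p \<notin> {i, j, k, l}"
  shows "E i j k l (add_mset (p, i) w) = 0"
proof -
  have d': "distinct [i,j,k,p]" "distinct [p,j,i,l]" "distinct [p,i,j,l]" "distinct [p, l, j, i]" using d p by auto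
  have "E i j k l (add_mset (p, i) w) = R i j k (add_mset (p, i) (add_mset (i, l) w))"
    unfolding E_def by (simp add: add_mset_commute)
  also have "\<dots> = R p j i (add_mset (j, k) (add_mset (i, l) w))" by (rule R_E[OF d'(1)])
  also have "\<dots> = - R p i j (add_mset (i, l) (add_mset (j, k) w))"
    using R_anti[of p i j] by (simp add: add_mset_commute)
  also have "\<dots> = - R p l i (add_mset (p, j) (add_mset (j, k) w))" by (subst R_B[OF d'(3)]) simp
  also have "\<dots> = - R p l i (add_mset (j, k) (add_mset (p, j) w))" by (simp add: add_mset_commute)
  also have "\<dots> = 0" using d d' p R_disj[of p l i j k] by auto
  finally show ?thesis .
qed

text \<open>A letter ending in the centre moves the centre to its own first index; this is
  \<open>R_F\<close> in each of the three forms of \<open>E\<close>.\<close>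

lemma E_in:
  assumes d: "distinct [i, j, k, l]"
  shows "E i j k l (add_mset (j, i) w) = E j l k i (add_mset (k, j) w)"
    and "E i j k l (add_mset (k, i) w) = E k j l i (add_mset (j, k) w)"
    and "E i j k l (add_mset (l, i) w) = E l k j i (add_mset (i, l) w)"
proof -
  have d': "distinct [i,k,l,j]" "distinct [i,l,j,k]" using d by auto
  show "E i j k l (add_mset (j, i) w) = E j l k i (add_mset (k, j) w)"
    unfolding E_alt2[OF d] unfolding E_def add_mset_commute[of "(k,j)"] by (rule R_F[OF d'(1)])
  show "E i j k l (add_mset (k, i) w) = E k j l i (add_mset (j, k) w)"
    unfolding E_alt1[OF d] unfolding E_def add_mset_commute[of "(j,k)"] by (rule R_F[OF d'(2)])
  show "E i j k l (add_mset (l, i) w) = E l k j i (add_mset (i, l) w)"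
    unfolding E_def add_mset_commute[of "(i,l)"] by (rule R_F[OF d])
qed

text \<open>By \<open>E_off\<close> and \<open>E_out\<close> only letters from \<open>j\<close>,
  \<open>k\<close> or \<open>l\<close> to the centre are left. If both \<open>u\<close> and
  \<open>v\<close> are of this kind, \<open>u\<close> moves the centre by \<open>E_in\<close>, and
  \<open>v\<close>, which still ends in the old centre, falls under \<open>E_off\<close>.\<close>

lemma E_kill:
  assumes d: "distinct [i, j, k, l]"
  shows "E i j k l (add_mset u (add_mset v w)) = 0"
proof -
  obtain p q where u: "u = (p, q)" by force
  obtain p' q' where v: "v = (p', q')" by force
  consider "p = q \<or> p' = q'" | "p \<noteq> q" "q \<noteq> i" | "p' \<noteq> q'" "q' \<noteq> i"
    | "p \<notin> {i, j, k, l}" "q = i" | "p \<in> {j, k, l}" "q = i" "q' = i" "p' \<noteq> q'"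
    using d by auto
  then show ?thesis
  proof cases
    case 1
    then show ?thesis unfolding E_def R_def u v by (auto simp: loop_word[of q] loop_word[of q'])
  next
    case 2
    then show ?thesis using E_off[OF d] u by simp
  next
    case 3
    then show ?thesis unfolding add_mset_commute[of u] v using E_off[OF d] by simp
  next
    case 4
    then show ?thesis using E_out[OF d] u by simp
  next
    case 5
    have o: "E a b c e (add_mset x (add_mset v w)) = 0" if "distinct [a,b,c,e]" "i \<noteq> a" for a b c e x
      unfolding add_mset_commute[of x] v using E_off[OF that(1), of p' q' "add_mset x w"] 5 that by simp
    show ?thesis using 5 u E_in[OF d, of "add_mset v w"] d
      o[of j l k i "(k,j)"] o[of k j l i "(j,k)"] o[of l k j i "(i,l)"] by auto
  qed
qed

text \<open>The threshold arises here. A letter that leaves the triple turns \<open>R\<close> into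
  zero or, up to sign, into some \<open>E\<close>, and \<open>size w \<ge> 2\<close> provides the
  two letters that kill it.\<close>

lemma R_out:
  assumes d: "distinct [i, j, k]" and w: "size w \<ge> 2" and pq: "\<not> (p \<in> {i,j,k} \<and> q \<in> {i,j,k})"
  shows "R i j k (add_mset (p, q) w) = 0"
proof -
  obtain u w1 where w1: "w = add_mset u w1" using w by (cases w) auto
  moreover obtain v w' where "w1 = add_mset v w'" using w w1 by (cases w1) auto
  ultimately have w': "w = add_mset u (add_mset v w')" by simp
  consider "p = q" | "p \<noteq> q" "p \<notin> {i,j,k}" "q \<notin> {i,j,k}"
    | "p \<notin> {i,j,k}" "q = j" | "p \<notin> {i,j,k}" "q = k" | "p \<notin> {i,j,k}" "q = i"
    | "q \<notin> {i,j,k}" "p = i" | "q \<notin> {i,j,k}" "p = j" | "q \<notin> {i,j,k}" "p = k"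
    using pq by auto
  then show ?thesis
  proof cases
    case 1 then show ?thesis unfolding R_def by (simp add: loop_word[of q])
  next
    case 2 then show ?thesis using R_disj[of i j k p q] d by auto
  next
    case 3 then show ?thesis using R_A[of i j k p] d by auto
  next
    case 4 then show ?thesis using R_A'[of i k j p] d by auto
  next
    case 5
    then have "R i j k (add_mset (p, i) w) = E p k j i w"
      using R_F[of i j k p w] d unfolding E_def by auto
    also have "\<dots> = 0" using E_kill[of p k j i u v w'] d 5 w' by auto
    finally show ?thesis using 5 by simp
  next
    case 6
    then have "R i j k (add_mset (i, q) w) = E i j k q w" unfolding E_def by auto
    also have "\<dots> = 0" using E_kill[of i j k q u v w'] d 6 w' by auto
    finally show ?thesis using 6 by simp
  next
    case 7
    then have "R i j k (add_mset (j, q) w) = E i q j k w"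
      using R_B[of i j k q w] d unfolding E_def by auto
    also have "\<dots> = 0" using E_kill[of i q j k u v w'] d 7 w' by auto
    finally show ?thesis using 7 by simp
  next
    case 8
    then have "R i j k (add_mset (k, q) w) = - E i q k j w"
      using R_B[of i k j q w] d R_anti[of i j k "add_mset (k, q) w"] unfolding E_def by auto
    also have "\<dots> = 0" using E_kill[of i q k j u v w'] d 8 w' by auto
    finally show ?thesis using 8 by simp
  qed
qed

end

context chen_functional
begin

section \<open>Normal form on a triple and the vanishing criterion\<close>

definition tri_word where "tri_word i j k w \<longleftrightarrow> (\<forall>(p, q) \<in># w. p \<in> {i, j, k} \<and> q \<in> {i, j, k})"

lemma R_loop: "R i j k (add_mset (p, p) w) = 0"
  unfolding R_def by (simp add: loop_word[of p])

text \<open>A nonempty rest word annihilates the defect by \<open>z_kill\<close>. Together with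
  \<open>y_off\<close>, generators with the same second index then act with opposite signs for each
  of the three letters.\<close>

lemma R_flip:
  assumes d: "distinct [i, j, k]" and w: "tri_word i j k w" "w \<noteq> {#}"
    and pq: "p \<in> {i, j, k}" "p' \<in> {i, j, k}" "q \<in> {i, j, k}" "p \<noteq> q" "p' \<noteq> q" "p \<noteq> p'"
  shows "R i j k (add_mset (p, q) w) = - R i j k (add_mset (p', q) w)"
proof -
  obtain a b w' where w': "w = add_mset (a, b) w'" using w(2) by (metis multiset_cases surj_pair)
  have "z i j k w = 0" unfolding w' using w d by (intro z_kill) (auto simp: tri_word_def w')
  then have "R i j k (add_mset (j, i) w) = - R i j k (add_mset (k, i) w)"
    unfolding z_def by linarith
  then show ?thesis using y_off[OF d, of w] pq d by auto
qed

text \<open>The letters \<open>(j, i)\<close>, \<open>(k, j)\<close>, \<open>(i, k)\<close>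
  represent the three classes of letters up to sign. The induction counts the letters that are not
  yet representatives.\<close>

lemma R_canonical:
  assumes d: "distinct [i, j, k]" and m: "m \<ge> 2"
    and can: "\<And>w. size w = m \<Longrightarrow> set_mset w \<subseteq> {(j, i), (k, j), (i, k)} \<Longrightarrow> R i j k w = 0"
  shows "size w = m \<Longrightarrow> tri_word i j k w \<Longrightarrow> R i j k w = 0"
proof (induction "size (filter_mset (\<lambda>x. x \<notin> {(j, i), (k, j), (i, k)}) w)" arbitrary: w rule: less_induct)
  case less
  show ?case
  proof (cases "set_mset w \<subseteq> {(j, i), (k, j), (i, k)}")
    case True
    then show ?thesis using can less.prems by blast
  next
    case False
    then obtain p q where pq: "(p, q) \<in># w" "(p, q) \<notin> {(j, i), (k, j), (i, k)}" by auto
    then obtain w' where w': "w = add_mset (p, q) w'" by (metis insert_DiffM)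
    have in3: "p \<in> {i, j, k}" "q \<in> {i, j, k}" "tri_word i j k w'"
      using less.prems unfolding w' tri_word_def by auto
    have ne: "w' \<noteq> {#}" using less.prems m unfolding w' by auto
    show ?thesis
    proof (cases "p = q")
      case True
      then show ?thesis unfolding w' by (simp add: R_loop)
    next
      case False
      obtain p' where p': "(p', q) \<in> {(j, i), (k, j), (i, k)}" "p' \<in> {i, j, k}" "p' \<noteq> q" "p' \<noteq> p"
        using in3 pq(2) d by auto
      have "R i j k (add_mset (p', q) w') = 0"
        using less.prems pq(2) p'(1,2) in3
        by (intro less.hyps) (auto simp: w' tri_word_def)
      then show ?thesis using R_flip[OF d in3(3) ne in3(1) p'(2) in3(2) False p'(3)] p'(4) w' by auto
    qed
  qed
qed

lemma mset_three:
  assumes "set_mset w \<subseteq> {a, b, c}" "distinct [a, b, c]"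
  shows "w = replicate_mset (count w a) a + replicate_mset (count w b) b + replicate_mset (count w c) c"
  using assms by (intro multiset_eqI) (auto simp: not_in_iff)

lemma R_triple:
  assumes d: "distinct [i, j, k]" and m: "m \<ge> 3"
    and 1: "\<And>p q. p + q = m \<Longrightarrow> R i j k (replicate_mset p (k, j) + replicate_mset q (i, k)) = 0"
    and 2: "\<And>s p q. s + p + q = m \<Longrightarrow>
      R j k i (replicate_mset s (j, i) + replicate_mset p (k, j) + replicate_mset q (i, k)) = 0"
    and 3: "\<And>s p q. s + p + q = m \<Longrightarrow>
      R k i j (replicate_mset s (j, i) + replicate_mset p (k, j) + replicate_mset q (i, k)) = 0"
    and w: "size w = m"
  shows "R i j k w = 0" "R j k i w = 0" "R k i j w = 0"
proof -
  have m2: "m \<ge> 2" using m by simp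
  \<comment> \<open>With \<open>m \<ge> 3\<close> two letters remain besides the offending one, as
    \<open>R_out\<close> requires.\<close>
  have out: "R a b c w = 0" if "distinct [a, b, c]" "\<not> tri_word a b c w" for a b c
  proof -
    obtain p q where pq: "(p, q) \<in># w" "\<not> (p \<in> {a,b,c} \<and> q \<in> {a,b,c})"
      using \<open>\<not> tri_word a b c w\<close> unfolding tri_word_def by auto
    then obtain w' where w': "w = add_mset (p, q) w'" by (metis insert_DiffM)
    show ?thesis unfolding w' using pq(2) w m that(1) by (intro R_out) (auto simp: w')
  qed
  have tw: "tri_word i j k = tri_word j k i" "tri_word i j k = tri_word k i j"
    unfolding tri_word_def by (auto simp: insert_commute)
  have dd: "distinct [(j, i), (k, j), (i, k)]" "distinct [j, k, i]" "distinct [k, i, j]" using d by auto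
  have sz: "size w = count w (j, i) + count w (k, j) + count w (i, k)"
    if "set_mset w \<subseteq> {(j, i), (k, j), (i, k)}" for w
    using arg_cong[OF mset_three[OF that dd(1)], of size] by simp
  have R2: "R j k i w = 0" if "tri_word i j k w" "size w = m" for w
  proof (rule R_canonical[OF dd(2) m2 _ that(2)])
    fix w assume "size w = m" "set_mset w \<subseteq> {(k, j), (i, k), (j, i)}"
    then have w: "set_mset w \<subseteq> {(j, i), (k, j), (i, k)}" "size w = m" by auto
    show "R j k i w = 0" by (subst mset_three[OF w(1) dd(1)], rule 2) (use sz w in simp)
  qed (use that tw in auto)
  have R3: "R k i j w = 0" if "tri_word i j k w" "size w = m" for w
  proof (rule R_canonical[OF dd(3) m2 _ that(2)])
    fix w assume "size w = m" "set_mset w \<subseteq> {(i, k), (j, i), (k, j)}"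
    then have w: "set_mset w \<subseteq> {(j, i), (k, j), (i, k)}" "size w = m" by auto
    show "R k i j w = 0" by (subst mset_three[OF w(1) dd(1)], rule 3) (use sz w in simp)
  qed (use that tw in auto)
  have R1: "R i j k w = 0" if "tri_word i j k w" "size w = m" for w
  proof (rule R_canonical[OF d m2 _ that(2)])
    fix w assume w: "size w = m" "set_mset w \<subseteq> {(j, i), (k, j), (i, k)}"
    show "R i j k w = 0"
    proof (cases "(j, i) \<in># w")
      case True
      then obtain w' where w': "w = add_mset (j, i) w'" by (metis insert_DiffM)
      have tr: "tri_word i j k w'" "w' \<noteq> {#}" using w m unfolding w' tri_word_def by auto
      \<comment> \<open>The letter \<open>(j, i)\<close> is traded by \<open>cyc\<close> for letters
        on the other two brackets. This is why the first family of test words does without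
        it.\<close>
      have "R i j k w = - R i j k (add_mset (k, i) w')"
        unfolding w' using d by (intro R_flip[OF d tr]) auto
      also have "\<dots> = R j k i (add_mset (i, j) w') + R k i j (add_mset (j, k) w')"
        using cyc[OF d, of w'] R_anti[of j i k "add_mset (i, j) w'"] R_anti[of k j i "add_mset (j, k) w'"]
        by linarith
      also have "\<dots> = 0"
        using R2[of "add_mset (i, j) w'"] R3[of "add_mset (j, k) w'"] w tr by (simp add: w' tri_word_def)
      finally show ?thesis .
    next
      case False
      then have "count w (j, i) = 0" by (simp add: not_in_iff)
      then show ?thesis
        using mset_three[OF w(2) dd(1)] sz[OF w(2)] w(1) 1[of "count w (k, j)" "count w (i, k)"] by simp
    qed
  qed (use that in auto)
  show "R i j k w = 0" "R j k i w = 0" "R k i j w = 0"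
    using out[OF d] out[OF dd(2)] out[OF dd(3)] R1 R2 R3 w tw by metis+
qed

text \<open>The test words correspond to the index set \<open>chen_indices\<close>, whose size is
  the claimed rank. Two-letter brackets with an outer letter are reduced to three-letter ones, and
  these to the test words by \<open>R_triple\<close>.\<close>

theorem vanish:
  assumes m: "m \<ge> 3"
    and pair: "\<And>i j p q. i < j \<Longrightarrow> p + q = m \<Longrightarrow>
      C (i, j) (j, i) (replicate_mset p (i, j) + replicate_mset q (j, i)) = 0"
    and tri1: "\<And>i j k p q. i < j \<Longrightarrow> j < k \<Longrightarrow> p + q = m \<Longrightarrow>
      C (i, j) (i, k) (replicate_mset p (k, j) + replicate_mset q (i, k)) = 0"
    and tri2: "\<And>i j k s p q. i < j \<Longrightarrow> j < k \<Longrightarrow> s + p + q = m \<Longrightarrow>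
      C (j, k) (j, i) (replicate_mset s (j, i) + replicate_mset p (k, j) + replicate_mset q (i, k)) = 0"
    and tri3: "\<And>i j k s p q. i < j \<Longrightarrow> j < k \<Longrightarrow> s + p + q = m \<Longrightarrow>
      C (k, i) (k, j) (replicate_mset s (j, i) + replicate_mset p (k, j) + replicate_mset q (i, k)) = 0"
    and w: "size w = m"
  shows "C a b w = 0"
proof -
  have sorted: "R i j k w = 0 \<and> R j k i w = 0 \<and> R k i j w = 0" if "i < j" "j < k" "size w = m" for i j k w
    using R_triple[of i j k m w] that m tri1 tri2 tri3 unfolding R_def by auto
  have R0: "R i j k w = 0" if "distinct [i, j, k]" "size w = m" for i j k w
  proof -
    consider "i < j" "j < k" | "i < k" "k < j" | "j < i" "i < k" | "j < k" "k < i" | "k < i" "i < j" | "k < j" "j < i"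
      using \<open>distinct [i, j, k]\<close> by fastforce
    then show ?thesis
      using sorted[of i j k w] sorted[of i k j w] sorted[of j i k w] sorted[of j k i w] sorted[of k i j w] sorted[of k j i w]
        R_anti[of i j k w] that(2) by cases auto
  qed
  have t0: "t i j w = 0" if ij: "i < j" and w: "size w = m" for i j w
  proof (cases "set_mset w \<subseteq> {(i, j), (j, i)}")
    case True
    have w2: "w = replicate_mset (count w (i, j)) (i, j) + replicate_mset (count w (j, i)) (j, i)"
      using True ij by (intro multiset_eqI) (auto simp: not_in_iff)
    show ?thesis
      unfolding t_def by (subst w2, rule pair[OF ij]) (use w arg_cong[OF w2, of size] in simp)
  next
    case False
    then obtain p q where pq: "(p, q) \<in># w" "(p, q) \<notin> {(i, j), (j, i)}" by auto
    then obtain w' where w': "w = add_mset (p, q) w'" by (metis insert_DiffM)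
    have sw: "size (add_mset u w') = m" for u using w unfolding w' by simp
    consider "p = q" | "p \<noteq> q" "p \<notin> {i, j}" "q \<notin> {i, j}" | "p = i" "q \<notin> {i,j}" | "p = j" "q \<notin> {i, j}"
      | "p \<notin> {i, j}" "q = i" | "p \<notin> {i, j}" "q = j"
      using pq(2) by auto
    then show ?thesis
    proof cases
      case 1
      then show ?thesis unfolding t_def w' by (simp add: loop_word[of q])
    next
      case 2
      then show ?thesis
        using jacobi[of "(i,j)" "(j,i)" "(p,q)" w'] disj[of j i p q "add_mset (i,j) w'"]
          disj[of p q i j "add_mset (j,i) w'"] ij unfolding t_def w' by auto
    next
      case 3
      then have "distinct [i, j, q]" "distinct [j, i, q]" using ij by auto
      then show ?thesis unfolding w' using 3 t_ik[of i j q w'] R0 sw by simp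
    next
      case 4
      then have "distinct [i, j, q]" "distinct [j, i, q]" using ij by auto
      then show ?thesis unfolding w' using 4 t_jk[of i j q w'] R0 sw by simp
    next
      case 5
      then have "distinct [i, j, p]" "distinct [p, i, j]" using ij by auto
      then show ?thesis unfolding w' using 5 t_ki[of i j p w'] R0 sw by simp
    next
      case 6
      then have "distinct [i, j, p]" "distinct [p, i, j]" using ij by auto
      then show ?thesis unfolding w' using 6 t_kj[of i j p w'] R0 sw by simp
    qed
  qed
  obtain i j where a: "a = (i, j)" by force
  obtain k l where b: "b = (k, l)" by force
  consider "i = j" | "k = l" | "i \<noteq> j" "k = i" "l = j" | "i \<noteq> j" "k = j" "l = i" | "i \<noteq> j" "k = i" "l \<noteq> j" "k \<noteq> l"
    | "i \<noteq> j" "l = j" "k \<noteq> i" "k \<noteq> l" | "i \<noteq> j" "k = j" "l \<noteq> i" "k \<noteq> l" | "i \<noteq> j" "l = i" "k \<noteq> j" "k \<noteq> l"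
    | "distinct [i, j, k, l]"
    by (cases "i = j"; cases "k = l"; cases "k = i"; cases "k = j"; cases "l = i"; cases "l = j") auto
  then show ?thesis
  proof cases
    case 1
    then show ?thesis unfolding a by (simp add: loop)
  next
    case 2
    then show ?thesis unfolding a b using anti[of "(i,j)" "(k,l)" w] by (simp add: loop)
  next
    case 3
    then show ?thesis using anti[of a a w] unfolding a b by simp
  next
    case 4
    then show ?thesis using t0[of i j w] t0[of j i w] t_anti[of i j w] w unfolding t_def a b
      by (cases i j rule: linorder_cases) auto
  next
    case 5
    then show ?thesis using R0[of i j l w] w unfolding R_def a b by auto
  next
    case 6
    then show ?thesis using same[of i k j w] unfolding a b by auto
  next
    case 7
    then show ?thesis using C_chain[of i j l w] R0[of i j l w] w unfolding a b by auto
  next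
    case 8
    then show ?thesis using C_chain'[of i j k w] R0[of k j i w] w unfolding a b by auto
  next
    case 9
    then show ?thesis unfolding a b by (rule disj)
  qed
qed

end

section \<open>Ranks of abelian groups\<close>

lemma underdetermined_system:
  fixes a :: "'s \<Rightarrow> 'i \<Rightarrow> 'f :: field"
  assumes "finite I" "finite S" "card I < card S"
  shows "\<exists>q. (\<exists>s\<in>S. q s \<noteq> 0) \<and> (\<forall>b\<in>I. (\<Sum>s\<in>S. q s * a s b) = 0)"
  using assms
proof (induction I arbitrary: S a rule: finite_induct)
  case empty
  then show ?case by (intro exI[of _ "\<lambda>_. 1"]) (auto simp: card_gt_0_iff)
next
  case (insert b I)
  show ?case
  proof (cases "\<forall>s\<in>S. a s b = 0")
    case True
    then show ?thesis using insert.IH[of S a] insert.prems insert.hyps by auto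
  next
    case False
    then obtain s0 where s0: "s0 \<in> S" "a s0 b \<noteq> 0" by auto
    define S' where "S' = S - {s0}"
    have "finite S'" "card I < card S'" using insert.prems insert.hyps s0 by (auto simp: S'_def)
    from insert.IH[OF this, of "\<lambda>s b'. a s b' - a s b / a s0 b * a s0 b'"]
    obtain q where q: "\<exists>s\<in>S'. q s \<noteq> 0"
      "\<And>b'. b' \<in> I \<Longrightarrow> (\<Sum>s\<in>S'. q s * (a s b' - a s b / a s0 b * a s0 b')) = 0" by auto
    \<comment> \<open>The coefficient at the pivot \<open>s0\<close> is chosen to satisfy the
      equation for \<open>b\<close>; the modified rows passed to the induction hypothesis ensure
      that the other equations hold as well.\<close>
    define p where "p = q(s0 := - (\<Sum>s\<in>S'. q s * a s b) / a s0 b)"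
    have sum_p: "(\<Sum>s\<in>S. p s * a s b') = p s0 * a s0 b' + (\<Sum>s\<in>S'. q s * a s b')" for b'
    proof -
      have "(\<Sum>s\<in>S'. p s * a s b') = (\<Sum>s\<in>S'. q s * a s b')"
        by (rule sum.cong) (auto simp: p_def S'_def)
      then show ?thesis using insert.prems s0(1) by (simp add: S'_def sum.remove)
    qed
    have "(\<Sum>s\<in>S. p s * a s b') = 0" if "b' \<in> I" for b'
    proof -
      have "0 = (\<Sum>s\<in>S'. q s * a s b') - (\<Sum>s\<in>S'. q s * a s b) / a s0 b * a s0 b'"
        using q(2)[OF that]
        by (simp add: right_diff_distrib sum_subtractf sum_divide_distrib sum_distrib_right mult.assoc)
      then show ?thesis unfolding sum_p by (simp add: p_def)
    qed
    moreover have "(\<Sum>s\<in>S. p s * a s b) = 0" unfolding sum_p using s0(2) by (simp add: p_def)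
    moreover have "\<exists>s\<in>S. p s \<noteq> 0" using q(1) by (auto simp: p_def S'_def)
    ultimately show ?thesis by (intro exI[of _ p]) auto
  qed
qed

definition additive_on :: "('a, 'b) monoid_scheme \<Rightarrow> ('a \<Rightarrow> 'c :: ab_group_add) \<Rightarrow> bool" where
  "additive_on A f \<longleftrightarrow> (\<forall>x \<in> carrier A. \<forall>y \<in> carrier A. f (x \<otimes>\<^bsub>A\<^esub> y) = f x + f y)"

lemma additive_on_mult:
  "additive_on A f \<Longrightarrow> x \<in> carrier A \<Longrightarrow> y \<in> carrier A \<Longrightarrow> f (x \<otimes>\<^bsub>A\<^esub> y) = f x + f y"
  unfolding additive_on_def by blast

lemma (in group) additive_on_one: "additive_on G f \<Longrightarrow> f \<one> = 0"
  using additive_on_mult[of G f \<one> \<one>] by simp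

lemma (in group) additive_on_inv: "additive_on G f \<Longrightarrow> x \<in> carrier G \<Longrightarrow> f (inv x) = - f x"
  using additive_on_mult[of G f x "inv x"] additive_on_one[of f] by (simp add: eq_neg_iff_add_eq_0 add.commute)

lemma (in group) additive_on_nat_pow:
  "additive_on G f \<Longrightarrow> x \<in> carrier G \<Longrightarrow> f (x [^] (n::nat)) = of_nat n * (f x :: 'c :: ring_1)"
  by (induction n) (simp_all add: additive_on_one additive_on_mult algebra_simps)

lemma (in group) additive_on_int_pow:
  "additive_on G f \<Longrightarrow> x \<in> carrier G \<Longrightarrow> f (x [^] (n::int)) = of_int n * (f x :: 'c :: ring_1)"
  by (cases n rule: int_cases2) (simp_all add: int_pow_neg int_pow_int additive_on_nat_pow additive_on_inv)

lemma (in comm_group) additive_on_finprod: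
  assumes "additive_on G f" "finite S" "g \<in> S \<rightarrow> carrier G"
  shows "f (finprod G g S) = (\<Sum>x\<in>S. f (g x))"
  using assms(2,3)
proof (induction S rule: finite_induct)
  case empty
  then show ?case using additive_on_one[OF assms(1)] by simp
next
  case (insert x S)
  then have "g \<in> S \<rightarrow> carrier G" "g x \<in> carrier G" by auto
  then show ?case using insert by (simp add: additive_on_mult[OF assms(1)])
qed

text \<open>Injectivity needs an argument because independence is stated for a set: two indices with
  the same image would admit the coefficients 1 and -1, which no functional detects.\<close>

lemma (in comm_group) independent_image:
  fixes g :: "'i \<Rightarrow> 'a" and \<Lambda> :: "('a \<Rightarrow> real) set"
  assumes fin: "finite I" and g: "g ` I \<subseteq> carrier G"
    and add: "\<And>f. f \<in> \<Lambda> \<Longrightarrow> additive_on G f"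
    and sep: "\<And>c :: 'i \<Rightarrow> int. (\<And>f. f \<in> \<Lambda> \<Longrightarrow> (\<Sum>b\<in>I. real_of_int (c b) * f (g b)) = 0) \<Longrightarrow> \<forall>b\<in>I. c b = 0"
  shows "inj_on g I" "int_independent G (g ` I)"
proof -
  show inj: "inj_on g I"
  proof (rule inj_onI, rule ccontr)
    fix b b' assume b: "b \<in> I" "b' \<in> I" "g b = g b'" "b \<noteq> b'"
    define c :: "'i \<Rightarrow> int" where "c = (\<lambda>x. if x = b then 1 else if x = b' then -1 else 0)"
    have 0: "(\<Sum>x\<in>I. c x * f (g x)) = 0" for f :: "'a \<Rightarrow> real"
    proof -
      have "(\<Sum>x\<in>I. c x * f (g x)) = (\<Sum>x\<in>I. (if x = b then f (g b) else 0) - (if x = b' then f (g b') else 0))"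
        by (rule sum.cong) (use b(4) in \<open>auto simp: c_def\<close>)
      also have "\<dots> = 0" using b fin by (simp add: sum_subtractf)
      finally show ?thesis .
    qed
    have "\<forall>x\<in>I. c x = 0" using sep[of c] 0 by blast
    then have "c b = 0" using b(1) by blast
    then show False by (simp add: c_def)
  qed
  show "int_independent G (g ` I)"
    unfolding int_independent_def
  proof (intro allI impI)
    fix c :: "'a \<Rightarrow> int" assume c: "finprod G (\<lambda>x. x [^] c x) (g ` I) = \<one>"
    have 0: "(\<Sum>b\<in>I. real_of_int (c (g b)) * f (g b)) = 0" if f: "f \<in> \<Lambda>" for f :: "'a \<Rightarrow> real"
    proof -
      have "0 = f (finprod G (\<lambda>x. x [^] c x) (g ` I))"
        using c additive_on_one[OF add[OF f]] by simp
      also have "\<dots> = (\<Sum>x\<in>g ` I. f (x [^] c x))"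
        using fin g by (intro additive_on_finprod[OF add[OF f]]) auto
      also have "\<dots> = (\<Sum>x\<in>g ` I. real_of_int (c x) * f x)"
        using g by (intro sum.cong) (auto simp: additive_on_int_pow[OF add[OF f]])
      also have "\<dots> = (\<Sum>b\<in>I. real_of_int (c (g b)) * f (g b))" using inj by (simp add: sum.reindex)
      finally show ?thesis by simp
    qed
    have "\<forall>b\<in>I. c (g b) = 0" using sep[of "\<lambda>b. c (g b)"] 0 by blast
    then show "\<forall>x\<in>g ` I. c x = 0" by blast
  qed
qed

context comm_group
begin

text \<open>The kernel of the map from the rational vector space on the carrier of an abelian group A
  to A tensor Q.\<close>
definition relation_space :: "('a \<Rightarrow> rat) set" where
  "relation_space = {f. \<exists>F N c. finite F \<and> F \<subseteq> carrier G \<and> N > (0::int) \<and> (\<forall>x. of_int N * f x = of_int (c x)) \<and>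
     (\<forall>x. x \<notin> F \<longrightarrow> c x = 0) \<and> finprod G (\<lambda>x. x [^] (c x :: int)) F = \<one>}"

lemma finprod_pow_superset:
  assumes "finite F" "F \<subseteq> F'" "finite F'" "F' \<subseteq> carrier G" "\<forall>x. x \<notin> F \<longrightarrow> c x = (0::int)"
  shows "finprod G (\<lambda>x. x [^] c x) F' = finprod G (\<lambda>x. x [^] c x) F"
  using assms by (intro finprod_mono_neutral_cong_left[symmetric]) auto

lemma finprod_pow_add:
  assumes "finite F" "F \<subseteq> carrier G"
  shows "finprod G (\<lambda>x. x [^] (c x + d x :: int)) F = finprod G (\<lambda>x. x [^] c x) F \<otimes> finprod G (\<lambda>x. x [^] d x) F"
proof -
  have "finprod G (\<lambda>x. x [^] (c x + d x)) F = finprod G (\<lambda>x. x [^] c x \<otimes> x [^] d x) F"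
    using assms by (intro finprod_cong') (auto simp: int_pow_mult)
  also have "\<dots> = finprod G (\<lambda>x. x [^] c x) F \<otimes> finprod G (\<lambda>x. x [^] d x) F"
    using assms by (intro finprod_multf) auto
  finally show ?thesis .
qed

lemma finprod_pow_scale:
  assumes "finite F" "F \<subseteq> carrier G"
  shows "finprod G (\<lambda>x. x [^] (m * c x :: int)) F = finprod G (\<lambda>x. x [^] c x) F [^] m"
  using assms
proof (induction F rule: finite_induct)
  case empty
  then show ?case by simp
next
  case (insert x F)
  then have "(\<lambda>x. x [^] c x) \<in> F \<rightarrow> carrier G" "(\<lambda>x. x [^] (m * c x)) \<in> F \<rightarrow> carrier G" by auto
  then show ?case using insert
    by (simp add: int_pow_distrib int_pow_pow mult.commute)
qed

lemma finprod_pow_single: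
  assumes "finite F" "F \<subseteq> carrier G" "p \<in> F"
  shows "finprod G (\<lambda>x. x [^] (if x = p then e else 0 :: int)) F = p [^] e"
proof -
  have "finprod G (\<lambda>x. x [^] (if x = p then e else 0 :: int)) F = finprod G (\<lambda>x. if p = x then x [^] e else \<one>) F"
    using assms by (intro finprod_cong') auto
  also have "\<dots> = p [^] e" using assms by (subst finprod_singleton) auto
  finally show ?thesis .
qed

abbreviation (input) rscale :: "rat \<Rightarrow> ('a \<Rightarrow> rat) \<Rightarrow> 'a \<Rightarrow> rat" where "rscale r f \<equiv> (\<lambda>x. r * f x)"
abbreviation (input) unit_vec :: "'a \<Rightarrow> 'a \<Rightarrow> rat" where "unit_vec s \<equiv> (\<lambda>x. if x = s then 1 else 0)"

lemma relation_space_add: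
  assumes "f \<in> relation_space" "g \<in> relation_space"
  shows "f + g \<in> relation_space"
proof -
  obtain F N c where f: "finite F" "F \<subseteq> carrier G" "N > (0::int)" "\<And>x. of_int N * f x = of_int (c x)"
     "\<forall>x. x \<notin> F \<longrightarrow> c x = 0" "finprod G (\<lambda>x. x [^] (c x :: int)) F = \<one>"
    using assms(1) unfolding relation_space_def by blast
  obtain F' N' c' where g: "finite F'" "F' \<subseteq> carrier G" "N' > (0::int)" "\<And>x. of_int N' * g x = of_int (c' x)"
     "\<forall>x. x \<notin> F' \<longrightarrow> c' x = 0" "finprod G (\<lambda>x. x [^] (c' x :: int)) F' = \<one>"
    using assms(2) unfolding relation_space_def by blast
  define d where "d x = N' * c x + N * c' x" for x
  have U: "finite (F \<union> F')" "F \<union> F' \<subseteq> carrier G" using f g by auto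
  have "finprod G (\<lambda>x. x [^] d x) (F \<union> F') =
    finprod G (\<lambda>x. x [^] c x) (F \<union> F') [^] N' \<otimes> finprod G (\<lambda>x. x [^] c' x) (F \<union> F') [^] N"
    unfolding d_def finprod_pow_add[OF U] finprod_pow_scale[OF U] ..
  also have "finprod G (\<lambda>x. x [^] c x) (F \<union> F') = \<one>"
    using finprod_pow_superset[of F "F \<union> F'" c] f U by auto
  also have "finprod G (\<lambda>x. x [^] c' x) (F \<union> F') = \<one>"
    using finprod_pow_superset[of F' "F \<union> F'" c'] g U by auto
  finally have p: "finprod G (\<lambda>x. x [^] d x) (F \<union> F') = \<one>" by simp
  have "of_int (N * N') * (f + g) x = of_int (d x)" for x
    using f(4)[of x] g(4)[of x] unfolding d_def by (simp add: algebra_simps flip: f(4) g(4))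
  then show ?thesis unfolding relation_space_def using U f(3) g(3) f(5) g(5) p
    by (intro CollectI exI[of _ "F \<union> F'"] exI[of _ "N * N'"] exI[of _ d]) (auto simp: d_def)
qed

lemma relation_space_scale:
  assumes "f \<in> relation_space"
  shows "rscale r f \<in> relation_space"
proof -
  obtain F N c where f: "finite F" "F \<subseteq> carrier G" "N > (0::int)" "\<And>x. of_int N * f x = of_int (c x)"
     "\<forall>x. x \<notin> F \<longrightarrow> c x = 0" "finprod G (\<lambda>x. x [^] (c x :: int)) F = \<one>"
    using assms(1) unfolding relation_space_def by blast
  obtain a b where ab: "quotient_of r = (a, b)" by force
  have r: "r = of_int a / of_int b" "b > 0" using quotient_of_div[OF ab] quotient_of_denom_pos[OF ab] by auto
  have "of_int (b * N) * (r * f x) = of_int (a * c x)" for x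
  proof -
    have "of_int (b * N) * (r * f x) = (r * of_int b) * (of_int N * f x)" by simp
    also have "\<dots> = of_int (a * c x)" unfolding f(4) using r by simp
    finally show ?thesis .
  qed
  moreover have "finprod G (\<lambda>x. x [^] (a * c x)) F = \<one>"
    using finprod_pow_scale[OF f(1,2), of a c] f(6) by simp
  ultimately show ?thesis unfolding relation_space_def using f r(2)
    by (intro CollectI exI[of _ F] exI[of _ "b * N"] exI[of _ "\<lambda>x. a * c x"]) auto
qed

lemma relation_space_mult:
  assumes "x \<in> carrier G" "y \<in> carrier G"
  shows "unit_vec (x \<otimes> y) - unit_vec x - unit_vec y \<in> relation_space"
proof -
  define F where "F = {x, y, x \<otimes> y}"
  have F: "finite F" "F \<subseteq> carrier G" using assms by (auto simp: F_def)
  define c where "c z = ((if z = x \<otimes> y then 1 else 0) + (if z = x then -1 else 0)) + (if z = y then - 1 else 0 :: int)" for z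
  have "finprod G (\<lambda>z. z [^] c z) F = (x \<otimes> y) [^] (1::int) \<otimes> x [^] (-1::int) \<otimes> y [^] (-1::int)"
    unfolding c_def finprod_pow_add[OF F] using F by (subst (1 2 3) finprod_pow_single) (auto simp: F_def)
  also have "\<dots> = \<one>" using assms by (simp add: int_pow_neg m_assoc m_comm[of x] inv_mult_group)
  finally have "finprod G (\<lambda>z. z [^] c z) F = \<one>" .
  then show ?thesis unfolding relation_space_def using F
    by (intro CollectI exI[of _ F] exI[of _ "1"] exI[of _ c]) (auto simp: c_def F_def)
qed

text \<open>The functionals come from linear maps on the rational functions on the carrier that kill
  \<open>relation_space\<close> and are prescribed on the unit vectors of \<open>S\<close>. They
  exist because a basis of \<open>relation_space\<close> stays independent after these unit vectors
  are added.\<close>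

lemma dual_functionals:
  assumes S: "S \<subseteq> carrier G" "finite S" "int_independent G S"
  shows "\<exists>h :: 'a \<Rightarrow> 'a \<Rightarrow> rat. \<forall>s\<in>S. additive_on G (h s) \<and> (\<forall>s'\<in>S. h s s' = (if s = s' then 1 else 0))"
proof -
  interpret V: vector_space "rscale"
    by unfold_locales (auto simp: algebra_simps fun_eq_iff)
  interpret Q: vector_space "(*) :: rat \<Rightarrow> rat \<Rightarrow> rat"
    by unfold_locales (auto simp: algebra_simps)
  interpret VQ: vector_space_pair "rscale" "(*) :: rat \<Rightarrow> rat \<Rightarrow> rat" ..
  have zero: "0 \<in> relation_space" unfolding relation_space_def
    by (intro CollectI exI[of _ "{}"] exI[of _ "1"] exI[of _ "\<lambda>_. 0"]) auto
  have sub: "V.subspace relation_space"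
    unfolding V.subspace_def using zero relation_space_add relation_space_scale by blast
  obtain B where B: "B \<subseteq> relation_space" "V.independent B" "relation_space \<subseteq> V.span B"
    using V.maximal_independent_subset by blast
  have spanB: "V.span B = relation_space" using B V.span_minimal[OF _ sub] by blast
  \<comment> \<open>A dependence writes \<open>unit_vec s\<close> as a relation \<open>u\<close>
    plus a vector supported on \<open>S'\<close>. Then \<open>u\<close> is supported on
    \<open>S\<close> and has value 1 at \<open>s\<close>; clearing denominators gives an integral
    relation on \<open>S\<close> with nonzero exponent at \<open>s\<close>.\<close>
  have notin: "unit_vec s \<notin> V.span (B \<union> unit_vec ` S')" if "S' \<subseteq> S" "s \<in> S" "s \<notin> S'" for s S'
  proof
    assume "unit_vec s \<in> V.span (B \<union> unit_vec ` S')"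
    then obtain u v where uv: "unit_vec s = u + v" "u \<in> relation_space" "v \<in> V.span (unit_vec ` S')"
      unfolding V.span_Un spanB by blast
    have "v \<in> {v. \<forall>x. x \<notin> S' \<longrightarrow> v x = 0}"
    proof (rule subsetD[OF V.span_minimal uv(3)])
      show "V.subspace {v. \<forall>x. x \<notin> S' \<longrightarrow> v x = 0}" unfolding V.subspace_def by auto
    qed auto
    then have v: "v x = 0" if "x \<notin> S'" for x using that by auto
    obtain F N c where f: "finite F" "F \<subseteq> carrier G" "N > (0::int)" "\<And>x. of_int N * u x = of_int (c x)"
     "\<forall>x. x \<notin> F \<longrightarrow> c x = 0" "finprod G (\<lambda>x. x [^] (c x :: int)) F = \<one>"
      using uv(2) unfolding relation_space_def by blast
    have u: "u x = (if x = s then 1 else 0) - v x" for x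
      using fun_cong[OF uv(1), of x] by (simp add: algebra_simps)
    have us: "u s = 1" using u[of s] v[of s] that by simp
    have "u x = 0" if "x \<notin> S" for x using u[of x] v[of x] that \<open>S' \<subseteq> S\<close> \<open>s \<in> S\<close> by auto
    then have cS: "c x = 0" if "x \<notin> S" for x using f(4)[of x] that by simp
    have "finprod G (\<lambda>x. x [^] c x) S = finprod G (\<lambda>x. x [^] c x) (S \<union> F)"
      using S f(1,2) cS by (intro finprod_pow_superset[symmetric]) auto
    also have "\<dots> = finprod G (\<lambda>x. x [^] c x) F"
      using S f(1,2,5) cS by (intro finprod_pow_superset) auto
    finally have "finprod G (\<lambda>x. x [^] c x) S = \<one>" using f(6) by simp
    then have "c s = 0" using S(3) that unfolding int_independent_def by blast
    then show False using f(3) f(4)[of s] us by simp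
  qed
  have "V.independent (B \<union> unit_vec ` S)"
  proof -
    have "finite S' \<Longrightarrow> S' \<subseteq> S \<Longrightarrow> V.independent (B \<union> unit_vec ` S')" for S'
    proof (induction S' rule: finite_induct)
      case empty
      then show ?case using B by simp
    next
      case (insert s S')
      then have "V.independent (insert (unit_vec s) (B \<union> unit_vec ` S'))"
        using notin[of S' s] by (intro V.independent_insertI) auto
      then show ?case by simp
    qed
    then show ?thesis using S(2) by blast
  qed
  note ind = this
  have "\<exists>h. additive_on G h \<and> (\<forall>s'\<in>S. h s' = (if s = s' then 1 else 0 :: rat))" if s: "s \<in> S" for s
  proof -
    obtain \<phi> where \<phi>: "Vector_Spaces.linear rscale (*) \<phi>" "\<And>x. x \<in> B \<union> unit_vec ` S \<Longrightarrow> \<phi> x = (if x = unit_vec s then 1 else 0)"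
      using VQ.linear_independent_extend[OF ind, of "\<lambda>x. if x = unit_vec s then 1 else 0"] by blast
    interpret \<phi>: Vector_Spaces.linear rscale "(*)" \<phi> by (rule \<phi>(1))
    have sB: "unit_vec s \<notin> B" using notin[of "{}" s] s V.span_base by auto
    have "\<phi> x = 0" if "x \<in> B" for x using \<phi>(2)[of x] that sB by auto
    then have \<phi>U: "\<phi> x = 0" if "x \<in> relation_space" for x
      using that \<phi>.eq_0_on_span[of B x] unfolding spanB by blast
    define h where "h x = \<phi> (unit_vec x)" for x
    have "h (x \<otimes> y) = h x + h y" if "x \<in> carrier G" "y \<in> carrier G" for x y
      using \<phi>U[OF relation_space_mult[OF that]] unfolding h_def \<phi>.diff by simp
    moreover have "h s' = (if s = s' then 1 else 0)" if "s' \<in> S" for s'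
    proof -
      have "unit_vec s' = unit_vec s \<longleftrightarrow> s' = s" by (auto dest: fun_cong[of _ _ s'] split: if_splits)
      then show ?thesis unfolding h_def using \<phi>(2)[of "unit_vec s'"] that by auto
    qed
    ultimately show ?thesis unfolding additive_on_def by blast
  qed
  then show ?thesis by metis
qed

text \<open>If \<open>S\<close> were larger than \<open>I\<close>, a nontrivial combination of the
  dual functionals of \<open>S\<close> would vanish on all \<open>g b\<close>, hence everywhere,
  while its value at \<open>s\<close> is the coefficient of \<open>s\<close>.\<close>

lemma card_independent_le:
  fixes g :: "'i \<Rightarrow> 'a"
  assumes fin: "finite I" and g: "g ` I \<subseteq> carrier G"
    and zero: "\<And>f :: 'a \<Rightarrow> rat. additive_on G f \<Longrightarrow> (\<And>b. b \<in> I \<Longrightarrow> f (g b) = 0) \<Longrightarrow> \<forall>x\<in>carrier G. f x = 0"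
    and S: "S \<subseteq> carrier G" "finite S" "int_independent G S"
  shows "card S \<le> card I"
proof (rule ccontr)
  assume "\<not> card S \<le> card I"
  then have less: "card I < card S" by simp
  obtain h :: "'a \<Rightarrow> 'a \<Rightarrow> rat" where h: "\<And>s. s \<in> S \<Longrightarrow> additive_on G (h s)"
    "\<And>s s'. s \<in> S \<Longrightarrow> s' \<in> S \<Longrightarrow> h s s' = (if s = s' then 1 else 0)"
    using dual_functionals[OF S] by blast
  obtain q where q: "\<exists>s\<in>S. q s \<noteq> 0" "\<And>b. b \<in> I \<Longrightarrow> (\<Sum>s\<in>S. q s * h s (g b)) = 0"
    using underdetermined_system[OF fin S(2) less, of "\<lambda>s b. h s (g b)"] by blast
  define f where "f x = (\<Sum>s\<in>S. q s * h s x)" for x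
  have "additive_on G f"
    unfolding additive_on_def f_def using h(1)
    by (auto simp: additive_on_mult algebra_simps sum.distrib intro!: sum.cong simp flip: sum.distrib)
  then have f0: "\<forall>x\<in>carrier G. f x = 0" using zero q(2) unfolding f_def by blast
  obtain s where s: "s \<in> S" "q s \<noteq> 0" using q(1) by blast
  have "f s = (\<Sum>s'\<in>S. if s' = s then q s else 0)"
    unfolding f_def using s h(2) by (intro sum.cong) auto
  also have "\<dots> = q s" using s S(2) by simp
  finally show False using f0 s S(1) by auto
qed

text \<open>Rational functionals serve the upper bound, since duality produces them; real ones serve
  the lower bound, since they will come from real power series. The bound by \<open>card I\<close>
  also makes the supremum in \<open>ab_rank\<close> a maximum.\<close>

theorem ab_rank_eq:
  fixes g :: "'i \<Rightarrow> 'a" and \<Lambda> :: "('a \<Rightarrow> real) set"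
  assumes fin: "finite I" and g: "g ` I \<subseteq> carrier G"
    and zero: "\<And>f :: 'a \<Rightarrow> rat. additive_on G f \<Longrightarrow> (\<And>b. b \<in> I \<Longrightarrow> f (g b) = 0) \<Longrightarrow> \<forall>x\<in>carrier G. f x = 0"
    and add: "\<And>f. f \<in> \<Lambda> \<Longrightarrow> additive_on G f"
    and sep: "\<And>c :: 'i \<Rightarrow> int. (\<And>f. f \<in> \<Lambda> \<Longrightarrow> (\<Sum>b\<in>I. real_of_int (c b) * f (g b)) = 0) \<Longrightarrow> \<forall>b\<in>I. c b = 0"
  shows "ab_rank G = card I"
proof -
  let ?M = "{card S | S. S \<subseteq> carrier G \<and> finite S \<and> int_independent G S}"
  have le: "x \<le> card I" if "x \<in> ?M" for x using that card_independent_le[OF fin g zero] by blast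
  have "card I \<in> ?M"
    using independent_image[OF fin g add sep] g fin by (auto simp: card_image intro!: exI[of _ "g ` I"])
  then show ?thesis unfolding ab_rank_def using le by (intro cSup_eq_maximum) auto
qed

end

section \<open>Lower central quotients\<close>

context group
begin

lemma inv_mult_cancel [simp]: "x \<in> carrier G \<Longrightarrow> y \<in> carrier G \<Longrightarrow> inv x \<otimes> (x \<otimes> y) = y"
  by (simp add: m_assoc[symmetric])

lemma mult_inv_cancel [simp]: "x \<in> carrier G \<Longrightarrow> y \<in> carrier G \<Longrightarrow> x \<otimes> (inv x \<otimes> y) = y"
  by (simp add: m_assoc[symmetric])

lemma commutator_closed [simp]: "u \<in> carrier G \<Longrightarrow> v \<in> carrier G \<Longrightarrow> commutator G u v \<in> carrier G"
  unfolding commutator_def by simp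

lemma conj_commutator:
  assumes "u \<in> carrier G" "v \<in> carrier G" "g \<in> carrier G"
  shows "g \<otimes> commutator G u v \<otimes> inv g = commutator G (g \<otimes> u \<otimes> inv g) (g \<otimes> v \<otimes> inv g)"
  using assms unfolding commutator_def by (simp add: m_assoc inv_mult_group)

lemma inv_commutator: "u \<in> carrier G \<Longrightarrow> v \<in> carrier G \<Longrightarrow> inv commutator G u v = commutator G v u"
  unfolding commutator_def by (simp add: m_assoc inv_mult_group)

lemma commutator_one_left [simp]: "v \<in> carrier G \<Longrightarrow> commutator G \<one> v = \<one>"
  unfolding commutator_def by simp

lemma commutator_one_right [simp]: "v \<in> carrier G \<Longrightarrow> commutator G v \<one> = \<one>"
  unfolding commutator_def by simp

lemma commutator_mult_right:
  "\<lbrakk>u \<in> carrier G; v \<in> carrier G; w \<in> carrier G\<rbrakk>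
    \<Longrightarrow> commutator G u (v \<otimes> w) = commutator G u v \<otimes> (v \<otimes> commutator G u w \<otimes> inv v)"
  unfolding commutator_def by (simp add: m_assoc inv_mult_group)

lemma commutator_mult_left:
  "\<lbrakk>u \<in> carrier G; v \<in> carrier G; w \<in> carrier G\<rbrakk>
    \<Longrightarrow> commutator G (u \<otimes> v) w = (u \<otimes> commutator G v w \<otimes> inv u) \<otimes> commutator G u w"
  unfolding commutator_def by (simp add: m_assoc inv_mult_group)

lemma conj_eq_commutator_mult:
  "a \<in> carrier G \<Longrightarrow> g \<in> carrier G \<Longrightarrow> g \<otimes> a \<otimes> inv g = inv commutator G a g \<otimes> a"
  unfolding commutator_def by (simp add: m_assoc inv_mult_group)

lemma lcs_normal: "lcs G k \<lhd> G"
proof (induction k rule: induct_nat_012)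
  case (ge2 k)
  then interpret L: normal "lcs G (Suc k)" G by simp
  show ?case unfolding lcs.simps
  proof (rule normal_generateI)
    show "{commutator G u v |u v. u \<in> lcs G (Suc k) \<and> v \<in> carrier G} \<subseteq> carrier G"
      using L.subset by auto
  next
    fix h g assume "h \<in> {commutator G u v |u v. u \<in> lcs G (Suc k) \<and> v \<in> carrier G}" and g: "g \<in> carrier G"
    then obtain u v where uv: "h = commutator G u v" "u \<in> lcs G (Suc k)" "v \<in> carrier G" by blast
    have "g \<otimes> h \<otimes> inv g = commutator G (g \<otimes> u \<otimes> inv g) (g \<otimes> v \<otimes> inv g)"
      unfolding uv(1) using uv g L.subset by (intro conj_commutator) auto
    moreover have "g \<otimes> u \<otimes> inv g \<in> lcs G (Suc k)" using uv(2) g by (simp add: L.inv_op_closed2)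
    ultimately show "g \<otimes> h \<otimes> inv g \<in> {commutator G u v |u v. u \<in> lcs G (Suc k) \<and> v \<in> carrier G}"
      using g uv by blast
  qed
qed (simp_all add: normal_self)

lemma lcs_subgroup: "subgroup (lcs G k) G"
  using lcs_normal normal_imp_subgroup by blast

lemma lcs_subset: "lcs G k \<subseteq> carrier G"
  using lcs_subgroup subgroup.subset by blast

lemma lcs_in_carrier: "u \<in> lcs G k \<Longrightarrow> u \<in> carrier G"
  using lcs_subset by blast

lemma commutator_in_lcs:
  "u \<in> lcs G k \<Longrightarrow> v \<in> carrier G \<Longrightarrow> k \<ge> 1 \<Longrightarrow> commutator G u v \<in> lcs G (Suc k)"
  by (cases k) (auto intro!: generate.incl)

lemma lcs_induct [consumes 2, case_names one commutator inv mult]: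
  assumes "u \<in> lcs G (Suc k)" "k \<ge> 1"
    and "P \<one>" "\<And>u v. u \<in> lcs G k \<Longrightarrow> v \<in> carrier G \<Longrightarrow> P (commutator G u v)"
    and "\<And>u. u \<in> lcs G (Suc k) \<Longrightarrow> P u \<Longrightarrow> P (inv u)"
    and "\<And>u v. u \<in> lcs G (Suc k) \<Longrightarrow> P u \<Longrightarrow> v \<in> lcs G (Suc k) \<Longrightarrow> P v \<Longrightarrow> P (u \<otimes> v)"
  shows "P u"
proof -
  obtain j where j: "k = Suc j" using assms(2) by (cases k) auto
  have lk: "lcs G (Suc k) = generate G {commutator G u v | u v. u \<in> lcs G k \<and> v \<in> carrier G}"
    unfolding j by simp
  have "u \<in> generate G {commutator G u v | u v. u \<in> lcs G k \<and> v \<in> carrier G}"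
    using assms(1) unfolding lk .
  then show ?thesis
  proof (induction rule: generate.induct)
    case (inv h)
    then show ?case using assms(4,5) commutator_in_lcs assms(2) by blast
  next
    case (eng h1 h2)
    then show ?case using assms(6) unfolding lk by blast
  qed (use assms in auto)
qed

lemma lcs_Suc_subset: "lcs G (Suc k) \<subseteq> lcs G k"
proof (cases k)
  case (Suc j)
  interpret L: normal "lcs G k" G by (rule lcs_normal)
  have le: "k \<ge> 1" using Suc by simp
  have "u \<in> lcs G k" if "u \<in> lcs G (Suc k)" for u
    using that le
  proof (induction rule: lcs_induct)
    case (commutator u v)
    then have "commutator G u v = u \<otimes> (v \<otimes> inv u \<otimes> inv v)"
      unfolding commutator_def using lcs_in_carrier by (simp add: m_assoc)
    then show ?case using commutator L.inv_op_closed2 by simp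
  qed auto
  then show ?thesis by blast
qed simp

text \<open>A functional on \<open>gr G k\<close>, pulled back to the group so that computations
  avoid cosets. Its values outside \<open>lcs G k\<close> are arbitrary.\<close>

definition gr_functional :: "nat \<Rightarrow> ('a \<Rightarrow> 'c :: ab_group_add) \<Rightarrow> bool" where
  "gr_functional k f \<longleftrightarrow> additive_on (G\<lparr>carrier := lcs G k\<rparr>) f \<and> (\<forall>u \<in> lcs G (Suc k). f u = 0)"

lemma gr_functional_mult:
  "gr_functional k f \<Longrightarrow> u \<in> lcs G k \<Longrightarrow> v \<in> lcs G k \<Longrightarrow> f (u \<otimes> v) = f u + f v"
  unfolding gr_functional_def additive_on_def by simp

lemma gr_functional_zero: "gr_functional k f \<Longrightarrow> u \<in> lcs G (Suc k) \<Longrightarrow> f u = 0"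
  unfolding gr_functional_def by simp

lemma gr_functional_one: "gr_functional k f \<Longrightarrow> f \<one> = 0"
  using gr_functional_zero subgroup.one_closed[OF lcs_subgroup] by blast

lemma gr_functional_inv: "gr_functional k f \<Longrightarrow> u \<in> lcs G k \<Longrightarrow> f (inv u) = - f u"
  using gr_functional_mult[of k f u "inv u"] gr_functional_one[of k f]
    subgroup.m_inv_closed[OF lcs_subgroup] lcs_in_carrier
  by (simp add: eq_neg_iff_add_eq_0 add.commute)

lemma gr_functional_conj:
  assumes f: "gr_functional k f" and k: "k \<ge> 1" and u: "u \<in> lcs G k" and g: "g \<in> carrier G"
  shows "f (g \<otimes> u \<otimes> inv g) = f u"
proof -
  have c: "commutator G u g \<in> lcs G (Suc k)" using commutator_in_lcs u g k by blast
  have "inv commutator G u g \<in> lcs G (Suc k)" using c subgroup.m_inv_closed[OF lcs_subgroup] by blast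
  moreover from this have "inv commutator G u g \<in> lcs G k" using lcs_Suc_subset by blast
  ultimately show ?thesis
    using gr_functional_mult[OF f _ u] gr_functional_zero[OF f] u g lcs_in_carrier
    by (simp add: conj_eq_commutator_mult)
qed

lemma
  assumes k: "k \<ge> 1"
  shows gr_normal: "lcs G (Suc k) \<lhd> G\<lparr>carrier := lcs G k\<rparr>"
    and gr_comm_group: "comm_group (gr G k)"
proof -
  show N: "lcs G (Suc k) \<lhd> G\<lparr>carrier := lcs G k\<rparr>"
    using normal_restrict_supergroup[OF lcs_subgroup lcs_normal lcs_Suc_subset] .
  interpret N: normal "lcs G (Suc k)" "G\<lparr>carrier := lcs G k\<rparr>" by (rule N)
  have grp: "group (gr G k)" unfolding gr_def by (rule N.factorgroup_is_group)
  show "comm_group (gr G k)"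
  proof (rule group.group_comm_groupI[OF grp])
    fix x y assume "x \<in> carrier (gr G k)" "y \<in> carrier (gr G k)"
    then obtain u v where u: "u \<in> lcs G k" "x = lcs G (Suc k) #>\<^bsub>G\<lparr>carrier := lcs G k\<rparr>\<^esub> u"
      and v: "v \<in> lcs G k" "y = lcs G (Suc k) #>\<^bsub>G\<lparr>carrier := lcs G k\<rparr>\<^esub> v"
      unfolding gr_def carrier_FactGroup by auto
    have uv: "u \<otimes> v = commutator G u v \<otimes> (v \<otimes> u)"
      unfolding commutator_def using u v lcs_in_carrier by (simp add: m_assoc)
    have c: "commutator G u v \<in> lcs G (Suc k)" using commutator_in_lcs u v k lcs_in_carrier by blast
    have vu: "v \<otimes> u \<in> lcs G k" "u \<otimes> v \<in> lcs G k" using u v subgroup.m_closed[OF lcs_subgroup] by blast+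
    have "lcs G (Suc k) #>\<^bsub>G\<lparr>carrier := lcs G k\<rparr>\<^esub> (u \<otimes> v) = lcs G (Suc k) #>\<^bsub>G\<lparr>carrier := lcs G k\<rparr>\<^esub> (v \<otimes> u)"
    proof (rule N.repr_independence[symmetric])
      show "v \<otimes> u \<in> carrier (G\<lparr>carrier := lcs G k\<rparr>)" using vu by simp
      show "u \<otimes> v \<in> lcs G (Suc k) #>\<^bsub>G\<lparr>carrier := lcs G k\<rparr>\<^esub> (v \<otimes> u)"
        using uv c unfolding r_coset_def by auto
      show "subgroup (lcs G (Suc k)) (G\<lparr>carrier := lcs G k\<rparr>)" by (rule N.subgroup_axioms)
    qed
    then show "x \<otimes>\<^bsub>gr G k\<^esub> y = y \<otimes>\<^bsub>gr G k\<^esub> x"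
      unfolding gr_def mult_FactGroup u(2) v(2)
      using N.rcos_sum[of u v] N.rcos_sum[of v u] u v by simp
  qed
qed

theorem ab_rank_gr:
  fixes g :: "'i \<Rightarrow> 'a" and \<Lambda> :: "('a \<Rightarrow> real) set"
  assumes k: "k \<ge> 1" and fin: "finite I" and g: "g ` I \<subseteq> lcs G k"
    and zero: "\<And>f :: 'a \<Rightarrow> rat. gr_functional k f \<Longrightarrow> (\<And>b. b \<in> I \<Longrightarrow> f (g b) = 0) \<Longrightarrow> \<forall>u\<in>lcs G k. f u = 0"
    and add: "\<And>f. f \<in> \<Lambda> \<Longrightarrow> gr_functional k f"
    and sep: "\<And>c :: 'i \<Rightarrow> int. (\<And>f. f \<in> \<Lambda> \<Longrightarrow> (\<Sum>b\<in>I. real_of_int (c b) * f (g b)) = 0) \<Longrightarrow> \<forall>b\<in>I. c b = 0"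
  shows "ab_rank (gr G k) = card I"
proof -
  let ?L = "G\<lparr>carrier := lcs G k\<rparr>"
  interpret N: normal "lcs G (Suc k)" ?L using k by (rule gr_normal)
  interpret C: comm_group "gr G k" using k by (rule gr_comm_group)
  define r where "r u = lcs G (Suc k) #>\<^bsub>?L\<^esub> u" for u
  have r_mult: "r (u \<otimes> v) = r u \<otimes>\<^bsub>gr G k\<^esub> r v" if "u \<in> lcs G k" "v \<in> lcs G k" for u v
    unfolding r_def gr_def mult_FactGroup using N.rcos_sum[of u v] that by simp
  have carr: "carrier (gr G k) = r ` lcs G k"
    unfolding gr_def carrier_FactGroup r_def by simp
  have r_eq: "\<exists>n\<in>lcs G (Suc k). v = n \<otimes> u" if "r u = r v" "u \<in> lcs G k" "v \<in> lcs G k" for u v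
  proof -
    have "v \<in> r v" unfolding r_def using N.rcos_self[of v] that N.subgroup_axioms by simp
    then show ?thesis unfolding that(1)[symmetric] unfolding r_def r_coset_def by auto
  qed
  have r_one: "r u = \<one>\<^bsub>gr G k\<^esub>" if "u \<in> lcs G (Suc k)" for u
    unfolding r_def gr_def one_FactGroup using N.coset_join2[of u] that lcs_Suc_subset N.subgroup_axioms by auto
  show ?thesis
  proof (rule C.ab_rank_eq[OF fin, of "\<lambda>b. r (g b)" "{f. additive_on (gr G k) f \<and> (\<exists>f'\<in>\<Lambda>. \<forall>u\<in>lcs G k. f (r u) = f' u)}"])
    show "(\<lambda>b. r (g b)) ` I \<subseteq> carrier (gr G k)" using g carr by auto
  next
    fix f :: "'a set \<Rightarrow> rat"
    assume f: "additive_on (gr G k) f" "\<And>b. b \<in> I \<Longrightarrow> f (r (g b)) = 0"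
    have "gr_functional k (\<lambda>u. f (r u))"
      unfolding gr_functional_def additive_on_def
      using f(1) carr by (auto simp: r_mult r_one additive_on_mult C.additive_on_one)
    then have "\<forall>u\<in>lcs G k. f (r u) = 0" using zero f(2) by blast
    then show "\<forall>x\<in>carrier (gr G k). f x = 0" unfolding carr by blast
  next
    fix f assume "f \<in> {f. additive_on (gr G k) f \<and> (\<exists>f'\<in>\<Lambda>. \<forall>u\<in>lcs G k. f (r u) = f' u)}"
    then show "additive_on (gr G k) f" by blast
  next
    fix c :: "'i \<Rightarrow> int"
    assume c: "\<And>f. f \<in> {f. additive_on (gr G k) f \<and> (\<exists>f'\<in>\<Lambda>. \<forall>u\<in>lcs G k. f (r u) = f' u)}
      \<Longrightarrow> (\<Sum>b\<in>I. real_of_int (c b) * f (r (g b))) = 0"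
    show "\<forall>b\<in>I. c b = 0"
    proof (rule sep)
      fix f' assume f': "f' \<in> \<Lambda>"
      \<comment> \<open>The functional descends to cosets by a choice of representatives;
        \<open>fr\<close> shows that the choice does not matter.\<close>
      define f where "f x = f' (SOME u. u \<in> lcs G k \<and> r u = x)" for x
      have fr: "f (r u) = f' u" if "u \<in> lcs G k" for u
      proof -
        define v where "v = (SOME v. v \<in> lcs G k \<and> r v = r u)"
        have v: "v \<in> lcs G k" "r v = r u" unfolding v_def using someI[of "\<lambda>v. v \<in> lcs G k \<and> r v = r u" u] that by auto
        from r_eq[OF v(2) v(1) that] obtain n where n: "n \<in> lcs G (Suc k)" "u = n \<otimes> v" by blast
        have "f' u = f' v" unfolding n(2)
          using gr_functional_mult[OF add[OF f'] _ v(1), of n] gr_functional_zero[OF add[OF f'] n(1)] n(1) lcs_Suc_subset by auto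
        then show ?thesis unfolding f_def v_def by simp
      qed
      have "f (x \<otimes>\<^bsub>gr G k\<^esub> y) = f x + f y" if xy: "x \<in> carrier (gr G k)" "y \<in> carrier (gr G k)" for x y
      proof -
        obtain u v where uv: "u \<in> lcs G k" "v \<in> lcs G k" "x = r u" "y = r v" using xy unfolding carr by blast
        then have "u \<otimes> v \<in> lcs G k" using subgroup.m_closed[OF lcs_subgroup] by blast
        then show ?thesis unfolding uv(3,4) using uv fr gr_functional_mult[OF add[OF f']] by (simp flip: r_mult)
      qed
      then have "additive_on (gr G k) f" unfolding additive_on_def by blast
      then have "(\<Sum>b\<in>I. real_of_int (c b) * f (r (g b))) = 0" using c fr f' by blast
      moreover have "f (r (g b)) = f' (g b)" if "b \<in> I" for b using fr g that by blast
      ultimately show "(\<Sum>b\<in>I. real_of_int (c b) * f' (g b)) = 0" by simp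
    qed
  qed
qed

definition iter_comm :: "'a \<Rightarrow> 'a list \<Rightarrow> 'a" where
  "iter_comm a gs = foldl (commutator G) a gs"

lemma iter_comm_Nil [simp]: "iter_comm a [] = a"
  by (simp add: iter_comm_def)

lemma iter_comm_Cons [simp]: "iter_comm a (g # gs) = iter_comm (commutator G a g) gs"
  by (simp add: iter_comm_def)

lemma iter_comm_snoc: "iter_comm a (gs @ [g]) = commutator G (iter_comm a gs) g"
  by (simp add: iter_comm_def)

lemma iter_comm_lcs:
  "a \<in> lcs G k \<Longrightarrow> k \<ge> 1 \<Longrightarrow> set gs \<subseteq> carrier G \<Longrightarrow> iter_comm a gs \<in> lcs G (k + length gs)"
proof (induction gs arbitrary: a k)
  case (Cons g gs)
  then have "iter_comm (commutator G a g) gs \<in> lcs G (Suc k + length gs)"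
    by (intro Cons.IH) (auto intro: commutator_in_lcs)
  then show ?case by simp
qed simp

lemma iter_comm_one: "set gs \<subseteq> carrier G \<Longrightarrow> iter_comm \<one> gs = \<one>"
  by (induction gs) auto

lemma iter_comm_has_one: "a \<in> carrier G \<Longrightarrow> set gs \<subseteq> carrier G \<Longrightarrow> \<one> \<in> set gs \<Longrightarrow> iter_comm a gs = \<one>"
  by (induction gs arbitrary: a) (auto simp: iter_comm_one)

text \<open>Induction on the weight: for a fixed generator \<open>x\<close>, the value of
  \<open>f\<close> at the commutator of \<open>u\<close> with \<open>x\<close> is a functional of
  \<open>u\<close> of weight one less. The second argument may be restricted to generators because
  \<open>f\<close> is additive there up to conjugation, which \<open>f\<close> does not see.\<close>

lemma gr_functional_eq_zero:
  fixes f :: "'a \<Rightarrow> 'c :: ab_group_add"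
  assumes S: "S \<subseteq> carrier G" "generate G S = carrier G"
    and f: "gr_functional k f" and k: "k \<ge> 1"
    and zero: "\<And>x gs. x \<in> S \<Longrightarrow> set gs \<subseteq> S \<Longrightarrow> length gs = k - 1 \<Longrightarrow> f (iter_comm x gs) = 0"
  shows "\<forall>u\<in>lcs G k. f u = 0"
  using k f zero
proof (induction k arbitrary: f rule: dec_induct)
  case base
  have "f u = 0" if "u \<in> generate G S" for u
    using that
  proof (induction rule: generate.induct)
    case one
    then show ?case using gr_functional_one[OF base(1)] .
  next
    case (incl h)
    then show ?case using base(2)[of h "[]"] by simp
  next
    case (inv h)
    then show ?case using base(2)[of h "[]"] S gr_functional_inv[OF base(1), of h] by auto
  next
    case (eng h1 h2)
    then show ?case using gr_functional_mult[OF base(1), of h1 h2] generate_in_carrier[OF S(1)] by simp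
  qed
  then show ?case using S by simp
next
  case (step k)
  have fx: "\<forall>u\<in>lcs G k. f (commutator G u x) = 0" if x: "x \<in> S" for x
  proof (rule step.IH)
    have xc: "x \<in> carrier G" using x S by blast
    show "gr_functional k (\<lambda>u. f (commutator G u x))"
      unfolding gr_functional_def additive_on_def
    proof (intro conjI ballI)
      fix u v assume "u \<in> carrier (G\<lparr>carrier := lcs G k\<rparr>)" "v \<in> carrier (G\<lparr>carrier := lcs G k\<rparr>)"
      then have uv: "u \<in> lcs G k" "v \<in> lcs G k" by auto
      have c: "commutator G u x \<in> lcs G (Suc k)" "commutator G v x \<in> lcs G (Suc k)"
        using commutator_in_lcs uv xc step.hyps by auto
      have "u \<otimes> commutator G v x \<otimes> inv u \<in> lcs G (Suc k)"
        using normal.inv_op_closed2[OF lcs_normal] uv lcs_in_carrier c by blast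
      then show "f (commutator G (u \<otimes>\<^bsub>G\<lparr>carrier := lcs G k\<rparr>\<^esub> v) x) = f (commutator G u x) + f (commutator G v x)"
        using uv xc lcs_in_carrier c step.hyps
        by (simp add: commutator_mult_left gr_functional_mult[OF step.prems(1)] gr_functional_conj[OF step.prems(1)] add.commute)
    next
      fix u assume "u \<in> lcs G (Suc k)"
      then show "f (commutator G u x) = 0"
        using gr_functional_zero[OF step.prems(1)] commutator_in_lcs[of u "Suc k" x] xc by simp
    qed
    fix y gs assume "y \<in> S" "set gs \<subseteq> S" "length gs = k - 1"
    then show "f (commutator G (iter_comm y gs) x) = 0"
      using step.prems(2)[of y "gs @ [x]"] x step.hyps by (simp add: iter_comm_snoc)
  qed
  have fv: "f (commutator G u v) = 0" if u: "u \<in> lcs G k" and v: "v \<in> carrier G" for u v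
  proof -
    have v: "v \<in> generate G S" using S v by simp
    have uc: "u \<in> carrier G" using u lcs_in_carrier by blast
    from v show ?thesis
    proof (induction rule: generate.induct)
      case one
      then show ?case using gr_functional_one[OF step.prems(1)] uc by simp
    next
      case (incl h)
      then show ?case using fx u by blast
    next
      case (inv h)
      then have h: "h \<in> carrier G" using S by blast
      have c: "commutator G u (inv h) \<in> lcs G (Suc k)" "commutator G u h \<in> lcs G (Suc k)"
        using commutator_in_lcs u h step.hyps by auto
      have c': "h \<otimes> commutator G u (inv h) \<otimes> inv h \<in> lcs G (Suc k)"
        using normal.inv_op_closed2[OF lcs_normal] h c by blast
      have "0 = f (commutator G u (h \<otimes> inv h))"
        using gr_functional_one[OF step.prems(1)] uc h by simp
      also have "\<dots> = f (commutator G u h) + f (commutator G u (inv h))"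
        unfolding commutator_mult_right[OF uc h inv_closed[OF h]]
        using h c c' by (simp add: gr_functional_mult[OF step.prems(1)] gr_functional_conj[OF step.prems(1)])
      finally show ?case using fx inv u by simp
    next
      case (eng h1 h2)
      then have h: "h1 \<in> carrier G" "h2 \<in> carrier G" using generate_in_carrier[OF S(1)] by auto
      have c: "commutator G u h1 \<in> lcs G (Suc k)" "commutator G u h2 \<in> lcs G (Suc k)"
        using commutator_in_lcs u h step.hyps by auto
      have c': "h1 \<otimes> commutator G u h2 \<otimes> inv h1 \<in> lcs G (Suc k)"
        using normal.inv_op_closed2[OF lcs_normal] h c by blast
      show ?case
        using uc h c c' eng by (simp add: commutator_mult_right gr_functional_mult[OF step.prems(1)] gr_functional_conj[OF step.prems(1)])
    qed
  qed
  show ?case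
  proof
    fix u assume "u \<in> lcs G (Suc k)"
    then show "f u = 0" using step.hyps(1)
      by (induction rule: lcs_induct)
        (auto simp: gr_functional_one[OF step.prems(1)] gr_functional_mult[OF step.prems(1)] gr_functional_inv[OF step.prems(1)] fv)
  qed
qed

end

section \<open>Metabelian groups and the upper bound\<close>

locale metabelian_group = group +
  assumes derived_comm: "a \<in> derived G (carrier G) \<Longrightarrow> b \<in> derived G (carrier G) \<Longrightarrow> a \<otimes> b = b \<otimes> a"
begin

abbreviation "D \<equiv> derived G (carrier G)"

lemma D_subgroup: "subgroup D G"
  by (intro derived_is_subgroup) simp

lemma D_normal: "D \<lhd> G"
  by (intro derived_is_normal normal_self)

lemma D_carrier [simp]: "a \<in> D \<Longrightarrow> a \<in> carrier G"
  using subgroup.subset[OF D_subgroup] by blast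

lemma D_mult [simp]: "a \<in> D \<Longrightarrow> b \<in> D \<Longrightarrow> a \<otimes> b \<in> D"
  using subgroup.m_closed[OF D_subgroup] by blast

lemma D_inv [simp]: "a \<in> D \<Longrightarrow> inv a \<in> D"
  using subgroup.m_inv_closed[OF D_subgroup] by blast

lemma D_one [simp]: "\<one> \<in> D"
  using subgroup.one_closed[OF D_subgroup] by blast

lemma D_conj [simp]: "a \<in> D \<Longrightarrow> g \<in> carrier G \<Longrightarrow> g \<otimes> a \<otimes> inv g \<in> D"
  using normal.inv_op_closed2[OF D_normal] by blast

lemma D_commutator [simp]: "u \<in> carrier G \<Longrightarrow> v \<in> carrier G \<Longrightarrow> commutator G u v \<in> D"
  unfolding derived_def commutator_def by (rule generate.incl) blast

lemma D_left_comm: "a \<in> D \<Longrightarrow> b \<in> D \<Longrightarrow> c \<in> D \<Longrightarrow> a \<otimes> (b \<otimes> c) = b \<otimes> (a \<otimes> c)"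
  using derived_comm[of a b] by (simp add: m_assoc[symmetric])

lemma commutator_D_mult:
  assumes a: "a \<in> D" "b \<in> D" and g: "g \<in> carrier G"
  shows "commutator G (a \<otimes> b) g = commutator G a g \<otimes> commutator G b g"
proof -
  have "a \<otimes> commutator G b g \<otimes> inv a = commutator G b g"
    using a g derived_comm[of a "commutator G b g"] by (simp add: m_assoc)
  then show ?thesis using a g derived_comm[of "commutator G b g" "commutator G a g"]
    by (simp add: commutator_mult_left)
qed

lemma commutator_D_eq: "a \<in> D \<Longrightarrow> g \<in> carrier G \<Longrightarrow> commutator G a g = a \<otimes> inv (g \<otimes> a \<otimes> inv g)"
  unfolding commutator_def by (simp add: m_assoc inv_mult_group)

text \<open>The two sides differ by conjugation with the commutator of \<open>h\<close> and
  \<open>g\<close>, which lies in the abelian group \<open>D\<close>.\<close>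

lemma conj_conj_D:
  assumes "a \<in> D" "g \<in> carrier G" "h \<in> carrier G"
  shows "h \<otimes> (g \<otimes> a \<otimes> inv g) \<otimes> inv h = g \<otimes> (h \<otimes> a \<otimes> inv h) \<otimes> inv g"
proof -
  define c where "c = commutator G h g"
  define b where "b = g \<otimes> (h \<otimes> a \<otimes> inv h) \<otimes> inv g"
  have "c \<in> D" "b \<in> D" using assms unfolding c_def b_def by auto
  then have "b = c \<otimes> b \<otimes> inv c" using derived_comm[of c b] by (simp add: m_assoc)
  also have "\<dots> = h \<otimes> (g \<otimes> a \<otimes> inv g) \<otimes> inv h"
    unfolding b_def c_def commutator_def using assms by (simp add: m_assoc inv_mult_group)
  finally show ?thesis unfolding b_def by simp
qed

text \<open>On \<open>D\<close>, written additively, taking the commutator with \<open>g\<close> is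
  the operator 1 - g. By \<open>conj_conj_D\<close> the operators for \<open>g\<close> and
  \<open>h\<close> commute.\<close>

lemma commutator_swap:
  assumes "a \<in> D" "g \<in> carrier G" "h \<in> carrier G"
  shows "commutator G (commutator G a g) h = commutator G (commutator G a h) g"
proof -
  define x where "x = inv (g \<otimes> a \<otimes> inv g)"
  define y where "y = inv (h \<otimes> a \<otimes> inv h)"
  define z where "z = h \<otimes> (g \<otimes> a \<otimes> inv g) \<otimes> inv h"
  have D: "x \<in> D" "y \<in> D" "z \<in> D" using assms unfolding x_def y_def z_def by auto
  have z': "z = g \<otimes> (h \<otimes> a \<otimes> inv h) \<otimes> inv g" unfolding z_def by (rule conj_conj_D) fact+
  have cz: "inv (h \<otimes> (a \<otimes> x) \<otimes> inv h) = z \<otimes> y"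
    unfolding x_def y_def z_def using assms by (simp add: m_assoc inv_mult_group)
  have cz': "inv (g \<otimes> (a \<otimes> y) \<otimes> inv g) = z \<otimes> x"
    unfolding x_def y_def z' using assms by (simp add: m_assoc inv_mult_group)
  have "commutator G a g = a \<otimes> x" "commutator G a h = a \<otimes> y"
    unfolding x_def y_def using assms by (auto intro: commutator_D_eq)
  moreover have "commutator G (a \<otimes> x) h = (a \<otimes> x) \<otimes> (z \<otimes> y)"
    using commutator_D_eq[OF D_mult[OF assms(1) D(1)] assms(3)] unfolding cz .
  moreover have "commutator G (a \<otimes> y) g = (a \<otimes> y) \<otimes> (z \<otimes> x)"
    using commutator_D_eq[OF D_mult[OF assms(1) D(2)] assms(2)] unfolding cz' .
  moreover have "(a \<otimes> x) \<otimes> (z \<otimes> y) = (a \<otimes> y) \<otimes> (z \<otimes> x)"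
    using D assms(1) by (simp add: m_assoc derived_comm D_left_comm)
  ultimately show ?thesis by simp
qed

text \<open>Both sides of the identity in the proof compare a b c with c b a; moving the letters past each
  other in the two possible orders gives the Hall--Witt identity modulo the second derived group.\<close>
lemma hall_witt:
  assumes "a \<in> carrier G" "b \<in> carrier G" "c \<in> carrier G"
  shows "commutator G (commutator G a b) c \<otimes> commutator G (commutator G b c) a \<otimes> commutator G (commutator G c a) b = \<one>"
proof -
  define x where "x = commutator G a b"
  define y where "y = commutator G b c"
  define z where "z = commutator G c a"
  define u where "u = inv (b \<otimes> z \<otimes> inv b)"
  define v where "v = inv (a \<otimes> y \<otimes> inv a)"
  define w where "w = inv (c \<otimes> x \<otimes> inv c)"
  have D: "x \<in> D" "y \<in> D" "z \<in> D" "u \<in> D" "v \<in> D" "w \<in> D"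
    using assms unfolding x_def y_def z_def u_def v_def w_def by auto
  have id: "x \<otimes> u \<otimes> y = inv v \<otimes> inv z \<otimes> inv w"
    unfolding x_def y_def z_def u_def v_def w_def commutator_def
    using assms by (simp add: m_assoc inv_mult_group)
  have "commutator G x c \<otimes> commutator G y a \<otimes> commutator G z b = (x \<otimes> w) \<otimes> (y \<otimes> v) \<otimes> (z \<otimes> u)"
    using D assms by (simp add: commutator_D_eq u_def v_def w_def)
  also have "\<dots> = (x \<otimes> u \<otimes> y) \<otimes> (w \<otimes> (z \<otimes> v))"
    using D by (simp add: m_assoc derived_comm D_left_comm)
  also have "\<dots> = \<one>" unfolding id using D by (simp add: m_assoc)
  finally show ?thesis unfolding x_def y_def z_def .
qed

lemma iter_comm_D: "a \<in> D \<Longrightarrow> set gs \<subseteq> carrier G \<Longrightarrow> iter_comm a gs \<in> D"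
  by (induction gs arbitrary: a) auto

lemma iter_comm_mult:
  "a \<in> D \<Longrightarrow> b \<in> D \<Longrightarrow> set gs \<subseteq> carrier G \<Longrightarrow> iter_comm (a \<otimes> b) gs = iter_comm a gs \<otimes> iter_comm b gs"
  by (induction gs arbitrary: a b) (auto simp: commutator_D_mult)

lemma iter_comm_inv:
  assumes "a \<in> D" "set gs \<subseteq> carrier G" shows "iter_comm (inv a) gs = inv (iter_comm a gs)"
proof -
  have "iter_comm (inv a) gs \<otimes> iter_comm a gs = \<one>"
    using iter_comm_mult[of "inv a" a gs] assms by (simp add: iter_comm_one)
  then show ?thesis using assms by (intro inv_equality[symmetric]) (auto simp: iter_comm_D)
qed

lemma iter_comm_move: "a \<in> D \<Longrightarrow> g \<in> carrier G \<Longrightarrow> set gs \<subseteq> carrier G \<Longrightarrow> iter_comm a (gs @ g # hs) = iter_comm a (g # gs @ hs)"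
  by (induction gs arbitrary: a) (auto simp: commutator_swap)

lemma iter_comm_perm:
  "a \<in> D \<Longrightarrow> set gs \<subseteq> carrier G \<Longrightarrow> mset gs = mset hs \<Longrightarrow> iter_comm a gs = iter_comm a hs"
proof (induction gs arbitrary: a hs)
  case (Cons g gs)
  have "g \<in> set hs" using Cons.prems(3) by (metis list.set_intros(1) mset_eq_setD)
  then obtain hs1 hs2 where hs: "hs = hs1 @ g # hs2" by (meson split_list)
  have sub: "set hs \<subseteq> carrier G" using Cons.prems mset_eq_setD by metis
  have "iter_comm (commutator G a g) gs = iter_comm (commutator G a g) (hs1 @ hs2)"
    using Cons.prems by (intro Cons.IH) (auto simp: hs)
  then show ?case using Cons.prems sub iter_comm_move[of a g hs1 hs2] unfolding hs by auto
qed simp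

end

text \<open>\<open>b\<close> is total, with value one away from pairs of distinct indices below
  \<open>n\<close>. The relations then hold for arbitrary distinct numbers, and this is why
  \<open>chen_functional\<close> has rules for loops but no bound on indices.\<close>

locale mccool_group = group +
  fixes b :: "nat \<Rightarrow> nat \<Rightarrow> 'a" and n :: nat
  assumes b_closed [simp]: "b i j \<in> carrier G"
    and b_trivial: "\<not> (i < n \<and> j < n \<and> i \<noteq> j) \<Longrightarrow> b i j = \<one>"
    and b_generate: "generate G (range (case_prod b)) = carrier G"
    and b_disj: "distinct [i, j, k, l] \<Longrightarrow> commutator G (b i j) (b k l) = \<one>"
    and b_same: "distinct [i, j, k] \<Longrightarrow> commutator G (b i k) (b j k) = \<one>"
    and b_mix: "distinct [i, j, k] \<Longrightarrow> commutator G (b i j) (b i k \<otimes> b j k) = \<one>"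

locale chen_group = metabelian_group G + mccool_group G b n for G (structure) and b n
begin

abbreviation "b' p \<equiv> case_prod b p"

text \<open>An arbitrary order of the letters is chosen. On \<open>D\<close> it is immaterial by
  \<open>iter_comm_perm\<close>, which is what allows functionals to depend on a multiset.\<close>

definition word_value :: "(nat \<times> nat) multiset \<Rightarrow> 'a \<Rightarrow> 'a" where
  "word_value w a = iter_comm a (map b' (SOME ps. mset ps = w))"

lemma b'_image [simp]: "case_prod b ` A \<subseteq> carrier G"
  by (auto split: prod.splits)

lemma b'_set: "set (map b' ps) \<subseteq> carrier G"
  by simp

lemma word_value: "a \<in> D \<Longrightarrow> word_value (mset ps) a = iter_comm a (map b' ps)"
proof -
  have "mset (SOME qs. mset qs = mset ps) = mset ps" by (rule someI) auto
  then show "a \<in> D \<Longrightarrow> ?thesis" unfolding word_value_def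
    by (intro iter_comm_perm b'_set) (simp_all add: mset_map)
qed

text \<open>The axioms are the group identities of weight \<open>k\<close>: inversion of
  commutators, Hall--Witt and the McCool relations. Words of length other than \<open>k - 2\<close>
  get the value 0, so that the homogeneous axioms hold for all multisets.\<close>

lemma chen_functional_of_gr_functional:
  fixes f :: "'a \<Rightarrow> rat"
  assumes f: "gr_functional k f" and k: "k \<ge> 2"
  shows "chen_functional (\<lambda>p q w. if size w = k - 2 then f (word_value w (commutator G (b' p) (b' q))) else 0)"
proof -
  have bc [simp]: "b' p \<in> carrier G" for p by (cases p) simp
  have in_lcs: "iter_comm (commutator G u v) (map b' ps) \<in> lcs G k"
    if "length ps = k - 2" "u \<in> carrier G" "v \<in> carrier G" for u v ps
  proof -
    have "iter_comm (commutator G u v) (map b' ps) \<in> lcs G (Suc (Suc 0) + length (map b' ps))"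
      using that by (intro iter_comm_lcs b'_set commutator_in_lcs) auto
    moreover have "Suc (Suc 0) + length (map b' ps) = k" using that k by simp
    ultimately show ?thesis by metis
  qed
  have wv: "\<exists>ps. mset ps = w \<and> length ps = size w \<and> (\<forall>a\<in>D. word_value w a = iter_comm a (map b' ps))" for w
    using ex_mset[of w] word_value by (metis size_mset)
  \<comment> \<open>The third McCool relation expands into a commutator times a conjugate of another
    one. The conjugation alters the iterated commutator only by a factor in
    \<open>lcs G (Suc k)\<close>, so \<open>f\<close> sees a plain sum.\<close>
  have lin: "f (word_value w x) + f (word_value w y) = 0"
    if "size w = k - 2" "x \<otimes> (g \<otimes> y \<otimes> inv g) = \<one>" "x = commutator G u v" "y = commutator G u v'"
      "u \<in> carrier G" "v \<in> carrier G" "v' \<in> carrier G" "g \<in> carrier G" for w x y u v v' g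
  proof -
    obtain ps where ps': "length ps = size w" and ps'': "\<forall>a\<in>D. word_value w a = iter_comm a (map b' ps)"
      using wv[of w] by blast
    have ps: "length ps = k - 2" "\<And>a. a \<in> D \<Longrightarrow> word_value w a = iter_comm a (map b' ps)"
      using ps' ps'' that(1) by simp_all
    have xy: "x \<in> D" "y \<in> D" using that by auto
    have "commutator G y g \<in> lcs G (Suc (Suc (Suc 0)))"
      unfolding that(4) using that by (intro commutator_in_lcs) auto
    then have "iter_comm (commutator G y g) (map b' ps) \<in> lcs G (Suc (Suc (Suc 0)) + length (map b' ps))"
      by (intro iter_comm_lcs b'_set) auto
    moreover have "Suc (Suc (Suc 0)) + length (map b' ps) = Suc k" using ps k by simp
    ultimately have c: "iter_comm (commutator G y g) (map b' ps) \<in> lcs G (Suc k)" by metis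
    have L: "iter_comm x (map b' ps) \<in> lcs G k" "iter_comm y (map b' ps) \<in> lcs G k"
      unfolding that(3,4) using that ps by (auto intro: in_lcs)
    have ci: "inv (iter_comm (commutator G y g) (map b' ps)) \<in> lcs G (Suc k)"
      using c subgroup.m_inv_closed[OF lcs_subgroup] by blast
    then have ci': "inv (iter_comm (commutator G y g) (map b' ps)) \<in> lcs G k" using lcs_Suc_subset by blast
    have "\<one> = iter_comm (x \<otimes> (inv commutator G y g \<otimes> y)) (map b' ps)"
      using that(2) xy that(8) by (simp add: conj_eq_commutator_mult[symmetric] iter_comm_one b'_set)
    also have "\<dots> = iter_comm x (map b' ps) \<otimes> (inv (iter_comm (commutator G y g) (map b' ps)) \<otimes> iter_comm y (map b' ps))"
      using xy that(8) by (simp add: iter_comm_mult iter_comm_inv b'_set)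
    finally have "0 = f (iter_comm x (map b' ps)) + f (inv (iter_comm (commutator G y g) (map b' ps)) \<otimes> iter_comm y (map b' ps))"
      using gr_functional_one[OF f] gr_functional_mult[OF f L(1)] subgroup.m_closed[OF lcs_subgroup ci' L(2)] by metis
    also have "f (inv (iter_comm (commutator G y g) (map b' ps)) \<otimes> iter_comm y (map b' ps)) = f (iter_comm y (map b' ps))"
      using gr_functional_mult[OF f ci' L(2)] gr_functional_zero[OF f ci] by simp
    finally show ?thesis using ps(2) xy by simp
  qed
  have wone: "word_value w \<one> = \<one>" for w
    unfolding word_value_def by (intro iter_comm_one b'_set)
  show ?thesis
  proof (unfold_locales, goal_cases)
    case (1 p q w)
    obtain ps where ps: "length ps = size w" "\<forall>a\<in>D. word_value w a = iter_comm a (map b' ps)"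
      using wv[of w] by blast
    have "f (iter_comm (inv commutator G (b' q) (b' p)) (map b' ps)) = - f (iter_comm (commutator G (b' q) (b' p)) (map b' ps))"
      if "size w = k - 2"
      using that ps gr_functional_inv[OF f in_lcs[of ps "b' q" "b' p"]] by (simp add: iter_comm_inv b'_set del: inv_commutator)
    then show ?case using ps by (simp add: inv_commutator)
  next
    case (2 p q r w)
    obtain ps where ps: "mset ps = w" "length ps = size w" using wv[of w] by blast
    have wva: "word_value (add_mset p w) a = iter_comm a (map b' (p # ps))" if "a \<in> D" for a p
      using word_value[OF that, of "p # ps"] ps by simp
    show ?case
    proof (cases "Suc (size w) = k - 2")
      case True
      let ?c = "\<lambda>p q r. iter_comm (commutator G (b' p) (b' q)) (map b' (r # ps))"
      have L: "?c p q r \<in> lcs G k" for p q r using True ps by (intro in_lcs) auto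
      have "?c p q r \<otimes> ?c q r p \<otimes> ?c r p q = iter_comm \<one> (map b' ps)"
        using hall_witt[of "b' p" "b' q" "b' r"] by (simp add: b'_set flip: iter_comm_mult)
      also have "\<dots> = \<one>" by (intro iter_comm_one b'_set)
      finally have "f (?c p q r \<otimes> ?c q r p \<otimes> ?c r p q) = 0" using gr_functional_one[OF f] by simp
      then have "f (?c p q r) + f (?c q r p) + f (?c r p q) = 0"
        using gr_functional_mult[OF f] L subgroup.m_closed[OF lcs_subgroup] by simp
      then show ?thesis using True wva by simp
    qed simp
  next
    case (3 i j k' l w)
    then show ?case using b_disj[of i j k' l] gr_functional_one[OF f] by (simp add: wone)
  next
    case (4 i j k' w)
    then show ?case using b_same[of i j k'] gr_functional_one[OF f] by (simp add: wone)
  next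
    case (5 i j k' w)
    then show ?case using b_mix[of i j k'] lin[of w "commutator G (b i j) (b i k')" "b i k'" "commutator G (b i j) (b j k')" "b i j" "b i k'" "b j k'"]
      by (simp add: commutator_mult_right)
  next
    case (6 i p w)
    then show ?case using b_trivial[of i i] gr_functional_one[OF f] by (simp add: wone)
  next
    case (7 i w p q)
    obtain ps where ps: "mset ps = w" "\<forall>a\<in>D. word_value w a = iter_comm a (map b' ps)"
      using wv[of w] by blast
    have "(i, i) \<in> set ps" using 7 ps(1) by auto
    then have "b' (i, i) \<in> set (map b' ps)" by force
    then have "\<one> \<in> set (map b' ps)" using b_trivial[of i i] by simp
    then show ?case using ps(2) gr_functional_one[OF f] by (simp add: iter_comm_has_one b'_set)
  qed
qed

text \<open>Tests are required only for indices below \<open>n\<close>: as soon as the largest index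
  reaches \<open>n\<close>, the initial bracket contains a trivial generator.\<close>

theorem gr_functional_vanish:
  fixes f :: "'a \<Rightarrow> rat"
  assumes f: "gr_functional (m + 2) f" and m: "m \<ge> 3"
    and pair: "\<And>i j p q. i < j \<Longrightarrow> j < n \<Longrightarrow> p + q = m \<Longrightarrow>
      f (iter_comm (commutator G (b i j) (b j i)) (replicate p (b i j) @ replicate q (b j i))) = 0"
    and tri1: "\<And>i j k p q. i < j \<Longrightarrow> j < k \<Longrightarrow> k < n \<Longrightarrow> p + q = m \<Longrightarrow>
      f (iter_comm (commutator G (b i j) (b i k)) (replicate p (b k j) @ replicate q (b i k))) = 0"
    and tri2: "\<And>i j k s p q. i < j \<Longrightarrow> j < k \<Longrightarrow> k < n \<Longrightarrow> s + p + q = m \<Longrightarrow>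
      f (iter_comm (commutator G (b j k) (b j i)) (replicate s (b j i) @ replicate p (b k j) @ replicate q (b i k))) = 0"
    and tri3: "\<And>i j k s p q. i < j \<Longrightarrow> j < k \<Longrightarrow> k < n \<Longrightarrow> s + p + q = m \<Longrightarrow>
      f (iter_comm (commutator G (b k i) (b k j)) (replicate s (b j i) @ replicate p (b k j) @ replicate q (b i k))) = 0"
  shows "\<forall>u\<in>lcs G (m + 2). f u = 0"
proof -
  define C where "C = (\<lambda>p q w. if size w = m then f (word_value w (commutator G (b' p) (b' q))) else 0)"
  interpret C: chen_functional C
    unfolding C_def using chen_functional_of_gr_functional[OF f] by simp
  have bc [simp]: "b' p \<in> carrier G" for p by (cases p) simp
  have C: "C p q w = f (iter_comm (commutator G (b' p) (b' q)) (map b' ps))" if "mset ps = w" "length ps = m" for p q w ps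
    using that word_value[of "commutator G (b' p) (b' q)" ps] unfolding C_def by auto
  have one: "f (iter_comm \<one> (map b' ps)) = 0" for ps
    using gr_functional_one[OF f] by (simp add: iter_comm_one b'_set)
  have Cz: "C p q w = 0" if "size w = m" for p q w
  proof (rule C.vanish[OF m _ _ _ _ that], goal_cases)
    case (1 i j p q)
    show ?case
    proof (cases "j < n")
      case True
      then show ?thesis
        using pair[OF 1(1) True 1(2)] 1 C[of "replicate p (i,j) @ replicate q (j,i)"] by simp
    next
      case False
      then show ?thesis using b_trivial[of i j] 1 C[of "replicate p (i,j) @ replicate q (j,i)"] one[of "replicate p (i,j) @ replicate q (j,i)"] by simp
    qed
  next
    case (2 i j k p q)
    show ?case
    proof (cases "k < n")
      case True
      then show ?thesis
        using tri1[OF 2(1,2) True 2(3)] 2 C[of "replicate p (k,j) @ replicate q (i,k)"] by simp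
    next
      case False
      then show ?thesis using b_trivial[of i k] 2 C[of "replicate p (k,j) @ replicate q (i,k)"] one[of "replicate p (k,j) @ replicate q (i,k)"] by simp
    qed
  next
    case (3 i j k s p q)
    let ?w = "replicate s (j,i) @ replicate p (k,j) @ replicate q (i,k)"
    show ?case
    proof (cases "k < n")
      case True
      then show ?thesis using tri2[OF 3(1,2) True 3(3)] 3 C[of ?w] by (simp add: add.assoc)
    next
      case False
      then show ?thesis using b_trivial[of j k] 3 C[of ?w] one[of ?w] by (simp add: add.assoc)
    qed
  next
    case (4 i j k s p q)
    let ?w = "replicate s (j,i) @ replicate p (k,j) @ replicate q (i,k)"
    show ?case
    proof (cases "k < n")
      case True
      then show ?thesis using tri3[OF 4(1,2) True 4(3)] 4 C[of ?w] by (simp add: add.assoc)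
    next
      case False
      then show ?thesis using b_trivial[of k i] 4 C[of ?w] one[of ?w] by (simp add: add.assoc)
    qed
  qed
  show ?thesis
  proof (rule gr_functional_eq_zero[OF _ b_generate f])
    show "range b' \<subseteq> carrier G" by auto
    show "1 \<le> m + 2" by simp
    fix x gs assume x: "x \<in> range b'" and gs: "set gs \<subseteq> range b'" "length gs = m + 2 - 1"
    obtain p where p: "x = b' p" using x by blast
    obtain ps where ps: "gs = map b' ps" using gs(1) by (metis ex_map_conv subsetD rangeE)
    \<comment> \<open>Of the \<open>m + 1\<close> entries the first one completes the bracket, and
      \<open>m\<close> remain for the word.\<close>
    obtain q qs where q: "ps = q # qs" "length qs = m" using gs(2) ps by (cases ps) auto
    show "f (iter_comm x gs) = 0"
      using Cz[of "mset qs" p q] C[of qs "mset qs" p q] q(2) unfolding p ps q(1) by simp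
  qed
qed

end

section \<open>Representations in an affine group over power series\<close>

lemma group_hom_commutator:
  assumes "group_hom G H h" "u \<in> carrier G" "v \<in> carrier G"
  shows "h (commutator G u v) = commutator H (h u) (h v)"
proof -
  interpret group_hom G H h by fact
  show ?thesis using assms(2,3) unfolding commutator_def by simp
qed

lemma (in group) commutator_unique:
  assumes "u \<otimes> v = c \<otimes> (v \<otimes> u)" "c \<in> carrier G" "u \<in> carrier G" "v \<in> carrier G"
  shows "commutator G u v = c"
proof -
  have "commutator G u v = (u \<otimes> v) \<otimes> inv (v \<otimes> u)"
    unfolding commutator_def using assms by (simp add: m_assoc inv_mult_group)
  also have "\<dots> = c" using assms(2-) unfolding assms(1) by (simp add: m_assoc)
  finally show ?thesis .
qed

text \<open>The maps u \<mapsto> s u + v on real power series, where s has constant term 1.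
  Commutators are translations, and a commutator with a translation multiplies it by some 1 - s,
  which raises its order; so the order of translations follows the lower central series.\<close>

definition affine_group :: "(real fps \<times> real fps) monoid" where
  "affine_group = \<lparr>carrier = {(s, v). fps_nth s 0 = 1},
     monoid.mult = (\<lambda>(s, v) (s', v'). (s * s', v + s * v')), one = (1, 0)\<rparr>"

lemma affine_carrier [simp]: "a \<in> carrier affine_group \<longleftrightarrow> fps_nth (fst a) 0 = 1"
  unfolding affine_group_def by auto

lemma affine_mult [simp]: "a \<otimes>\<^bsub>affine_group\<^esub> b = (fst a * fst b, snd a + fst a * snd b)"
  unfolding affine_group_def by (auto split: prod.splits)

lemma affine_one [simp]: "\<one>\<^bsub>affine_group\<^esub> = (1, 0)"
  unfolding affine_group_def by simp

lemma affine_group: "group affine_group"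
proof (rule groupI)
  fix x assume "x \<in> carrier affine_group"
  then have "inverse (fst x) * fst x = 1" "fps_nth (inverse (fst x)) 0 = 1"
    by (auto intro!: inverse_mult_eq_1)
  then show "\<exists>y\<in>carrier affine_group. y \<otimes>\<^bsub>affine_group\<^esub> x = \<one>\<^bsub>affine_group\<^esub>"
    by (intro bexI[of _ "(inverse (fst x), - inverse (fst x) * snd x)"]) auto
qed (auto simp: algebra_simps)

interpretation Aff: group affine_group by (rule affine_group)

lemma affine_commutator:
  assumes "a \<in> carrier affine_group" "b \<in> carrier affine_group"
  shows "commutator affine_group a b = (1, (1 - fst b) * snd a + (fst a - 1) * snd b)"
proof -
  let ?c = "(1, (1 - fst b) * snd a + (fst a - 1) * snd b)"
  have "a \<otimes>\<^bsub>affine_group\<^esub> b = ?c \<otimes>\<^bsub>affine_group\<^esub> (b \<otimes>\<^bsub>affine_group\<^esub> a)"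
    by (simp add: algebra_simps)
  moreover have "?c \<in> carrier affine_group" by simp
  ultimately show ?thesis using assms by (intro Aff.commutator_unique)
qed

abbreviation (input) lin_coeff :: "real fps \<times> real fps \<Rightarrow> real" where "lin_coeff a \<equiv> fps_nth (fst a) 1"
abbreviation (input) trans_coeff :: "real fps \<times> real fps \<Rightarrow> real" where "trans_coeff a \<equiv> fps_nth (snd a) 0"

lemma affine_inv_coeffs:
  assumes a: "a \<in> carrier affine_group"
  shows "lin_coeff (inv\<^bsub>affine_group\<^esub> a) = - lin_coeff a"
    and "trans_coeff (inv\<^bsub>affine_group\<^esub> a) = - trans_coeff a"
proof -
  let ?i = "inv\<^bsub>affine_group\<^esub> a"
  have c: "fps_nth (fst a) 0 = 1" "fps_nth (fst ?i) 0 = 1" using a Aff.inv_closed[OF a] by auto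
  have "(fst ?i * fst a, snd ?i + fst ?i * snd a) = (1, 0)"
    using Aff.l_inv[OF a] by simp
  then have "fst ?i * fst a = 1" "snd ?i + fst ?i * snd a = 0" by auto
  then have "fps_nth (fst ?i * fst a) 1 = 0" "fps_nth (snd ?i + fst ?i * snd a) 0 = 0" by auto
  then show "lin_coeff (inv\<^bsub>affine_group\<^esub> a) = - lin_coeff a"
    "trans_coeff (inv\<^bsub>affine_group\<^esub> a) = - trans_coeff a"
    using c by (auto simp: fps_mult_nth_1 fps_mult_nth_0)
qed

definition vanishing_translation :: "nat \<Rightarrow> real fps \<times> real fps \<Rightarrow> bool" where
  "vanishing_translation k a \<longleftrightarrow> fst a = 1 \<and> (\<forall>i<k. fps_nth (snd a) i = 0)"

text \<open>On a translation, the commutator with \<open>b\<close> is multiplication by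
  \<open>1 - fst b\<close>. This series has no constant term, and its linear coefficient is
  \<open>- lin_coeff b\<close>.\<close>

lemma vanishing_translation_commutator:
  assumes a: "vanishing_translation k a" and b: "b \<in> carrier affine_group"
  shows "vanishing_translation (Suc k) (commutator affine_group a b)"
    and "fps_nth (snd (commutator affine_group a b)) (Suc k) = - lin_coeff b * fps_nth (snd a) k"
proof -
  have ac: "a \<in> carrier affine_group" using a by (simp add: vanishing_translation_def)
  have c: "commutator affine_group a b = (1, (1 - fst b) * snd a)"
    using affine_commutator[OF ac b] a by (simp add: vanishing_translation_def)
  have z: "fps_nth (1 - fst b) 0 = 0" using b by simp
  have "(\<Sum>l=0..i. fps_nth (1 - fst b) l * fps_nth (snd a) (i - l)) = 0" if "i \<le> k" for i
  proof (rule sum.neutral, intro ballI)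
    fix l assume "l \<in> {0..i}"
    then show "fps_nth (1 - fst b) l * fps_nth (snd a) (i - l) = 0"
      using z a that by (cases l) (auto simp: vanishing_translation_def)
  qed
  then show "vanishing_translation (Suc k) (commutator affine_group a b)"
    unfolding c vanishing_translation_def by (auto simp: fps_mult_nth less_Suc_eq_le)
  have "fps_nth ((1 - fst b) * snd a) (Suc k) = (\<Sum>l\<in>{1}. fps_nth (1 - fst b) l * fps_nth (snd a) (Suc k - l))"
    unfolding fps_mult_nth
  proof (rule sum.mono_neutral_right)
    show "\<forall>l\<in>{0..Suc k} - {1}. fps_nth (1 - fst b) l * fps_nth (snd a) (Suc k - l) = 0"
    proof
      fix l assume l: "l \<in> {0..Suc k} - {1}"
      then show "fps_nth (1 - fst b) l * fps_nth (snd a) (Suc k - l) = 0"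
        using z a by (cases "l = 0") (auto simp: vanishing_translation_def)
    qed
  qed auto
  then show "fps_nth (snd (commutator affine_group a b)) (Suc k) = - lin_coeff b * fps_nth (snd a) k"
    unfolding c by simp
qed

lemma commutator_first_coeff:
  assumes "a \<in> carrier affine_group" "b \<in> carrier affine_group"
  shows "vanishing_translation 1 (commutator affine_group a b)"
    and "fps_nth (snd (commutator affine_group a b)) 1 = lin_coeff a * trans_coeff b - lin_coeff b * trans_coeff a"
  using assms unfolding affine_commutator[OF assms] vanishing_translation_def
  by (auto simp: fps_mult_nth_1 fps_mult_nth_0)

lemma vanishing_translation_group:
  shows "vanishing_translation k \<one>\<^bsub>affine_group\<^esub>"
    and "vanishing_translation k a \<Longrightarrow> vanishing_translation k (inv\<^bsub>affine_group\<^esub> a)"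
    and "vanishing_translation k a \<Longrightarrow> vanishing_translation k b \<Longrightarrow> vanishing_translation k (a \<otimes>\<^bsub>affine_group\<^esub> b)"
proof -
  show "vanishing_translation k (inv\<^bsub>affine_group\<^esub> a)" if a: "vanishing_translation k a"
  proof -
    have "inv\<^bsub>affine_group\<^esub> a = (1, - snd a)"
      using a by (intro Aff.inv_equality) (auto simp: vanishing_translation_def)
    then show ?thesis using a by (simp add: vanishing_translation_def)
  qed
qed (auto simp: vanishing_translation_def)

context group
begin

text \<open>The shift by one arises because a commutator of arbitrary elements is already a
  translation of order 1. Accordingly \<open>affine_functional\<close> reads off the coefficient
  \<open>k - 1\<close> in weight \<open>k\<close>.\<close>

lemma lcs_vanishing:
  assumes h: "h \<in> hom G affine_group" and k: "k \<ge> 1" and u: "u \<in> lcs G (Suc k)"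
  shows "vanishing_translation k (h u)"
  using k u
proof (induction k arbitrary: u rule: dec_induct)
  interpret h: group_hom G affine_group h
    using h affine_group by unfold_locales
  have hom: "group_hom G affine_group h" ..
  {
    case base
    from base order_refl[of "1::nat"] show ?case
    proof (induction rule: lcs_induct)
      case (commutator u v)
      then show ?case unfolding group_hom_commutator[OF hom lcs_in_carrier[OF commutator(1)] commutator(2)]
        using commutator_first_coeff(1)[OF h.hom_closed h.hom_closed] lcs_in_carrier by blast
    next
      case (inv u)
      then show ?case using vanishing_translation_group(2) lcs_in_carrier[OF inv.hyps(1)] by simp
    next
      case (mult u v)
      then show ?case using vanishing_translation_group(3) lcs_in_carrier[OF mult.hyps(1)] lcs_in_carrier[OF mult.hyps(2)]
        by (simp del: affine_mult)
    qed (use vanishing_translation_group(1) in simp_all)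
  next
    case (step k)
    have "Suc k \<ge> 1" by simp
    from step.prems this show ?case
    proof (induction rule: lcs_induct)
      case (commutator u v)
      then show ?case unfolding group_hom_commutator[OF hom lcs_in_carrier[OF commutator(1)] commutator(2)]
        using vanishing_translation_commutator(1)[OF step.IH h.hom_closed] by blast
    next
      case (inv u)
      then show ?case using vanishing_translation_group(2) lcs_in_carrier[OF inv.hyps(1)] by simp
    next
      case (mult u v)
      then show ?case using vanishing_translation_group(3) lcs_in_carrier[OF mult.hyps(1)] lcs_in_carrier[OF mult.hyps(2)]
        by (simp del: affine_mult)
    qed (use vanishing_translation_group(1) in simp_all)
  }
qed

definition affine_functional :: "nat \<Rightarrow> ('a \<Rightarrow> real fps \<times> real fps) \<Rightarrow> 'a \<Rightarrow> real" where
  "affine_functional k h u = fps_nth (snd (h u)) (k - 1)"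

lemma gr_functional_affine:
  assumes h: "h \<in> hom G affine_group" and k: "k \<ge> 2"
  shows "gr_functional k (affine_functional k h)"
  unfolding gr_functional_def additive_on_def
proof (intro conjI ballI)
  obtain j where j: "k = Suc j" "j \<ge> 1" using k by (cases k) auto
  fix u v assume "u \<in> carrier (G\<lparr>carrier := lcs G k\<rparr>)" "v \<in> carrier (G\<lparr>carrier := lcs G k\<rparr>)"
  then have uv: "u \<in> lcs G k" "v \<in> lcs G k" by auto
  have "fst (h u) = 1" using lcs_vanishing[OF h j(2)] uv unfolding j vanishing_translation_def by blast
  then show "affine_functional k h (u \<otimes>\<^bsub>G\<lparr>carrier := lcs G k\<rparr>\<^esub> v) = affine_functional k h u + affine_functional k h v"
    using hom_mult[OF h lcs_in_carrier[OF uv(1)] lcs_in_carrier[OF uv(2)]]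
    unfolding affine_functional_def by simp
next
  fix u assume "u \<in> lcs G (Suc k)"
  then show "affine_functional k h u = 0"
    using lcs_vanishing[OF h, of k u] k unfolding affine_functional_def vanishing_translation_def by simp
qed

text \<open>The value is a determinant formed from the initial pair times a monomial in the linear
  coefficients. As these coefficients can be varied, independence of commutators becomes
  independence of monomials.\<close>

lemma affine_functional_iter_comm:
  assumes h: "h \<in> hom G affine_group" and x: "x \<in> carrier G" "y \<in> carrier G" and gs: "set gs \<subseteq> carrier G"
    and k: "k = length gs + 2"
  shows "affine_functional k h (iter_comm (commutator G x y) gs) =
    (lin_coeff (h x) * trans_coeff (h y) - lin_coeff (h y) * trans_coeff (h x)) * (\<Prod>g\<leftarrow>gs. - lin_coeff (h g))"
proof -
  interpret h: group_hom G affine_group h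
    using h affine_group by unfold_locales
  have hom: "group_hom G affine_group h" ..
  have it: "fps_nth (snd (h (iter_comm a gs))) (j + length gs) = fps_nth (snd (h a)) j * (\<Prod>g\<leftarrow>gs. - lin_coeff (h g))"
    if "a \<in> carrier G" "vanishing_translation j (h a)" for a j
    using gs that
  proof (induction gs arbitrary: a j)
    case (Cons g gs)
    have hc: "h (commutator G a g) = commutator affine_group (h a) (h g)"
      using Cons.prems by (intro group_hom_commutator[OF hom]) auto
    have hg: "h g \<in> carrier affine_group" using Cons.prems by (intro h.hom_closed) auto
    have "fps_nth (snd (h (iter_comm (commutator G a g) gs))) (Suc j + length gs) =
       fps_nth (snd (h (commutator G a g))) (Suc j) * (\<Prod>g\<leftarrow>gs. - lin_coeff (h g))"
      using Cons.prems vanishing_translation_commutator(1)[OF Cons.prems(3) hg] by (intro Cons.IH) (auto simp: hc)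
    also have "fps_nth (snd (h (commutator G a g))) (Suc j) = - lin_coeff (h g) * fps_nth (snd (h a)) j"
      unfolding hc by (rule vanishing_translation_commutator(2)[OF Cons.prems(3) hg])
    finally show ?case by (simp add: mult_ac)
  qed simp
  have hc: "h (commutator G x y) = commutator affine_group (h x) (h y)"
    using x by (intro group_hom_commutator[OF hom])
  show ?thesis
    using it[of "commutator G x y" 1] commutator_first_coeff[OF h.hom_closed h.hom_closed, OF x] x
    unfolding affine_functional_def k hc by simp
qed

end

text \<open>The factor \<open>x\<close> is there because in the application the sums are known to
  vanish only after multiplication by \<open>x\<close>. It is absorbed by shifting the degree in
  \<open>x\<close>, with coefficient 0 in degree 0.\<close>

lemma bivariate_polynomial_zero:
  fixes e :: "nat \<times> nat \<Rightarrow> real"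
  assumes "\<And>x y. x * (\<Sum>(s, p)\<in>(SIGMA s:{..m}. {..m - s}). e (s, p) * (x ^ s * y ^ p)) = 0"
    and "s \<le> m" "p \<le> m - s"
  shows "e (s, p) = 0"
proof -
  have "(\<Sum>p\<le>m - s. e (s, p) * y ^ p) = 0" for y
  proof -
    define d where "d i = (case i of 0 \<Rightarrow> 0 | Suc s \<Rightarrow> \<Sum>p\<le>m - s. e (s, p) * y ^ p)" for i
    have "(\<Sum>i\<le>Suc m. d i * x ^ i) = 0" for x
    proof -
      have "(\<Sum>i\<le>Suc m. d i * x ^ i) = (\<Sum>s\<le>m. (\<Sum>p\<le>m - s. e (s, p) * y ^ p) * x ^ Suc s)"
        by (subst sum.atMost_Suc_shift) (simp add: d_def)
      also have "\<dots> = x * (\<Sum>s\<le>m. \<Sum>p\<le>m - s. e (s, p) * (x ^ s * y ^ p))"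
        by (simp add: sum_distrib_left sum_distrib_right mult_ac)
      also have "(\<Sum>s\<le>m. \<Sum>p\<le>m - s. e (s, p) * (x ^ s * y ^ p)) = (\<Sum>(s, p)\<in>(SIGMA s:{..m}. {..m - s}). e (s, p) * (x ^ s * y ^ p))"
        by (subst sum.Sigma) auto
      finally show ?thesis using assms(1) by simp
    qed
    then have "d (Suc s) = 0" using polyfun_eq_0[of d "Suc m"] assms(2) by blast
    then show ?thesis by (simp add: d_def)
  qed
  then show ?thesis using polyfun_eq_0[of "\<lambda>p. e (s, p)" "m - s"] assms(3) by blast
qed

section \<open>The rank formula for groups with McCool relations\<close>

definition pair_set :: "nat \<Rightarrow> (nat \<times> nat) set" where
  "pair_set n = {(i, j). i < j \<and> j < n}"

definition triple_set :: "nat \<Rightarrow> (nat \<times> nat \<times> nat) set" where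
  "triple_set n = {(i, j, k). i < j \<and> j < k \<and> k < n}"

text \<open>Monomials of degree \<open>m\<close> in three variables, given by two of the exponents;
  the third one is \<open>m - s - p\<close>.\<close>

definition exponent_set :: "nat \<Rightarrow> (nat \<times> nat) set" where
  "exponent_set m = (SIGMA s:{..m}. {..m - s})"

lemma card_pair_set: "finite (pair_set n) \<and> card (pair_set n) = n choose 2"
proof (induction n)
  case (Suc n)
  have "pair_set (Suc n) = pair_set n \<union> {..<n} \<times> {n}" unfolding pair_set_def by auto
  moreover have "pair_set n \<inter> {..<n} \<times> {n} = {}" unfolding pair_set_def by auto
  ultimately show ?case using Suc by (simp add: card_Un_disjoint numeral_2_eq_2)
qed (simp add: pair_set_def)

lemma card_triple_set: "finite (triple_set n) \<and> card (triple_set n) = n choose 3"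
proof (induction n)
  case (Suc n)
  let ?f = "\<lambda>(i, j). (i, j, n)"
  have "triple_set (Suc n) = triple_set n \<union> ?f ` pair_set n"
    unfolding pair_set_def triple_set_def by (auto simp: image_iff less_Suc_eq)
  moreover have "triple_set n \<inter> ?f ` pair_set n = {}" unfolding pair_set_def triple_set_def by auto
  moreover have "card (?f ` pair_set n) = n choose 2"
    using card_pair_set[of n] by (subst card_image) (auto simp: inj_on_def)
  ultimately show ?case using Suc card_pair_set[of n] by (simp add: card_Un_disjoint numeral_3_eq_3 numeral_2_eq_2)
next
  case 0
  have "triple_set 0 = {}" by (auto simp: triple_set_def)
  then show ?case by (simp add: numeral_3_eq_3)
qed

lemma card_exponent_set: "finite (exponent_set m) \<and> 2 * card (exponent_set m) = (m + 1) * (m + 2)"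
proof -
  have "card (exponent_set m) = (\<Sum>s\<le>m. m - s + 1)" unfolding exponent_set_def by simp
  also have "\<dots> = (\<Sum>s\<le>m. s + 1)" by (rule sum.reindex_bij_witness[of _ "\<lambda>s. m - s" "\<lambda>s. m - s"]) auto
  also have "2 * \<dots> = (m + 1) * (m + 2)" by (induction m) auto
  finally show ?thesis by (simp add: exponent_set_def)
qed

text \<open>One block for each bracket on a triple. The first is smaller, since \<open>cyc\<close>
  has removed the letter \<open>(j, i)\<close> from its words.\<close>

definition triple_exponents :: "nat \<Rightarrow> (nat + (nat \<times> nat) + (nat \<times> nat)) set" where
  "triple_exponents m = Sum_Type.Plus {..m} (Sum_Type.Plus (exponent_set m) (exponent_set m))"

lemma triple_exponents_cases [consumes 1]:
  assumes "u \<in> triple_exponents m"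
  obtains p where "u = Inl p" "p \<le> m"
    | s p where "u = Inr (Inl (s, p))" "(s, p) \<in> exponent_set m"
    | s p where "u = Inr (Inr (s, p))" "(s, p) \<in> exponent_set m"
  using assms unfolding triple_exponents_def Plus_def by auto

type_synonym chen_index = "((nat \<times> nat) \<times> nat) + ((nat \<times> nat \<times> nat) \<times> (nat + (nat \<times> nat) + (nat \<times> nat)))"

definition chen_indices :: "nat \<Rightarrow> nat \<Rightarrow> chen_index set" where
  "chen_indices n m = Sum_Type.Plus (pair_set n \<times> {..m}) (triple_set n \<times> triple_exponents m)"

lemma chen_indices_iff [simp]:
  "Inl ((i, j), p) \<in> chen_indices n m \<longleftrightarrow> (i, j) \<in> pair_set n \<and> p \<le> m"
  "Inr ((i, j, k), u) \<in> chen_indices n m \<longleftrightarrow> (i, j, k) \<in> triple_set n \<and> u \<in> triple_exponents m"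
  unfolding chen_indices_def Plus_def by auto

lemma triple_exponents_iff [simp]:
  "Inl p \<in> triple_exponents m \<longleftrightarrow> p \<le> m"
  "Inr (Inl e) \<in> triple_exponents m \<longleftrightarrow> e \<in> exponent_set m"
  "Inr (Inr e) \<in> triple_exponents m \<longleftrightarrow> e \<in> exponent_set m"
  unfolding triple_exponents_def Plus_def by auto

lemma chen_index_cases [case_names pair triple]:
  obtains i j p where "x = Inl ((i, j), p)" | i j k u where "x = Inr ((i, j, k), u)"
  by (cases x) (metis prod.exhaust)+

lemma chen_indices_finite: "finite (chen_indices n m)"
  unfolding chen_indices_def triple_exponents_def using card_pair_set card_triple_set card_exponent_set by auto

lemma card_chen_indices:
  "card (chen_indices n m) = (m + 1) * (n choose 2) + (m + 1) * (m + 3) * (n choose 3)"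
proof -
  have "card (chen_indices n m) = (n choose 2) * (m + 1) + (n choose 3) * ((m + 1) + 2 * card (exponent_set m))"
    unfolding chen_indices_def triple_exponents_def using card_pair_set[of n] card_triple_set[of n] card_exponent_set[of m, THEN conjunct1]
    by (simp add: card_Plus card_cartesian_product)
  also have "2 * card (exponent_set m) = (m + 1) * (m + 2)" using card_exponent_set by blast
  finally show ?thesis by (simp add: algebra_simps)
qed

context mccool_group
begin

definition chen_element :: "nat \<Rightarrow> chen_index \<Rightarrow> 'a" where
  "chen_element m x = (case x of
     Inl ((i, j), p) \<Rightarrow> iter_comm (commutator G (b i j) (b j i)) (replicate p (b i j) @ replicate (m - p) (b j i))
   | Inr ((i, j, k), y) \<Rightarrow> (case y of
       Inl p \<Rightarrow> iter_comm (commutator G (b i j) (b i k)) (replicate p (b k j) @ replicate (m - p) (b i k))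
     | Inr (Inl (s, p)) \<Rightarrow> iter_comm (commutator G (b j k) (b j i))
         (replicate s (b j i) @ replicate p (b k j) @ replicate (m - s - p) (b i k))
     | Inr (Inr (s, p)) \<Rightarrow> iter_comm (commutator G (b k i) (b k j))
         (replicate s (b j i) @ replicate p (b k j) @ replicate (m - s - p) (b i k))))"

lemma set_replicate_subset: "x \<in> S \<Longrightarrow> set (replicate k x) \<subseteq> S"
  by (auto simp: in_set_replicate)

lemma chen_element_lcs:
  assumes "x \<in> chen_indices n m"
  shows "chen_element m x \<in> lcs G (m + 2)"
proof -
  have *: "iter_comm (commutator G u v) gs \<in> lcs G (m + 2)"
    if "length gs = m" "u \<in> carrier G" "v \<in> carrier G" "set gs \<subseteq> carrier G" for u v gs
    using iter_comm_lcs[of "commutator G u v" "Suc (Suc 0)" gs] commutator_in_lcs[of u "Suc 0" v] that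
    by (simp del: lcs.simps(3) add: add.commute)
  show ?thesis
  proof (cases x rule: chen_index_cases)
    case (pair i j p)
    then show ?thesis using assms unfolding chen_element_def
      by (auto intro!: * set_replicate_subset simp del: lcs.simps add_2_eq_Suc')
  next
    case (triple i j k u)
    from assms have "u \<in> triple_exponents m" unfolding triple by simp
    then show ?thesis unfolding triple chen_element_def
      by (cases rule: triple_exponents_cases)
        (auto intro!: * set_replicate_subset simp del: lcs.simps add_2_eq_Suc' simp: exponent_set_def)
  qed
qed

lemma chen_element_value:
  fixes h defines "c \<equiv> \<lambda>i j. lin_coeff (h (b i j))" and "v \<equiv> \<lambda>i j. trans_coeff (h (b i j))"
  assumes h: "h \<in> hom G affine_group"
  shows "p \<le> m \<Longrightarrow> affine_functional (m + 2) h (chen_element m (Inl ((i, j), p))) =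
      (c i j * v j i - c j i * v i j) * ((- c i j) ^ p * (- c j i) ^ (m - p))"
    and "p \<le> m \<Longrightarrow> affine_functional (m + 2) h (chen_element m (Inr ((i, j, k), Inl p))) =
      (c i j * v i k - c i k * v i j) * ((- c k j) ^ p * (- c i k) ^ (m - p))"
    and "(s, p) \<in> exponent_set m \<Longrightarrow> affine_functional (m + 2) h (chen_element m (Inr ((i, j, k), Inr (Inl (s, p))))) =
      (c j k * v j i - c j i * v j k) * ((- c j i) ^ s * ((- c k j) ^ p * (- c i k) ^ (m - s - p)))"
    and "(s, p) \<in> exponent_set m \<Longrightarrow> affine_functional (m + 2) h (chen_element m (Inr ((i, j, k), Inr (Inr (s, p))))) =
      (c k i * v k j - c k j * v k i) * ((- c j i) ^ s * ((- c k j) ^ p * (- c i k) ^ (m - s - p)))"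
  unfolding chen_element_def c_def v_def exponent_set_def
  by (auto simp: affine_functional_iter_comm[OF h] set_replicate_subset)

end

lemma sum_singleton_product:
  "(\<Sum>x\<in>{a} \<times> S. f x) = (\<Sum>y\<in>S. f (a, y))"
proof -
  have "{a} \<times> S = Pair a ` S" by auto
  then show ?thesis by (simp add: sum.reindex inj_on_def)
qed

text \<open>These are the maps to free groups of rank 2 and 3 followed by arbitrary representations,
  so the images of the free generators can be prescribed. On a triple, two generators conjugating by
  the same letter get inverse values, because their product is inner on the free group of the
  triple.\<close>

locale mccool_group_with_quotients = mccool_group +
  assumes pair_hom: "\<lbrakk>i < j; j < n; a1 \<in> carrier affine_group; a2 \<in> carrier affine_group\<rbrakk> \<Longrightarrow>
      \<exists>h \<in> hom G affine_group. h (b i j) = a1 \<and> h (b j i) = a2 \<and>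
        (\<forall>p q. {p, q} \<noteq> {i, j} \<longrightarrow> h (b p q) = \<one>\<^bsub>affine_group\<^esub>)"
    and triple_hom: "\<lbrakk>i < j; j < k; k < n; a1 \<in> carrier affine_group; a2 \<in> carrier affine_group; a3 \<in> carrier affine_group\<rbrakk> \<Longrightarrow>
      \<exists>h \<in> hom G affine_group. h (b j i) = a1 \<and> h (b k i) = inv\<^bsub>affine_group\<^esub> a1 \<and>
        h (b k j) = a2 \<and> h (b i j) = inv\<^bsub>affine_group\<^esub> a2 \<and> h (b i k) = a3 \<and> h (b j k) = inv\<^bsub>affine_group\<^esub> a3 \<and>
        (\<forall>p q. \<not> (p \<in> {i, j, k} \<and> q \<in> {i, j, k}) \<longrightarrow> h (b p q) = \<one>\<^bsub>affine_group\<^esub>)"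
begin

definition affine_functionals :: "nat \<Rightarrow> ('a \<Rightarrow> real) set" where
  "affine_functionals k = affine_functional k ` hom G affine_group"

lemma separation_pairs:
  fixes c :: "chen_index \<Rightarrow> int"
  assumes c: "\<And>f. f \<in> affine_functionals (m + 2) \<Longrightarrow> (\<Sum>x\<in>chen_indices n m. real_of_int (c x) * f (chen_element m x)) = 0"
    and ij: "(i, j) \<in> pair_set n" and p: "p \<le> m"
  shows "c (Inl ((i, j), p)) = 0"
proof -
  have ij': "i < j" "j < n" using ij by (auto simp: pair_set_def)
  have "(\<Sum>p\<le>m. real_of_int (c (Inl ((i, j), p))) * y ^ p) = 0" for y
  proof -
    \<comment> \<open>The linear coefficients are \<open>- y\<close> and \<open>- 1\<close> and the
      translation parts 1 and 0, so the determinant is 1 and the commutator with index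
      \<open>p\<close> has the value \<open>y ^ p\<close>.\<close>
    obtain h where h: "h \<in> hom G affine_group" "h (b i j) = (1 - fps_const y * fps_X, 1)" "h (b j i) = (1 - fps_X, 0)"
      "\<And>p q. {p, q} \<noteq> {i, j} \<Longrightarrow> h (b p q) = \<one>\<^bsub>affine_group\<^esub>"
      using pair_hom[OF ij', of "(1 - fps_const y * fps_X, 1)" "(1 - fps_X, 0)"] by auto
    define f where "f = affine_functional (m + 2) h"
    have z: "lin_coeff (h (b p q)) = 0" "trans_coeff (h (b p q)) = 0" if "{p, q} \<noteq> {i, j}" for p q
      using h(4)[OF that] by auto
    have zz: "lin_coeff (h (b p q)) * trans_coeff (h (b p' q')) - lin_coeff (h (b p' q')) * trans_coeff (h (b p q)) = 0"
      if "{p, q} \<noteq> {i, j} \<or> {p', q'} \<noteq> {i, j}" for p q p' q'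
      using that
    proof (elim disjE)
      assume "{p, q} \<noteq> {i, j}"
      from z[OF this] show ?thesis by simp
    next
      assume "{p', q'} \<noteq> {i, j}"
      from z[OF this] show ?thesis by simp
    qed
    have 1: "f (chen_element m (Inl ((i, j), p))) = y ^ p" if "p \<le> m" for p
      unfolding f_def using chen_element_value(1)[OF h(1) that] h(2,3) by simp
    have 2: "f (chen_element m (Inl ((i', j'), p))) = 0" if "p \<le> m" "(i', j') \<in> pair_set n" "(i', j') \<noteq> (i, j)" for i' j' p
    proof -
      have "{i', j'} \<noteq> {i, j}" using that(2,3) ij' by (auto simp: pair_set_def doubleton_eq_iff)
      then show ?thesis unfolding f_def chen_element_value(1)[OF h(1) that(1)] using z[of i' j'] by simp
    qed
    have 3: "f (chen_element m (Inr ((i', j', k'), u))) = 0"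
      if "(i', j', k') \<in> triple_set n" "u \<in> triple_exponents m" for i' j' k' u
    proof -
      have d: "i' < j'" "j' < k'" using that(1) by (auto simp: triple_set_def)
      \<comment> \<open>The two generators in the initial bracket of a triple have different
        underlying pairs, so \<open>h\<close> is trivial on at least one of them.\<close>
      have n1: "{i', j'} \<noteq> {i, j} \<or> {i', k'} \<noteq> {i, j}" "{j', k'} \<noteq> {i, j} \<or> {j', i'} \<noteq> {i, j}" "{k', i'} \<noteq> {i, j} \<or> {k', j'} \<noteq> {i, j}"
        using d by (auto simp: doubleton_eq_iff)
      from that(2) show ?thesis
      proof (cases rule: triple_exponents_cases)
        case (1 p)
        show ?thesis unfolding 1(1) f_def chen_element_value(2)[OF h(1) 1(2)] zz[OF n1(1)] by simp
      next
        case (2 s p)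
        show ?thesis unfolding 2(1) f_def chen_element_value(3)[OF h(1) 2(2)] zz[OF n1(2)] by simp
      next
        case (3 s p)
        show ?thesis unfolding 3(1) f_def chen_element_value(4)[OF h(1) 3(2)] zz[OF n1(3)] by simp
      qed
    qed
    have "0 = (\<Sum>x\<in>chen_indices n m. real_of_int (c x) * f (chen_element m x))"
      using c[of f] h(1) by (auto simp: f_def affine_functionals_def)
    also have "\<dots> = (\<Sum>x\<in>Inl ` ({(i, j)} \<times> {..m}). real_of_int (c x) * f (chen_element m x))"
    proof (rule sum.mono_neutral_right[OF chen_indices_finite])
      show "Inl ` ({(i, j)} \<times> {..m}) \<subseteq> chen_indices n m" using ij by auto
      show "\<forall>x\<in>chen_indices n m - Inl ` ({(i, j)} \<times> {..m}). real_of_int (c x) * f (chen_element m x) = 0"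
      proof
        fix x assume x: "x \<in> chen_indices n m - Inl ` ({(i, j)} \<times> {..m})"
        show "real_of_int (c x) * f (chen_element m x) = 0"
        proof (cases x rule: chen_index_cases)
          case (pair i' j' p)
          then show ?thesis using x 2[of p i' j'] by auto
        next
          case (triple i' j' k' u)
          then show ?thesis using x 3[of i' j' k' u] by auto
        qed
      qed
    qed
    also have "\<dots> = (\<Sum>p\<le>m. real_of_int (c (Inl ((i, j), p))) * f (chen_element m (Inl ((i, j), p))))"
      by (subst sum.reindex) (simp_all add: sum_singleton_product)
    also have "\<dots> = (\<Sum>p\<le>m. real_of_int (c (Inl ((i, j), p))) * y ^ p)"
      using 1 by (intro sum.cong) auto
    finally show ?thesis by simp
  qed
  then have "real_of_int (c (Inl ((i, j), p))) = 0"
    using polyfun_eq_0[of "\<lambda>p. real_of_int (c (Inl ((i, j), p)))" m] p by blast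
  then show ?thesis by simp
qed

text \<open>The pairs have to be treated before: the functional of a triple may be nonzero on the
  commutators of the pairs contained in it, so their coefficients must already be known to
  vanish.\<close>

lemma separation_triples:
  fixes c :: "chen_index \<Rightarrow> int"
  assumes c: "\<And>f. f \<in> affine_functionals (m + 2) \<Longrightarrow> (\<Sum>x\<in>chen_indices n m. real_of_int (c x) * f (chen_element m x)) = 0"
    and ijk: "(i, j, k) \<in> triple_set n" and u: "u \<in> triple_exponents m"
  shows "c (Inr ((i, j, k), u)) = 0"
proof -
  have ijk': "i < j" "j < k" "k < n" using ijk by (auto simp: triple_set_def)
  have cp: "c (Inl y) = 0" if "Inl y \<in> chen_indices n m" for y
    using separation_pairs[OF c] that by (cases y) auto
  define A where "A y = (\<Sum>p\<le>m. real_of_int (c (Inr ((i, j, k), Inl p))) * y ^ p)" for y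
  define B where "B x y = (\<Sum>(s, p)\<in>exponent_set m. real_of_int (c (Inr ((i, j, k), Inr (Inl (s, p))))) * (x ^ s * y ^ p))" for x y
  define E where "E x y = (\<Sum>(s, p)\<in>exponent_set m. real_of_int (c (Inr ((i, j, k), Inr (Inr (s, p))))) * (x ^ s * y ^ p))" for x y
  \<comment> \<open>\<open>x\<close>, \<open>y\<close> and 1 are the values of the canonical letters
    \<open>(j, i)\<close>, \<open>(k, j)\<close>, \<open>(i, k)\<close>, and \<open>v1\<close>,
    \<open>v2\<close>, \<open>v3\<close> their translation parts. The three determinants are the
    coordinates of the cross product of (x, y, 1) and (v1, v2, v3).\<close>
  have main: "(y * v3 - v2) * A y + (v1 - x * v3) * B x y + (x * v2 - y * v1) * E x y = 0" for x y v1 v2 v3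
  proof -
    let ?a1 = "(1 - fps_const x * fps_X, fps_const v1)"
    let ?a2 = "(1 - fps_const y * fps_X, fps_const v2)"
    let ?a3 = "(1 - fps_X, fps_const v3)"
    have ac: "?a1 \<in> carrier affine_group" "?a2 \<in> carrier affine_group" "?a3 \<in> carrier affine_group" by auto
    obtain h where h: "h \<in> hom G affine_group" "h (b j i) = ?a1" "h (b k i) = inv\<^bsub>affine_group\<^esub> ?a1"
      "h (b k j) = ?a2" "h (b i j) = inv\<^bsub>affine_group\<^esub> ?a2" "h (b i k) = ?a3" "h (b j k) = inv\<^bsub>affine_group\<^esub> ?a3"
      "\<And>p q. \<not> (p \<in> {i, j, k} \<and> q \<in> {i, j, k}) \<Longrightarrow> h (b p q) = \<one>\<^bsub>affine_group\<^esub>"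
      using triple_hom[OF ijk' ac] by blast
    define f where "f = affine_functional (m + 2) h"
    have co: "lin_coeff (h (b j i)) = - x" "lin_coeff (h (b k i)) = x" "lin_coeff (h (b k j)) = - y"
      "lin_coeff (h (b i j)) = y" "lin_coeff (h (b i k)) = - 1" "lin_coeff (h (b j k)) = 1"
      "trans_coeff (h (b j i)) = v1" "trans_coeff (h (b k i)) = - v1" "trans_coeff (h (b k j)) = v2"
      "trans_coeff (h (b i j)) = - v2" "trans_coeff (h (b i k)) = v3" "trans_coeff (h (b j k)) = - v3"
      unfolding h(2-7) affine_inv_coeffs[OF ac(1)] affine_inv_coeffs[OF ac(2)] affine_inv_coeffs[OF ac(3)] by simp_all
    have z: "lin_coeff (h (b p q)) = 0" "trans_coeff (h (b p q)) = 0" if "\<not> (p \<in> {i, j, k} \<and> q \<in> {i, j, k})" for p q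
      using h(8)[OF that] by auto
    have zz: "lin_coeff (h (b p q)) * trans_coeff (h (b p' q')) - lin_coeff (h (b p' q')) * trans_coeff (h (b p q)) = 0"
      if "\<not> (p \<in> {i, j, k} \<and> q \<in> {i, j, k}) \<or> \<not> (p' \<in> {i, j, k} \<and> q' \<in> {i, j, k})" for p q p' q'
      using that
    proof (elim disjE)
      assume "\<not> (p \<in> {i, j, k} \<and> q \<in> {i, j, k})"
      from z[OF this] show ?thesis by simp
    next
      assume "\<not> (p' \<in> {i, j, k} \<and> q' \<in> {i, j, k})"
      from z[OF this] show ?thesis by simp
    qed
    have 1: "f (chen_element m (Inr ((i, j, k), Inl p))) = (y * v3 - v2) * y ^ p" if "p \<le> m" for p
      unfolding f_def chen_element_value(2)[OF h(1) that] co by simp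
    have 2: "f (chen_element m (Inr ((i, j, k), Inr (Inl (s, p))))) = (v1 - x * v3) * (x ^ s * y ^ p)"
      if "(s, p) \<in> exponent_set m" for s p
      unfolding f_def chen_element_value(3)[OF h(1) that] co by simp
    have 3: "f (chen_element m (Inr ((i, j, k), Inr (Inr (s, p))))) = (x * v2 - y * v1) * (x ^ s * y ^ p)"
      if "(s, p) \<in> exponent_set m" for s p
      unfolding f_def chen_element_value(4)[OF h(1) that] co by simp
    have 4: "f (chen_element m (Inr ((i', j', k'), u))) = 0"
      if "(i', j', k') \<in> triple_set n" "(i', j', k') \<noteq> (i, j, k)" "u \<in> triple_exponents m" for i' j' k' u
    proof -
      have d: "i' < j'" "j' < k'" using that(1) by (auto simp: triple_set_def)
      have "\<not> (i' \<in> {i, j, k} \<and> j' \<in> {i, j, k} \<and> k' \<in> {i, j, k})"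
        using that(2) d ijk' by auto
      then have n1: "\<not> (i' \<in> {i, j, k} \<and> j' \<in> {i, j, k}) \<or> \<not> (i' \<in> {i, j, k} \<and> k' \<in> {i, j, k})"
         "\<not> (j' \<in> {i, j, k} \<and> k' \<in> {i, j, k}) \<or> \<not> (j' \<in> {i, j, k} \<and> i' \<in> {i, j, k})"
         "\<not> (k' \<in> {i, j, k} \<and> i' \<in> {i, j, k}) \<or> \<not> (k' \<in> {i, j, k} \<and> j' \<in> {i, j, k})"
        by blast+
      from that(3) show ?thesis
      proof (cases rule: triple_exponents_cases)
        case (1 p)
        show ?thesis unfolding 1(1) f_def chen_element_value(2)[OF h(1) 1(2)] zz[OF n1(1)] by simp
      next
        case (2 s p)
        show ?thesis unfolding 2(1) f_def chen_element_value(3)[OF h(1) 2(2)] zz[OF n1(2)] by simp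
      next
        case (3 s p)
        show ?thesis unfolding 3(1) f_def chen_element_value(4)[OF h(1) 3(2)] zz[OF n1(3)] by simp
      qed
    qed
    let ?U = "triple_exponents m"
    have finE: "finite (exponent_set m)" using card_exponent_set by blast
    have "0 = (\<Sum>x\<in>chen_indices n m. real_of_int (c x) * f (chen_element m x))"
      using c[of f] h(1) by (auto simp: f_def affine_functionals_def)
    also have "\<dots> = (\<Sum>x\<in>Inr ` ({(i, j, k)} \<times> ?U). real_of_int (c x) * f (chen_element m x))"
    proof (rule sum.mono_neutral_right[OF chen_indices_finite])
      show "Inr ` ({(i, j, k)} \<times> ?U) \<subseteq> chen_indices n m" using ijk by auto
      show "\<forall>x\<in>chen_indices n m - Inr ` ({(i, j, k)} \<times> ?U). real_of_int (c x) * f (chen_element m x) = 0"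
      proof
        fix x assume x: "x \<in> chen_indices n m - Inr ` ({(i, j, k)} \<times> ?U)"
        show "real_of_int (c x) * f (chen_element m x) = 0"
        proof (cases x rule: chen_index_cases)
          case (pair i' j' p)
          then show ?thesis using x cp[of "((i', j'), p)"] by simp
        next
          case (triple i' j' k' u)
          have "(i', j', k') \<in> triple_set n" "u \<in> ?U" "(i', j', k') \<noteq> (i, j, k)"
            using x unfolding triple by auto
          then show ?thesis using 4 unfolding triple by simp
        qed
      qed
    qed
    also have "\<dots> = (\<Sum>u\<in>?U. real_of_int (c (Inr ((i, j, k), u))) * f (chen_element m (Inr ((i, j, k), u))))"
      by (subst sum.reindex) (simp_all add: sum_singleton_product)
    also have "\<dots> = (\<Sum>p\<le>m. real_of_int (c (Inr ((i, j, k), Inl p))) * f (chen_element m (Inr ((i, j, k), Inl p)))) +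
      ((\<Sum>e\<in>exponent_set m. real_of_int (c (Inr ((i, j, k), Inr (Inl e)))) * f (chen_element m (Inr ((i, j, k), Inr (Inl e))))) +
       (\<Sum>e\<in>exponent_set m. real_of_int (c (Inr ((i, j, k), Inr (Inr e)))) * f (chen_element m (Inr ((i, j, k), Inr (Inr e))))))"
      using finE unfolding triple_exponents_def by (simp add: sum.Plus)
    also have "(\<Sum>p\<le>m. real_of_int (c (Inr ((i, j, k), Inl p))) * f (chen_element m (Inr ((i, j, k), Inl p)))) = (y * v3 - v2) * A y"
      unfolding A_def sum_distrib_left by (intro sum.cong) (auto simp: 1)
    also have "(\<Sum>e\<in>exponent_set m. real_of_int (c (Inr ((i, j, k), Inr (Inl e)))) * f (chen_element m (Inr ((i, j, k), Inr (Inl e))))) = (v1 - x * v3) * B x y"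
      unfolding B_def sum_distrib_left by (intro sum.cong) (auto simp: 2)
    also have "(\<Sum>e\<in>exponent_set m. real_of_int (c (Inr ((i, j, k), Inr (Inr e)))) * f (chen_element m (Inr ((i, j, k), Inr (Inr e))))) = (x * v2 - y * v1) * E x y"
      unfolding E_def sum_distrib_left by (intro sum.cong) (auto simp: 3)
    finally show ?thesis by simp
  qed
  \<comment> \<open>\<open>A\<close> does not contain \<open>x\<close>, so \<open>x = 0\<close>
    isolates it. The translation vectors (0, 0, 1) and (0, 1, 0) then isolate \<open>B\<close> and
    \<open>E\<close> up to the factor \<open>x\<close>.\<close>
  have A0: "A y = 0" for y using main[of y 0 "-1" 0 0] by simp
  have B0: "x * B x y = 0" for x y using main[of y 1 0 0 x] A0 by simp
  have E0: "x * E x y = 0" for x y using main[of y 0 1 0 x] A0 by simp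
  from u show ?thesis
  proof (cases rule: triple_exponents_cases)
    case (1 p)
    have "real_of_int (c (Inr ((i, j, k), Inl p))) = 0"
      using polyfun_eq_0[of "\<lambda>p. real_of_int (c (Inr ((i, j, k), Inl p)))" m] A0 1(2) unfolding A_def by blast
    then show ?thesis using 1 by simp
  next
    case (2 s p)
    have "real_of_int (c (Inr ((i, j, k), Inr (Inl (s, p))))) = 0"
      using 2(2) B0 bivariate_polynomial_zero[where e = "\<lambda>e. real_of_int (c (Inr ((i, j, k), Inr (Inl e))))" and m = m]
      unfolding B_def exponent_set_def by auto
    then show ?thesis using 2 by simp
  next
    case (3 s p)
    have "real_of_int (c (Inr ((i, j, k), Inr (Inr (s, p))))) = 0"
      using 3(2) E0 bivariate_polynomial_zero[where e = "\<lambda>e. real_of_int (c (Inr ((i, j, k), Inr (Inr e))))" and m = m]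
      unfolding E_def exponent_set_def by auto
    then show ?thesis using 3 by simp
  qed
qed

end

locale chen_group_with_quotients = chen_group G b n + mccool_group_with_quotients G b n for G (structure) and b n
begin

theorem ab_rank_gr_eq:
  assumes m: "m \<ge> 3"
  shows "ab_rank (gr G (m + 2)) = card (chen_indices n m)"
proof (rule ab_rank_gr[OF _ chen_indices_finite, where g = "chen_element m" and \<Lambda> = "affine_functionals (m + 2)"])
  show "chen_element m ` chen_indices n m \<subseteq> lcs G (m + 2)" using chen_element_lcs by blast
  show "gr_functional (m + 2) f" if "f \<in> affine_functionals (m + 2)" for f
    using that gr_functional_affine by (auto simp: affine_functionals_def)
next
  fix f :: "'a \<Rightarrow> rat"
  assume f: "gr_functional (m + 2) f" and z: "\<And>x. x \<in> chen_indices n m \<Longrightarrow> f (chen_element m x) = 0"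
  show "\<forall>u\<in>lcs G (m + 2). f u = 0"
  proof (rule gr_functional_vanish[OF f m], goal_cases)
    case (1 i j p q)
    then have "q = m - p" by simp
    then show ?case using z[of "Inl ((i, j), p)"] 1 by (simp add: pair_set_def chen_element_def)
  next
    case (2 i j k p q)
    then have "q = m - p" by simp
    then show ?case using z[of "Inr ((i, j, k), Inl p)"] 2 by (simp add: triple_set_def chen_element_def)
  next
    case (3 i j k s p q)
    then have "q = m - s - p" "s \<le> m" "p \<le> m - s" by simp_all
    then show ?case using z[of "Inr ((i, j, k), Inr (Inl (s, p)))"] 3(1-3)
      by (simp add: triple_set_def chen_element_def exponent_set_def)
  next
    case (4 i j k s p q)
    then have "q = m - s - p" "s \<le> m" "p \<le> m - s" by simp_all
    then show ?case using z[of "Inr ((i, j, k), Inr (Inr (s, p)))"] 4(1-3)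
      by (simp add: triple_set_def chen_element_def exponent_set_def)
  qed
next
  fix c :: "chen_index \<Rightarrow> int"
  assume c: "\<And>f. f \<in> affine_functionals (m + 2) \<Longrightarrow> (\<Sum>x\<in>chen_indices n m. real_of_int (c x) * f (chen_element m x)) = 0"
  show "\<forall>x\<in>chen_indices n m. c x = 0"
  proof
    fix x assume x: "x \<in> chen_indices n m"
    show "c x = 0"
    proof (cases x rule: chen_index_cases)
      case (pair i j p)
      then show ?thesis using x separation_pairs[OF c] by simp
    next
      case (triple i j k u)
      then show ?thesis using x separation_triples[OF c] by simp
    qed
  qed
qed simp

end

section \<open>Passage to the maximal metabelian quotient\<close>

lemma (in group) derived_generate_commutators:
  "derived G H = generate G {commutator G u v | u v. u \<in> H \<and> v \<in> H}"
proof -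
  have "(\<Union>u\<in>H. \<Union>v\<in>H. {u \<otimes> v \<otimes> inv u \<otimes> inv v}) = {commutator G u v | u v. u \<in> H \<and> v \<in> H}"
    unfolding commutator_def by auto
  then show ?thesis unfolding derived_def by simp
qed

text \<open>The derived subgroup is mapped to translations, which commute. Hence every affine
  representation factors through the quotient by the second derived subgroup.\<close>

lemma (in group) affine_second_derived:
  assumes h: "h \<in> hom G affine_group" and u: "u \<in> derived G (derived G (carrier G))"
  shows "h u = \<one>\<^bsub>affine_group\<^esub>"
proof -
  interpret h: group_hom G affine_group h
    using h affine_group by unfold_locales
  have hom: "group_hom G affine_group h" ..
  have D: "derived G (carrier G) \<subseteq> carrier G" by (intro derived_in_carrier) simp
  have 1: "vanishing_translation 0 (h u)" if "u \<in> derived G (carrier G)" for u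
    using that unfolding derived_generate_commutators
  proof (induction rule: generate.induct)
    case (incl u)
    then show ?case using commutator_first_coeff(1)[OF h.hom_closed h.hom_closed]
      by (auto simp: group_hom_commutator[OF hom] vanishing_translation_def)
  next
    case (inv u)
    then have "vanishing_translation 0 (h u)" "u \<in> carrier G" using commutator_first_coeff(1)[OF h.hom_closed h.hom_closed]
      by (auto simp: group_hom_commutator[OF hom] vanishing_translation_def)
    then show ?case using vanishing_translation_group(2) by simp
  next
    case (eng u v)
    then have "u \<in> carrier G" "v \<in> carrier G" using D unfolding derived_generate_commutators by auto
    then show ?case using vanishing_translation_group(3)[OF eng.IH] by simp
  qed (simp add: vanishing_translation_def)
  have 2: "h (commutator G u v) = \<one>\<^bsub>affine_group\<^esub>" if "u \<in> derived G (carrier G)" "v \<in> derived G (carrier G)" for u v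
  proof -
    have c: "u \<in> carrier G" "v \<in> carrier G" using that D by auto
    show ?thesis using 1[OF that(1)] 1[OF that(2)]
      unfolding group_hom_commutator[OF hom c] affine_commutator[OF h.hom_closed[OF c(1)] h.hom_closed[OF c(2)]]
      by (simp add: vanishing_translation_def)
  qed
  have sub: "{commutator G u v | u v. u \<in> derived G (carrier G) \<and> v \<in> derived G (carrier G)} \<subseteq> carrier G"
    using subsetD[OF D] by (auto intro!: commutator_closed)
  show ?thesis
    using u unfolding derived_generate_commutators[of "derived G (carrier G)"]
  proof (induction rule: generate.induct)
    case (incl u)
    then show ?case using 2 by auto
  next
    case (inv u)
    then have "h u = \<one>\<^bsub>affine_group\<^esub>" using 2 by auto
    moreover have "u \<in> carrier G" using inv sub by blast
    ultimately show ?case using Aff.inv_one by simp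
  next
    case (eng u v)
    then have "u \<in> carrier G" "v \<in> carrier G" using generate_in_carrier[OF sub] by auto
    then show ?case using eng.IH by simp
  qed simp
qed

lemma (in group) metabelian_quotient:
  "metabelian_group (G Mod ((derived G ^^ 2) (carrier G)))"
  "(derived G ^^ 2) (carrier G) \<lhd> G"
proof -
  define N where "N = (derived G ^^ 2) (carrier G)"
  have N_def': "N = derived G (derived G (carrier G))" unfolding N_def by (simp add: numeral_2_eq_2)
  have N: "N \<lhd> G" unfolding N_def' by (intro derived_is_normal normal_self)
  then show "(derived G ^^ 2) (carrier G) \<lhd> G" unfolding N_def .
  interpret N: normal N G by (rule N)
  interpret Q: group "G Mod N" by (rule N.factorgroup_is_group)
  interpret r: group_hom G "G Mod N" "\<lambda>x. N #> x"
    using N.r_coset_hom_Mod by unfold_locales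
  have D: "derived G (carrier G) \<subseteq> carrier G" by (intro derived_in_carrier) simp
  have img: "derived (G Mod N) (carrier (G Mod N)) = (\<lambda>x. N #> x) ` derived G (carrier G)"
    using r.derived_img[of "carrier G"] by (simp add: carrier_FactGroup)
  have "metabelian_group (G Mod N)"
  proof unfold_locales
    fix x y assume "x \<in> derived (G Mod N) (carrier (G Mod N))" "y \<in> derived (G Mod N) (carrier (G Mod N))"
    then obtain u v where uv: "u \<in> derived G (carrier G)" "v \<in> derived G (carrier G)" "x = N #> u" "y = N #> v"
      unfolding img by blast
    have c: "u \<in> carrier G" "v \<in> carrier G" using uv D by auto
    have "commutator G u v \<in> N"
      unfolding N_def' derived_generate_commutators[of "derived G (carrier G)"] using uv by (intro generate.incl) blast
    moreover have "u \<otimes> v = commutator G u v \<otimes> (v \<otimes> u)"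
      unfolding commutator_def using c by (simp add: m_assoc)
    ultimately have "u \<otimes> v \<in> N #> (v \<otimes> u)" unfolding r_coset_def by blast
    then have "N #> (v \<otimes> u) = N #> (u \<otimes> v)"
      using c N.subgroup_axioms by (intro repr_independence) auto
    then show "x \<otimes>\<^bsub>G Mod N\<^esub> y = y \<otimes>\<^bsub>G Mod N\<^esub> x"
      unfolding uv(3,4) using c r.hom_mult by metis
  qed
  then show "metabelian_group (G Mod ((derived G ^^ 2) (carrier G)))" unfolding N_def .
qed

context mccool_group_with_quotients
begin

lemma quotient_chen_group:
  fixes N defines "N \<equiv> (derived G ^^ 2) (carrier G)"
  shows "chen_group_with_quotients (G Mod N) (\<lambda>i j. N #> b i j) n"
proof -
  interpret N: normal N G unfolding N_def by (rule metabelian_quotient)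
  interpret Q: metabelian_group "G Mod N" unfolding N_def by (rule metabelian_quotient)
  interpret r: group_hom G "G Mod N" "\<lambda>x. N #> x"
    using N.r_coset_hom_Mod by unfold_locales
  have rh: "group_hom G (G Mod N) (\<lambda>x. N #> x)" ..
  have one: "N #> \<one> = \<one>\<^bsub>G Mod N\<^esub>" by (rule r.hom_one)
  have fac: "\<exists>h' \<in> hom (G Mod N) affine_group. \<forall>x\<in>carrier G. h' (N #> x) = h x" if h: "h \<in> hom G affine_group" for h
  proof -
    interpret h: group_hom G affine_group h using h affine_group by unfold_locales
    have "N \<subseteq> kernel G affine_group h"
      using affine_second_derived[OF h] N.subset unfolding kernel_def N_def by (auto simp: numeral_2_eq_2)
    then obtain h' where "h' \<in> hom (G Mod N) affine_group" "\<And>x. x \<in> carrier G \<Longrightarrow> h' (N #> x) = h x"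
      using h.FactGroup_universal_kernel[OF N.normal_axioms] by metis
    then show ?thesis by blast
  qed
  show ?thesis
  proof (unfold_locales, goal_cases)
    case (1 i j)
    then show ?case by (rule r.hom_closed[OF b_closed])
  next
    case (2 i j)
    then show ?case using b_trivial one by simp
  next
    case 3
    have "range (\<lambda>(i, j). N #> b i j) = (\<lambda>x. N #> x) ` range (case_prod b)"
      by (auto simp: image_iff)
    moreover have "range (case_prod b) \<subseteq> carrier G" by auto
    ultimately show ?case using r.generate_img[of "range (case_prod b)"] b_generate
      by (simp add: carrier_FactGroup)
  next
    case (4 i j k l)
    then show ?case using b_disj group_hom_commutator[OF rh b_closed b_closed] one by metis
  next
    case (5 i j k)
    then show ?case using b_same group_hom_commutator[OF rh b_closed b_closed] one by metis
  next
    case (6 i j k)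
    have "(N #> b i k) \<otimes>\<^bsub>G Mod N\<^esub> (N #> b j k) = N #> (b i k \<otimes> b j k)"
      by (rule r.hom_mult[symmetric]) simp_all
    then show ?case using b_mix[OF 6] group_hom_commutator[OF rh b_closed m_closed[OF b_closed b_closed]] one by metis
  next
    case (7 i j a1 a2)
    then obtain h where h: "h \<in> hom G affine_group" "h (b i j) = a1" "h (b j i) = a2"
        "\<forall>p q. {p, q} \<noteq> {i, j} \<longrightarrow> h (b p q) = \<one>\<^bsub>affine_group\<^esub>"
      using pair_hom by blast
    obtain h' where h': "h' \<in> hom (G Mod N) affine_group" "\<forall>x\<in>carrier G. h' (N #> x) = h x"
      using fac[OF h(1)] by blast
    have "h' (N #> b p q) = h (b p q)" for p q using h'(2) by simp
    then show ?case using h' h by (intro bexI[of _ h']) auto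
  next
    case (8 i j k a1 a2 a3)
    then obtain h where h: "h \<in> hom G affine_group" "h (b j i) = a1 \<and> h (b k i) = inv\<^bsub>affine_group\<^esub> a1 \<and>
        h (b k j) = a2 \<and> h (b i j) = inv\<^bsub>affine_group\<^esub> a2 \<and> h (b i k) = a3 \<and> h (b j k) = inv\<^bsub>affine_group\<^esub> a3 \<and>
        (\<forall>p q. \<not> (p \<in> {i, j, k} \<and> q \<in> {i, j, k}) \<longrightarrow> h (b p q) = \<one>\<^bsub>affine_group\<^esub>)"
      using triple_hom[OF 8] by blast
    obtain h' where h': "h' \<in> hom (G Mod N) affine_group" "\<forall>x\<in>carrier G. h' (N #> x) = h x"
      using fac[OF h(1)] by blast
    have "h' (N #> b p q) = h (b p q)" for p q using h'(2) by simp
    then show ?case using h'(1) h(2) by (intro bexI[of _ h']) (simp_all del: affine_one affine_carrier)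
  qed
qed

theorem chen_rank_eq:
  assumes "k \<ge> 5"
  shows "chen_rank G k = (k - 1) * (n choose 2) + (k - 1) * (k + 1) * (n choose 3)"
proof -
  \<comment> \<open>Weight \<open>k\<close> means a bracket followed by \<open>m\<close> entries;
    \<open>k \<ge> 5\<close> becomes \<open>m \<ge> 3\<close>.\<close>
  define m where "m = k - 2"
  have m: "k = m + 2" "m \<ge> 3" using assms unfolding m_def by auto
  have "k - 1 = m + 1" "k + 1 = m + 3" using m by simp_all
  then show ?thesis
    unfolding chen_rank_def m(1)
      chen_group_with_quotients.ab_rank_gr_eq[OF quotient_chen_group m(2)] card_chen_indices
    by (simp only:)
qed

end

section \<open>Free groups\<close>

abbreviation letter_inv :: "letter \<Rightarrow> letter" where
  "letter_inv a \<equiv> (fst a, \<not> snd a)"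

lemma inverse_letters_iff: "inverse_letters a c \<longleftrightarrow> c = letter_inv a"
  by (cases a; cases c) auto

abbreviation reduced :: "letter list \<Rightarrow> bool" where
  "reduced \<equiv> successively (\<lambda>a c. c \<noteq> letter_inv a)"

lemma freduce_Cons_reduced: "reduced (a # w) \<Longrightarrow> freduce w = w \<Longrightarrow> freduce (a # w) = a # w"
  by (cases w) (auto simp: inverse_letters_iff)

lemma reduced_freduce: "reduced (freduce w)"
proof (induction w)
  case (Cons a w)
  then show ?case
    by (cases "freduce w") (auto simp: successively_Cons inverse_letters_iff)
qed simp

lemma freduce_reduced: "reduced w \<Longrightarrow> freduce w = w"
proof (induction w)
  case (Cons a w)
  then have "reduced w" by (auto simp: successively_Cons)
  then have "freduce w = w" by (rule Cons.IH)
  with Cons.prems show ?case by (rule freduce_Cons_reduced)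
qed simp

lemma freduce_eq_iff: "freduce w = w \<longleftrightarrow> reduced w"
  using reduced_freduce freduce_reduced by metis

lemma freduce_freduce [simp]: "freduce (freduce w) = freduce w"
  using reduced_freduce freduce_reduced by blast

lemma freduce_append_right [simp]: "freduce (u @ freduce v) = freduce (u @ v)"
  by (induction u) auto

lemma freduce_cancel: "freduce (a # letter_inv a # w) = freduce w"
  using reduced_freduce[of w] by (cases "freduce w"; cases a) (auto simp: inverse_letters_iff successively_Cons split: if_splits list.splits)

declare freduce.simps(2) [simp del]

lemma freduce_Cons_freduce [simp]: "freduce (a # freduce w) = freduce (a # w)"
  by (simp add: freduce.simps(2))

lemma freduce_single [simp]: "freduce [a] = [a]"
  by (simp add: freduce.simps(2))

lemma freduce_append_left [simp]: "freduce (freduce u @ v) = freduce (u @ v)"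
proof (induction u)
  case (Cons a u)
  show ?case
  proof (cases "\<exists>t. freduce u = letter_inv a # t")
    case True
    then obtain t where t: "freduce u = letter_inv a # t" by blast
    have "freduce ((a # u) @ v) = freduce (a # freduce (u @ v))" by simp
    also have "\<dots> = freduce (a # freduce (letter_inv a # t @ v))" using Cons.IH t by simp
    also have "\<dots> = freduce (t @ v)" by (simp only: freduce_Cons_freduce freduce_cancel)
    finally show ?thesis using t by (simp add: freduce.simps(2)[of a u] inverse_letters_iff)
  next
    case False
    then have "freduce (a # u) = a # freduce u"
      by (auto simp: freduce.simps(2)[of a u] inverse_letters_iff split: list.splits)
    then have "freduce (freduce (a # u) @ v) = freduce (a # freduce (freduce u @ v))" by simp
    then show ?thesis using Cons.IH by simp
  qed
qed simp

definition word_inv :: "letter list \<Rightarrow> letter list" where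
  "word_inv w = rev (map letter_inv w)"

lemma word_inv_simps [simp]:
  "word_inv [] = []" "word_inv (a # w) = word_inv w @ [letter_inv a]" "word_inv (u @ v) = word_inv v @ word_inv u"
  "word_inv (word_inv w) = w" "length (word_inv w) = length w" "word_inv w = [] \<longleftrightarrow> w = []"
  unfolding word_inv_def by (auto simp: rev_map comp_def)

lemma reduced_word_inv [simp]: "reduced (word_inv w) \<longleftrightarrow> reduced w"
proof -
  have "reduced (word_inv w) \<longleftrightarrow> successively (\<lambda>a c. letter_inv a \<noteq> letter_inv (letter_inv c)) w"
    unfolding word_inv_def successively_rev successively_map ..
  also have "\<dots> \<longleftrightarrow> reduced w" by (rule successively_cong) (auto simp: prod_eq_iff)
  finally show ?thesis .
qed

lemma freduce_word_inv_left: "freduce (word_inv w @ w) = []"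
proof (induction w)
  case (Cons a w)
  have "freduce (word_inv (a # w) @ a # w) = freduce (word_inv w @ freduce (letter_inv a # letter_inv (letter_inv a) # w))"
    by (simp del: freduce_cancel)
  also have "freduce (letter_inv a # letter_inv (letter_inv a) # w) = freduce w" by (rule freduce_cancel)
  finally show ?case using Cons by simp
qed simp

text \<open>The free group on all natural numbers as a single type, written additively although it
  is not commutative. \<open>F_n\<close> is cut out by \<open>letters_below\<close>, and group
  identities can be simplified without carrier conditions.\<close>

typedef fword = "{w :: letter list. freduce w = w}"
  morphisms letters Abs_fword
  by (rule exI[of _ "[]"]) simp

definition fw :: "letter list \<Rightarrow> fword" where
  "fw w = Abs_fword (freduce w)"

lemma letters_fw [simp]: "letters (fw w) = freduce w"
  unfolding fw_def by (simp add: Abs_fword_inverse)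

lemma fw_letters [simp]: "fw (letters w) = w"
  unfolding fw_def using letters[of w] by (simp add: letters_inverse)

lemma freduce_letters [simp]: "freduce (letters w) = letters w"
  using letters[of w] by simp

lemma reduced_letters [simp]: "reduced (letters w)"
  using letters[of w] by (simp add: freduce_eq_iff)

lemma fword_eqI: "letters u = letters v \<Longrightarrow> u = v"
  by (simp add: letters_inject)

instantiation fword :: group_add
begin

definition "0 = fw []"
definition "u + v = fw (letters u @ letters v)"
definition "- u = fw (word_inv (letters u))"
definition "u - v = u + - (v :: fword)"

instance
proof
  fix a b c :: fword
  show "a + b + c = a + (b + c)"
    unfolding plus_fword_def by (intro fword_eqI) simp
  show "0 + a = a" "a + 0 = a" unfolding plus_fword_def zero_fword_def by (intro fword_eqI; simp)+
  show "- a + a = 0" unfolding plus_fword_def zero_fword_def uminus_fword_def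
    by (intro fword_eqI) (simp add: freduce_word_inv_left)
  show "a + - b = a - b" by (simp add: minus_fword_def)
qed

end

lemma letters_zero [simp]: "letters 0 = []"
  by (simp add: zero_fword_def)

lemma letters_plus: "letters (u + v) = freduce (letters u @ letters v)"
  by (simp add: plus_fword_def)

lemma letters_uminus [simp]: "letters (- u) = word_inv (letters u)"
  using reduced_letters[of u] by (simp add: uminus_fword_def freduce_eq_iff del: reduced_letters)

definition letter_value :: "(nat \<Rightarrow> 'g :: group_add) \<Rightarrow> letter \<Rightarrow> 'g" where
  "letter_value t a = (if snd a then t (fst a) else - t (fst a))"

lemma letter_value_inv [simp]: "letter_value t (letter_inv a) = - letter_value t a"
  unfolding letter_value_def by simp

fun word_eval :: "(nat \<Rightarrow> 'g :: group_add) \<Rightarrow> letter list \<Rightarrow> 'g" where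
  "word_eval t [] = 0"
| "word_eval t (a # w) = letter_value t a + word_eval t w"

lemma word_eval_append [simp]: "word_eval t (u @ v) = word_eval t u + word_eval t v"
  by (induction u) (auto simp: add.assoc)

lemma word_eval_inv [simp]: "word_eval t (word_inv w) = - word_eval t w"
  by (induction w) (auto simp: minus_add simp del: fst_conv)

lemma word_eval_freduce [simp]: "word_eval t (freduce w) = word_eval t w"
proof (induction w)
  case (Cons a w)
  show ?case
  proof (cases "freduce w")
    case Nil
    then show ?thesis using Cons by (simp add: freduce.simps(2))
  next
    case C: (Cons c v)
    show ?thesis
    proof (cases "c = letter_inv a")
      case True
      have "word_eval t w = - letter_value t a + word_eval t v"
        using Cons C True by (simp flip: Cons)
      then show ?thesis using C True by (simp add: freduce.simps(2) inverse_letters_iff add.assoc[symmetric])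
    next
      case False
      then show ?thesis using C Cons by (simp add: freduce.simps(2) inverse_letters_iff)
    qed
  qed
qed simp

text \<open>The universal property of the free group: the homomorphism with x_i \<mapsto> t
  i.\<close>

definition subst :: "(nat \<Rightarrow> 'g :: group_add) \<Rightarrow> fword \<Rightarrow> 'g" where
  "subst t w = word_eval t (letters w)"

lemma subst_fw [simp]: "subst t (fw w) = word_eval t w"
  by (simp add: subst_def)

lemma subst_zero [simp]: "subst t 0 = 0"
  by (simp add: subst_def)

lemma subst_plus [simp]: "subst t (u + v) = subst t u + subst t v"
  by (simp add: subst_def letters_plus)

lemma subst_uminus [simp]: "subst t (- u) = - subst t u"
  by (simp add: subst_def)

lemma subst_minus [simp]: "subst t (u - v) = subst t u - subst t v"
  using subst_plus[of t u "- v"] by simp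

definition x :: "nat \<Rightarrow> fword" where "x i = fw [(i, True)]"

lemma letters_x [simp]: "letters (x i) = [(i, True)]"
  by (simp add: x_def)

lemma subst_x [simp]: "subst t (x i) = t i"
  by (simp add: x_def letter_value_def)

lemma letter_value_x: "letter_value x a = fw [a]"
  by (cases a) (auto simp: letter_value_def x_def uminus_fword_def intro!: fword_eqI)

lemma word_eval_x [simp]: "word_eval x w = fw w"
proof (induction w)
  case (Cons a w)
  then show ?case by (intro fword_eqI) (simp add: letters_plus letter_value_x)
qed (simp add: zero_fword_def)

lemma word_eval_cong: "(\<And>a. a \<in> set w \<Longrightarrow> t (fst a) = s (fst a)) \<Longrightarrow> word_eval t w = word_eval s w"
  by (induction w) (auto simp: letter_value_def)

lemma subst_cong: "(\<And>a. a \<in> set (letters w) \<Longrightarrow> t (fst a) = s (fst a)) \<Longrightarrow> subst t w = subst s w"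
  unfolding subst_def by (rule word_eval_cong)

lemma subst_x_id [simp]: "subst x w = w"
  by (simp add: subst_def)

lemma subst_word_eval: "subst s (word_eval t w) = word_eval (\<lambda>i. subst s (t i)) w"
  by (induction w) (auto simp: letter_value_def)

lemma subst_subst: "subst s (subst t w) = subst (\<lambda>i. subst s (t i)) w"
  unfolding subst_def[of t] subst_def[of "\<lambda>i. subst s (t i)"] by (rule subst_word_eval)

definition letters_below :: "nat \<Rightarrow> fword \<Rightarrow> bool" where
  "letters_below n w \<longleftrightarrow> (\<forall>a \<in> set (letters w). fst a < n)"

lemma set_freduce: "set (freduce w) \<subseteq> set w"
proof (induction w)
  case (Cons a w)
  then show ?case by (auto simp: freduce.simps(2) split: list.splits if_splits)
qed simp

lemma letters_below_zero [simp]: "letters_below n 0"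
  by (simp add: letters_below_def)

lemma letters_below_x [simp]: "letters_below n (x i) \<longleftrightarrow> i < n"
  by (simp add: letters_below_def)

lemma letters_below_plus: "letters_below n u \<Longrightarrow> letters_below n v \<Longrightarrow> letters_below n (u + v)"
  unfolding letters_below_def letters_plus using set_freduce[of "letters u @ letters v"] by auto

lemma letters_below_uminus [simp]: "letters_below n (- u) = letters_below n u"
  unfolding letters_below_def by (auto simp: word_inv_def)

lemma letters_below_minus: "letters_below n u \<Longrightarrow> letters_below n v \<Longrightarrow> letters_below n (u - v)"
  using letters_below_plus[of n u "- v"] by simp

lemma letters_below_word_eval:
  "(\<And>i. i < n \<Longrightarrow> letters_below m (t i)) \<Longrightarrow> (\<forall>a\<in>set w. fst a < n) \<Longrightarrow> letters_below m (word_eval t w)"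
  by (induction w) (auto simp: letter_value_def intro!: letters_below_plus)

lemma letters_below_subst:
  "(\<And>i. i < n \<Longrightarrow> letters_below m (t i)) \<Longrightarrow> letters_below n w \<Longrightarrow> letters_below m (subst t w)"
  unfolding subst_def by (rule letters_below_word_eval) (auto simp: letters_below_def)

section \<open>The group of basis-conjugating automorphisms\<close>

lemma free_group_carrier: "w \<in> carrier (free_group n) \<longleftrightarrow> letters (fw w) = w \<and> letters_below n (fw w)"
  unfolding free_group_def letters_below_def by auto

lemma letters_carrier [simp]: "letters w \<in> carrier (free_group n) \<longleftrightarrow> letters_below n w"
  by (simp add: free_group_carrier)

lemma carrier_letters: "w \<in> carrier (free_group n) \<Longrightarrow> \<exists>u. letters_below n u \<and> w = letters u"
  using free_group_carrier by metis

lemma free_group_mult [simp]: "letters u \<otimes>\<^bsub>free_group n\<^esub> letters v = letters (u + v)"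
  by (simp add: free_group_def letters_plus)

lemma free_group_one [simp]: "\<one>\<^bsub>free_group n\<^esub> = letters 0"
  by (simp add: free_group_def)

lemma free_group: "group (free_group n)"
proof (rule groupI)
  show "\<one>\<^bsub>free_group n\<^esub> \<in> carrier (free_group n)" unfolding free_group_one by (simp del: letters_zero)
next
  fix u v assume "u \<in> carrier (free_group n)" "v \<in> carrier (free_group n)"
  then obtain u' v' where "letters_below n u'" "u = letters u'" "letters_below n v'" "v = letters v'"
    using carrier_letters by blast
  then show "u \<otimes>\<^bsub>free_group n\<^esub> v \<in> carrier (free_group n)" by (simp add: letters_below_plus)
next
  fix u v w assume "u \<in> carrier (free_group n)" "v \<in> carrier (free_group n)" "w \<in> carrier (free_group n)"
  then obtain u' v' w' where "u = letters u'" "v = letters v'" "w = letters w'"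
    using carrier_letters by metis
  then show "u \<otimes>\<^bsub>free_group n\<^esub> v \<otimes>\<^bsub>free_group n\<^esub> w = u \<otimes>\<^bsub>free_group n\<^esub> (v \<otimes>\<^bsub>free_group n\<^esub> w)"
    by (simp add: add.assoc)
next
  fix u assume "u \<in> carrier (free_group n)"
  then obtain u' where u: "letters_below n u'" "u = letters u'" using carrier_letters by blast
  show "\<one>\<^bsub>free_group n\<^esub> \<otimes>\<^bsub>free_group n\<^esub> u = u" unfolding free_group_one u by (simp del: letters_zero)
  show "\<exists>v\<in>carrier (free_group n). v \<otimes>\<^bsub>free_group n\<^esub> u = \<one>\<^bsub>free_group n\<^esub>"
    unfolding u free_group_one by (rule bexI[of _ "letters (- u')"]) (use u in \<open>simp_all del: letters_zero letters_uminus\<close>)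
qed

lemma free_group_inv: "letters_below n u \<Longrightarrow> inv\<^bsub>free_group n\<^esub> letters u = letters (- u)"
  by (rule group.inv_equality[OF free_group]) (simp_all del: letters_uminus letters_zero)

lemma gen_eq: "gen i = letters (x i)"
  by (simp add: gen_def)

text \<open>An automorphism of \<open>F_n\<close> is recorded by its values on the generators and
  extended by the identity to the letters from \<open>n\<close> on, so that composition becomes
  substitution in one free group.\<close>

definition images :: "nat \<Rightarrow> (letter list \<Rightarrow> letter list) \<Rightarrow> nat \<Rightarrow> fword" where
  "images n \<phi> i = (if i < n then fw (\<phi> (gen i)) else x i)"

lemma auto_group_hom: "\<phi> \<in> auto (free_group n) \<Longrightarrow> group_hom (free_group n) (free_group n) \<phi>"
  using free_group by (auto simp: auto_def group_hom_def group_hom_axioms_def)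

lemma auto_gen: "\<phi> \<in> auto (free_group n) \<Longrightarrow> i < n \<Longrightarrow> \<phi> (gen i) = letters (images n \<phi> i) \<and> letters_below n (images n \<phi> i)"
  using group_hom.hom_closed[OF auto_group_hom, of \<phi> n "gen i"]
  by (simp add: gen_eq images_def free_group_carrier del: letters_x)

lemma auto_letters:
  assumes \<phi>: "\<phi> \<in> auto (free_group n)" and w: "letters_below n w"
  shows "\<phi> (letters w) = letters (subst (images n \<phi>) w)"
proof -
  interpret group_hom "free_group n" "free_group n" \<phi> by (rule auto_group_hom[OF \<phi>])
  have L: "letters_below n (images n \<phi> i)" if "i < n" for i using auto_gen[OF \<phi> that] by blast
  have single: "\<phi> (letters (letter_value x a)) = letters (letter_value (images n \<phi>) a) \<and>
      letters_below n (letter_value x a) \<and> letters_below n (letter_value (images n \<phi>) a)" if "fst a < n" for a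
  proof (cases "snd a")
    case True
    then show ?thesis using auto_gen[OF \<phi> that] that by (simp add: letter_value_def gen_eq del: letters_x)
  next
    case False
    have "\<phi> (letters (- x (fst a))) = letters (- images n \<phi> (fst a))"
      using hom_inv[of "letters (x (fst a))"] auto_gen[OF \<phi> that] that
      by (simp add: free_group_inv gen_eq del: letters_uminus letters_x)
    then show ?thesis using False that L[OF that] by (simp add: letter_value_def del: letters_uminus letters_x)
  qed
  have "\<phi> (letters (word_eval x v)) = letters (word_eval (images n \<phi>) v) \<and> letters_below n (word_eval x v) \<and>
      letters_below n (word_eval (images n \<phi>) v)" if "\<forall>a\<in>set v. fst a < n" for v
    using that
  proof (induction v)
    case Nil
    then show ?case using hom_one by simp
  next
    case (Cons a v)
    then have IH: "\<phi> (letters (word_eval x v)) = letters (word_eval (images n \<phi>) v)" "letters_below n (word_eval x v)"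
      "letters_below n (word_eval (images n \<phi>) v)" by (simp_all del: word_eval_x)
    have s: "\<phi> (letters (letter_value x a)) = letters (letter_value (images n \<phi>) a)" "letters_below n (letter_value x a)"
      "letters_below n (letter_value (images n \<phi>) a)" using single[of a] Cons.prems by simp_all
    have "\<phi> (letters (letter_value x a + word_eval x v)) =
        letters (letter_value (images n \<phi>) a + word_eval (images n \<phi>) v)"
      using hom_mult[of "letters (letter_value x a)" "letters (word_eval x v)"] IH s by (simp del: word_eval_x)
    then show ?case using IH s by (simp add: letters_below_plus del: word_eval_x)
  qed
  from this[of "letters w"] w show ?thesis unfolding letters_below_def subst_def by simp
qed

lemma auto_eqI:
  assumes "\<phi> \<in> auto (free_group n)" "\<psi> \<in> auto (free_group n)" "images n \<phi> = images n \<psi>"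
  shows "\<phi> = \<psi>"
proof
  fix w
  show "\<phi> w = \<psi> w"
  proof (cases "w \<in> carrier (free_group n)")
    case True
    then show ?thesis using carrier_letters auto_letters assms by metis
  next
    case False
    \<comment> \<open>Elements of \<open>auto\<close> are extensional, so outside the carrier both
      functions take the same default value.\<close>
    have e: "\<phi> \<in> extensional (carrier (free_group n))" "\<psi> \<in> extensional (carrier (free_group n))"
      using assms(1,2) by (simp_all add: auto_def Bij_imp_extensional)
    show ?thesis using extensional_arb[OF e(1) False] extensional_arb[OF e(2) False] by simp
  qed
qed

definition endo :: "nat \<Rightarrow> (nat \<Rightarrow> fword) \<Rightarrow> letter list \<Rightarrow> letter list" where
  "endo n t = (\<lambda>w\<in>carrier (free_group n). letters (subst t (fw w)))"

lemma endo_letters: "letters_below n w \<Longrightarrow> endo n t (letters w) = letters (subst t w)"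
  by (simp add: endo_def del: subst_fw)

lemma endo_auto:
  assumes t: "\<And>i. i < n \<Longrightarrow> letters_below n (t i)" and s: "\<And>i. i < n \<Longrightarrow> letters_below n (s i)"
    and st: "\<And>i. i < n \<Longrightarrow> subst s (t i) = x i" and ts: "\<And>i. i < n \<Longrightarrow> subst t (s i) = x i"
  shows "endo n t \<in> auto (free_group n)"
proof -
  have inv: "endo n s' (endo n t' w) = w"
    if w: "w \<in> carrier (free_group n)" and t': "\<And>i. i < n \<Longrightarrow> letters_below n (t' i)" and s': "\<And>i. i < n \<Longrightarrow> subst s' (t' i) = x i" for s' t' w
  proof -
    obtain u where u: "letters_below n u" "w = letters u" using carrier_letters[OF w] by blast
    have "subst s' (subst t' u) = u"
      unfolding subst_subst using u s' subst_cong[of u "\<lambda>i. subst s' (t' i)" x] by (auto simp: letters_below_def)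
    moreover have "letters_below n (subst t' u)" using t' u(1) by (rule letters_below_subst)
    ultimately show ?thesis using u by (simp add: endo_letters)
  qed
  have clos: "endo n t' ` carrier (free_group n) \<subseteq> carrier (free_group n)" if "\<And>i. i < n \<Longrightarrow> letters_below n (t' i)" for t'
  proof
    fix v assume "v \<in> endo n t' ` carrier (free_group n)"
    then obtain u where "letters_below n u" "v = endo n t' (letters u)" using carrier_letters by blast
    moreover from this have "letters_below n (subst t' u)" using that letters_below_subst by blast
    ultimately show "v \<in> carrier (free_group n)" by (simp add: endo_letters)
  qed
  have "endo n t \<in> Bij (carrier (free_group n))"
    unfolding Bij_def
  proof
    show "endo n t \<in> extensional (carrier (free_group n))" by (simp add: endo_def)
    show "endo n t \<in> {f. bij_betw f (carrier (free_group n)) (carrier (free_group n))}"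
      using inv[of _ t s] inv[of _ s t] clos[of t] clos[of s] assms
      by (auto intro!: bij_betw_byWitness[of _ "endo n s"])
  qed
  moreover have "endo n t \<in> hom (free_group n) (free_group n)"
  proof (rule homI)
    fix u assume "u \<in> carrier (free_group n)"
    then show "endo n t u \<in> carrier (free_group n)" using clos t by blast
  next
    fix u v assume "u \<in> carrier (free_group n)" "v \<in> carrier (free_group n)"
    then obtain u' v' where "letters_below n u'" "u = letters u'" "letters_below n v'" "v = letters v'"
      using carrier_letters by blast
    then show "endo n t (u \<otimes>\<^bsub>free_group n\<^esub> v) = endo n t u \<otimes>\<^bsub>free_group n\<^esub> endo n t v"
      by (simp add: endo_letters letters_below_plus)
  qed
  ultimately show ?thesis unfolding auto_def by blast
qed

lemma images_endo: "(\<And>i. i < n \<Longrightarrow> letters_below n (t i)) \<Longrightarrow> images n (endo n t) = (\<lambda>i. if i < n then t i else x i)"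
  by (rule ext) (simp add: images_def gen_eq endo_letters del: letters_x)

definition conj_by :: "fword \<Rightarrow> nat \<Rightarrow> fword" where
  "conj_by w i = - w + x i + w"

lemma PSigma_carrier:
  "\<phi> \<in> carrier (PSigma n) \<longleftrightarrow> \<phi> \<in> auto (free_group n) \<and>
     (\<forall>i<n. \<exists>w. letters_below n w \<and> images n \<phi> i = conj_by w i)"
proof -
  have "(\<exists>w\<in>carrier (free_group n). \<phi> (gen i) = inv\<^bsub>free_group n\<^esub> w \<otimes>\<^bsub>free_group n\<^esub> gen i \<otimes>\<^bsub>free_group n\<^esub> w) \<longleftrightarrow>
    (\<exists>w. letters_below n w \<and> images n \<phi> i = conj_by w i)" if "\<phi> \<in> auto (free_group n)" "i < n" for i
  proof -
    have eq: "\<phi> (gen i) = inv\<^bsub>free_group n\<^esub> letters w \<otimes>\<^bsub>free_group n\<^esub> gen i \<otimes>\<^bsub>free_group n\<^esub> letters w \<longleftrightarrow>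
      images n \<phi> i = conj_by w i" if w: "letters_below n w" for w
      using auto_gen[OF \<open>\<phi> \<in> auto (free_group n)\<close> \<open>i < n\<close>] w unfolding conj_by_def
      by (simp add: gen_eq free_group_inv letters_inject del: letters_x letters_uminus)
    have Q: "(\<exists>w\<in>carrier (free_group n). Q w) \<longleftrightarrow> (\<exists>w. letters_below n w \<and> Q (letters w))" for Q
      using carrier_letters[of _ n] letters_carrier[of _ n] by blast
    show ?thesis unfolding Q by (intro ex_cong1 conj_cong refl) (rule eq)
  qed
  then show ?thesis unfolding PSigma_def AutoGroup_def by auto
qed

lemma AutoGroup_mult:
  "\<phi> \<in> auto (free_group n) \<Longrightarrow> \<psi> \<in> auto (free_group n) \<Longrightarrow>
    \<phi> \<otimes>\<^bsub>AutoGroup (free_group n)\<^esub> \<psi> = compose (carrier (free_group n)) \<phi> \<psi>"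
  unfolding AutoGroup_def BijGroup_def by (auto simp: auto_def)

lemma AutoGroup_carrier [simp]: "carrier (AutoGroup (free_group n)) = auto (free_group n)"
  by (simp add: AutoGroup_def)

lemma images_mult:
  assumes "\<phi> \<in> auto (free_group n)" "\<psi> \<in> auto (free_group n)"
  shows "images n (\<phi> \<otimes>\<^bsub>AutoGroup (free_group n)\<^esub> \<psi>) = (\<lambda>i. subst (images n \<phi>) (images n \<psi> i))"
proof
  fix i
  show "images n (\<phi> \<otimes>\<^bsub>AutoGroup (free_group n)\<^esub> \<psi>) i = subst (images n \<phi>) (images n \<psi> i)"
  proof (cases "i < n")
    case True
    then have "(\<phi> \<otimes>\<^bsub>AutoGroup (free_group n)\<^esub> \<psi>) (gen i) = \<phi> (letters (images n \<psi> i))"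
      using auto_gen[OF assms(2) True] unfolding AutoGroup_mult[OF assms] by (simp add: compose_eq gen_eq del: letters_x)
    then show ?thesis using auto_letters[OF assms(1)] auto_gen[OF assms(2) True] True
      by (simp add: images_def[of n "_ \<otimes>\<^bsub>_\<^esub> _"])
  qed (simp add: images_def)
qed

lemma images_one: "images n \<one>\<^bsub>AutoGroup (free_group n)\<^esub> = x"
  by (rule ext) (simp add: images_def AutoGroup_def BijGroup_def gen_eq del: letters_x)

lemma PSigma_simps [simp]:
  "\<one>\<^bsub>PSigma n\<^esub> = \<one>\<^bsub>AutoGroup (free_group n)\<^esub>" "monoid.mult (PSigma n) = monoid.mult (AutoGroup (free_group n))"
  by (simp_all add: PSigma_def)

lemma conj_by_subst: "subst t (conj_by w i) = - subst t w + t i + subst t w"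
  by (simp add: conj_by_def)

lemma PSigma_subgroup: "subgroup (carrier (PSigma n)) (AutoGroup (free_group n))"
proof -
  interpret A: group "AutoGroup (free_group n)" using group.AutoGroup[OF free_group] .
  show ?thesis
  proof (rule A.subgroupI)
    show "carrier (PSigma n) \<subseteq> carrier (AutoGroup (free_group n))" using PSigma_carrier by auto
    have "\<one>\<^bsub>AutoGroup (free_group n)\<^esub> \<in> carrier (PSigma n)"
      using A.one_closed unfolding PSigma_carrier images_one
      by (auto intro!: exI[of _ 0] simp: conj_by_def)
    then show "carrier (PSigma n) \<noteq> {}" by blast
  next
    fix \<phi> assume "\<phi> \<in> carrier (PSigma n)"
    then have \<phi>: "\<phi> \<in> auto (free_group n)" "\<And>i. i < n \<Longrightarrow> \<exists>w. letters_below n w \<and> images n \<phi> i = conj_by w i"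
      unfolding PSigma_carrier by auto
    let ?\<psi> = "inv\<^bsub>AutoGroup (free_group n)\<^esub> \<phi>"
    have \<psi>: "?\<psi> \<in> auto (free_group n)" using A.inv_closed[of \<phi>] \<phi>(1) by simp
    have id: "subst (images n ?\<psi>) (images n \<phi> i) = x i" for i
      using images_mult[OF \<psi> \<phi>(1)] A.l_inv[of \<phi>] \<phi>(1) images_one by (metis AutoGroup_carrier)
    have "\<exists>w. letters_below n w \<and> images n ?\<psi> i = conj_by w i" if i: "i < n" for i
    proof -
      obtain w where w: "letters_below n w" "images n \<phi> i = conj_by w i" using \<phi>(2)[OF i] by blast
      \<comment> \<open>If an automorphism conjugates x_i by \<open>w\<close>, its inverse
        conjugates x_i by the inverse of the image of \<open>w\<close> under that inverse.\<close>
      define u where "u = subst (images n ?\<psi>) w"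
      have "letters_below n u" unfolding u_def using auto_gen[OF \<psi>] w by (intro letters_below_subst) auto
      moreover have "- u + images n ?\<psi> i + u = x i" using id[of i] unfolding w(2) conj_by_subst u_def .
      then have "images n ?\<psi> i = conj_by (- u) i" unfolding conj_by_def by (metis add.assoc add_minus_cancel minus_minus right_minus add.right_neutral)
      ultimately show ?thesis by (intro exI[of _ "- u"]) simp
    qed
    then show "?\<psi> \<in> carrier (PSigma n)" unfolding PSigma_carrier using \<psi> by blast
  next
    fix \<phi> \<psi> assume "\<phi> \<in> carrier (PSigma n)" "\<psi> \<in> carrier (PSigma n)"
    then have \<phi>: "\<phi> \<in> auto (free_group n)" "\<And>i. i < n \<Longrightarrow> \<exists>w. letters_below n w \<and> images n \<phi> i = conj_by w i"
      and \<psi>: "\<psi> \<in> auto (free_group n)" "\<And>i. i < n \<Longrightarrow> \<exists>w. letters_below n w \<and> images n \<psi> i = conj_by w i"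
      unfolding PSigma_carrier by auto
    have "\<exists>w. letters_below n w \<and> subst (images n \<phi>) (images n \<psi> i) = conj_by w i" if i: "i < n" for i
    proof -
      obtain v where v: "letters_below n v" "images n \<phi> i = conj_by v i" using \<phi>(2)[OF i] by blast
      obtain w where w: "letters_below n w" "images n \<psi> i = conj_by w i" using \<psi>(2)[OF i] by blast
      have "letters_below n (subst (images n \<phi>) w)" using auto_gen[OF \<phi>(1)] w by (intro letters_below_subst) auto
      moreover have "subst (images n \<phi>) (images n \<psi> i) = conj_by (v + subst (images n \<phi>) w) i"
        unfolding w(2) conj_by_subst v(2) by (simp add: conj_by_def minus_add add.assoc diff_conv_add_uminus del: add_uminus_conv_diff)
      ultimately show ?thesis using v(1) letters_below_plus by blast
    qed
    moreover have "\<phi> \<otimes>\<^bsub>AutoGroup (free_group n)\<^esub> \<psi> \<in> auto (free_group n)" using A.m_closed \<phi>(1) \<psi>(1) by simp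
    ultimately show "\<phi> \<otimes>\<^bsub>AutoGroup (free_group n)\<^esub> \<psi> \<in> carrier (PSigma n)"
      unfolding PSigma_carrier images_mult[OF \<phi>(1) \<psi>(1)] by blast
  qed
qed

lemma PSigma_group: "group (PSigma n)"
proof -
  have eq: "AutoGroup (free_group n) \<lparr>carrier := carrier (PSigma n)\<rparr> = PSigma n" by (simp add: PSigma_def)
  show ?thesis
    using subgroup.subgroup_is_group[OF PSigma_subgroup group.AutoGroup[OF free_group], of n] unfolding eq .
qed

lemma PSigma_auto: "\<phi> \<in> carrier (PSigma n) \<Longrightarrow> \<phi> \<in> auto (free_group n)"
  by (simp add: PSigma_carrier)

lemma images_PSigma_mult:
  "\<phi> \<in> carrier (PSigma n) \<Longrightarrow> \<psi> \<in> carrier (PSigma n) \<Longrightarrow>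
    images n (\<phi> \<otimes>\<^bsub>PSigma n\<^esub> \<psi>) = (\<lambda>i. subst (images n \<phi>) (images n \<psi> i))"
  by (simp add: images_mult PSigma_auto)

lemma images_PSigma_one: "images n \<one>\<^bsub>PSigma n\<^esub> = x"
  by (simp add: images_one)

lemma PSigma_eqI:
  "\<phi> \<in> carrier (PSigma n) \<Longrightarrow> \<psi> \<in> carrier (PSigma n) \<Longrightarrow> images n \<phi> = images n \<psi> \<Longrightarrow> \<phi> = \<psi>"
  using auto_eqI PSigma_auto by blast

definition mccool :: "nat \<Rightarrow> nat \<Rightarrow> nat \<Rightarrow> letter list \<Rightarrow> letter list" where
  "mccool n i j = (if i < n \<and> j < n \<and> i \<noteq> j then endo n (x(i := conj_by (x j) i)) else \<one>\<^bsub>PSigma n\<^esub>)"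

lemma mccool:
  shows mccool_closed: "mccool n i j \<in> carrier (PSigma n)"
    and images_mccool: "images n (mccool n i j) = (if i < n \<and> j < n \<and> i \<noteq> j then x(i := conj_by (x j) i) else x)"
proof -
  have "mccool n i j \<in> carrier (PSigma n) \<and> images n (mccool n i j) = (if i < n \<and> j < n \<and> i \<noteq> j then x(i := conj_by (x j) i) else x)"
  proof (cases "i < n \<and> j < n \<and> i \<noteq> j")
    case True
    have below: "letters_below n ((x(i := conj_by (x j) i)) k)" if "k < n" for k
      using True that by (auto simp: conj_by_def intro!: letters_below_plus)
    have img: "images n (mccool n i j) = x(i := conj_by (x j) i)"
      using True images_endo[of n "x(i := conj_by (x j) i)", OF below] by (auto simp: mccool_def)
    have "mccool n i j \<in> auto (free_group n)"
      unfolding mccool_def using True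
      by (auto intro!: endo_auto[where s = "x(i := conj_by (- x j) i)"] letters_below_plus letters_below_minus simp: conj_by_def add.assoc)
    moreover have "\<exists>w. letters_below n w \<and> images n (mccool n i j) k = conj_by w k" if "k < n" for k
    proof (cases "k = i")
      case k: True
      then show ?thesis using True unfolding img by (intro exI[of _ "x j"]) simp
    next
      case False
      then show ?thesis unfolding img by (intro exI[of _ 0]) (simp add: conj_by_def)
    qed
    ultimately have "mccool n i j \<in> carrier (PSigma n)" unfolding PSigma_carrier by blast
    then show ?thesis unfolding if_P[OF True] using img by (rule conjI)
  next
    case False
    then have "mccool n i j = \<one>\<^bsub>PSigma n\<^esub>" unfolding mccool_def by (rule if_not_P)
    then show ?thesis unfolding if_not_P[OF False]
      using images_PSigma_one[of n] monoid.one_closed[OF group.is_monoid[OF PSigma_group]] by (simp only: simp_thms)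
  qed
  then show "mccool n i j \<in> carrier (PSigma n)" "images n (mccool n i j) = (if i < n \<and> j < n \<and> i \<noteq> j then x(i := conj_by (x j) i) else x)"
    by auto
qed

lemma (in group) commutator_eq_one:
  "u \<otimes> v = v \<otimes> u \<Longrightarrow> u \<in> carrier G \<Longrightarrow> v \<in> carrier G \<Longrightarrow> commutator G u v = \<one>"
  by (intro commutator_unique) auto

lemma
  shows mccool_disj: "distinct [i, j, k, l] \<Longrightarrow> commutator (PSigma n) (mccool n i j) (mccool n k l) = \<one>\<^bsub>PSigma n\<^esub>"
    and mccool_same: "distinct [i, j, k] \<Longrightarrow> commutator (PSigma n) (mccool n i k) (mccool n j k) = \<one>\<^bsub>PSigma n\<^esub>"
    and mccool_mix: "distinct [i, j, k] \<Longrightarrow>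
      commutator (PSigma n) (mccool n i j) (mccool n i k \<otimes>\<^bsub>PSigma n\<^esub> mccool n j k) = \<one>\<^bsub>PSigma n\<^esub>"
proof -
  interpret P: group "PSigma n" by (rule PSigma_group)
  note c = mccool_closed P.m_closed[OF mccool_closed mccool_closed]
  {
    assume "distinct [i, j, k, l]"
    then show "commutator (PSigma n) (mccool n i j) (mccool n k l) = \<one>\<^bsub>PSigma n\<^esub>"
      by (intro P.commutator_eq_one PSigma_eqI P.m_closed c)
        (auto simp: images_PSigma_mult c images_mccool conj_by_def fun_eq_iff simp del: PSigma_simps)
  next
    assume "distinct [i, j, k]"
    then show "commutator (PSigma n) (mccool n i k) (mccool n j k) = \<one>\<^bsub>PSigma n\<^esub>"
      by (intro P.commutator_eq_one PSigma_eqI P.m_closed c)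
        (auto simp: images_PSigma_mult c images_mccool conj_by_def fun_eq_iff simp del: PSigma_simps)
  next
    assume "distinct [i, j, k]"
    then show "commutator (PSigma n) (mccool n i j) (mccool n i k \<otimes>\<^bsub>PSigma n\<^esub> mccool n j k) = \<one>\<^bsub>PSigma n\<^esub>"
      by (intro P.commutator_eq_one PSigma_eqI P.m_closed c)
        (auto simp: images_PSigma_mult c images_mccool conj_by_def fun_eq_iff minus_add add.assoc diff_conv_add_uminus simp del: PSigma_simps add_uminus_conv_diff)
  }
qed

section \<open>Generation by the McCool generators\<close>

text \<open>The cancelling part \<open>c\<close> is split off once and for all, so that products of
  reduced words can be treated as concatenations \<open>p @ q\<close>.\<close>

lemma cancellation:
  assumes "reduced u" "reduced v"
  shows "\<exists>p c q. u = p @ word_inv c \<and> v = c @ q \<and> reduced (p @ q)"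
  using assms
proof (induction u arbitrary: v rule: rev_induct)
  case Nil
  then show ?case by (intro exI[of _ "[]"] exI[of _ v]) simp
next
  case (snoc a u)
  show ?case
  proof (cases "\<exists>w. v = letter_inv a # w")
    case True
    then obtain w where w: "v = letter_inv a # w" by blast
    have "reduced u" "reduced w" using snoc.prems unfolding w by (auto simp: successively_append_iff successively_Cons)
    from snoc.IH[OF this] obtain p c q where *: "u = p @ word_inv c" "w = c @ q" "reduced (p @ q)" by blast
    have "u @ [a] = p @ word_inv (letter_inv a # c)" "v = (letter_inv a # c) @ q" using * w by simp_all
    then show ?thesis using *(3) by blast
  next
    case False
    have "reduced ((u @ [a]) @ v)"
    proof (cases v)
      case (Cons b w)
      then have "b \<noteq> letter_inv a" using False by auto
      then show ?thesis using snoc.prems unfolding Cons by (auto simp: successively_append_iff)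
    qed (use snoc.prems in simp)
    then show ?thesis by (intro exI[of _ "u @ [a]"] exI[of _ "[]"] exI[of _ v]) simp
  qed
qed

lemma reduced_prefix: "reduced (u @ v) \<Longrightarrow> reduced u"
  and reduced_suffix: "reduced (u @ v) \<Longrightarrow> reduced v"
  by (simp_all add: successively_append_iff)

lemma freduce_middle: "freduce (u @ freduce v @ w) = freduce (u @ v @ w)"
  using freduce_append_right[of u "freduce v @ w"] freduce_append_right[of u "v @ w"] by simp

lemma fw_append: "fw (u @ v) = fw u + fw v"
  by (intro fword_eqI) (simp add: letters_plus)

lemma fw_Cons: "fw (a # w) = letter_value x a + fw w"
  using fw_append[of "[a]" w] by (simp add: letter_value_x)

lemma letters_below_fw: "(\<forall>a\<in>set w. fst a < n) \<Longrightarrow> letters_below n (fw w)"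
  unfolding letters_below_def using set_freduce[of w] by auto

text \<open>A conjugator of x_i matters only up to powers of x_i on its left. This condition selects
  the representative for which the conjugate is reduced as it is written.\<close>

definition no_leading :: "nat \<Rightarrow> fword \<Rightarrow> bool" where
  "no_leading i w \<longleftrightarrow> (letters w = [] \<or> fst (hd (letters w)) \<noteq> i)"

lemma conj_by_letter: "conj_by (letter_value x (i, e) + w) i = conj_by w i"
  unfolding conj_by_def letter_value_def
  by (simp add: minus_add add.assoc diff_conv_add_uminus del: add_uminus_conv_diff)

lemma conj_by_no_leading:
  "letters_below n w \<Longrightarrow> \<exists>w'. conj_by w' i = conj_by w i \<and> letters_below n w' \<and> no_leading i w' \<and>
     length (letters w') \<le> length (letters w)"
proof (induction "length (letters w)" arbitrary: w rule: less_induct)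
  case less
  show ?case
  proof (cases "no_leading i w")
    case False
    then obtain e v where v: "letters w = (i, e) # v"
      unfolding no_leading_def by (cases "letters w") auto
    have rv: "reduced v" using reduced_letters[of w] unfolding v by (auto simp: successively_Cons simp del: reduced_letters)
    then have lv: "letters (fw v) = v" by (simp add: freduce_reduced)
    have w: "w = letter_value x (i, e) + fw v" using fw_letters[of w] unfolding v fw_Cons by simp
    have "letters_below n (fw v)" using less.prems unfolding letters_below_def v lv by simp
    from less.hyps[OF _ this] show ?thesis
      unfolding lv v using conj_by_letter[of i e "fw v"] unfolding w[symmetric] by (metis le_SucI length_Cons lessI)
  qed (use less.prems in blast)
qed

lemma letters_conj_by:
  assumes "no_leading i w"
  shows "letters (conj_by w i) = word_inv (letters w) @ (i, True) # letters w"
    and "letters (- conj_by w i) = word_inv (letters w) @ (i, False) # letters w"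
proof -
  have r: "reduced (word_inv (letters w) @ (i, e) # letters w)" for e
  proof (cases "letters w")
    case (Cons a v)
    then have "fst a \<noteq> i" using assms by (simp add: no_leading_def)
    then show ?thesis using reduced_letters[of w] reduced_word_inv[of "letters w"] unfolding Cons
      by (auto simp: successively_append_iff successively_Cons simp del: reduced_letters reduced_word_inv)
  qed simp
  have "conj_by w i = fw (word_inv (letters w) @ (i, True) # letters w)"
    unfolding conj_by_def fw_append fw_Cons
    by (simp add: letter_value_def uminus_fword_def add.assoc)
  then show 1: "letters (conj_by w i) = word_inv (letters w) @ (i, True) # letters w"
    using freduce_reduced[OF r] by simp
  then show "letters (- conj_by w i) = word_inv (letters w) @ (i, False) # letters w"
    by simp
qed

text \<open>If no conjugator ends with a letter followed by another conjugator, then in a reduced product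
  of the conjugates the central letters never cancel.\<close>
lemma no_cancellation:
  assumes nl: "\<And>i. i < n \<Longrightarrow> no_leading i (W i)"
    and nr: "\<And>i j e p. i < n \<Longrightarrow> j < n \<Longrightarrow> i \<noteq> j \<Longrightarrow> letters (W i) \<noteq> p @ (j, e) # letters (W j)"
    and v: "reduced ((i, e) # v)" "\<forall>a\<in>set ((i, e) # v). fst a < n"
  shows "\<exists>V. letters (word_eval (\<lambda>i. conj_by (W i) i) ((i, e) # v)) = word_inv (letters (W i)) @ (i, e) # V \<and>
    (v = [] \<longrightarrow> V = letters (W i)) \<and> (v \<noteq> [] \<longrightarrow> V \<noteq> [])"
  using v
proof (induction v arbitrary: i e)
  case Nil
  then show ?case using letters_conj_by[OF nl, of i] by (simp add: letter_value_def)
next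
  case (Cons b v)
  obtain j f where b: "b = (j, f)" by force
  let ?t = "\<lambda>i. conj_by (W i) i"
  have ij: "i < n" "j < n" using Cons.prems b by auto
  have rj: "reduced ((j, f) # v)" using Cons.prems b by simp
  then obtain V where V: "letters (word_eval ?t ((j, f) # v)) = word_inv (letters (W j)) @ (j, f) # V"
    using Cons.IH[of j f] Cons.prems b by auto
  have L: "letters (letter_value ?t (i, e)) = word_inv (letters (W i)) @ (i, e) # letters (W i)"
    using letters_conj_by[OF nl[OF ij(1)]] by (cases e) (simp_all add: letter_value_def)
  obtain p c q where pcq: "letters (W i) = p @ word_inv c" "word_inv (letters (W j)) = c @ q" "reduced (p @ q)"
    using cancellation[of "letters (W i)" "word_inv (letters (W j))"] by auto
  have Wj: "letters (W j) = word_inv q @ word_inv c" using arg_cong[OF pcq(2), of word_inv] by simp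
  have "reduced (letters (letter_value ?t (i, e)))" by (rule reduced_letters)
  then have A: "reduced (word_inv (letters (W i)) @ (i, e) # p)"
    unfolding L pcq(1) using reduced_prefix[of "word_inv (letters (W i)) @ (i, e) # p" "word_inv c"] pcq(1) by simp
  have "reduced (letters (word_eval ?t ((j, f) # v)))" by (rule reduced_letters)
  then have B: "reduced (q @ (j, f) # V)"
    unfolding V pcq(2) using reduced_suffix[of c "q @ (j, f) # V"] by simp
  \<comment> \<open>If only one of \<open>p\<close> and \<open>q\<close> is empty, a cancellation
    here would make one conjugator end with a central letter followed by the other conjugator,
    against \<open>nr\<close>, or against lengths when \<open>i = j\<close>. If both are empty, the
    given word would not be reduced.\<close>
  have junction: "hd (q @ [(j, f)]) \<noteq> letter_inv (last ((i, e) # p))"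
  proof (cases "p = []"; cases "q = []")
    assume "p = []" "q = []"
    then show ?thesis using Cons.prems(1) b by auto
  next
    assume p: "p = []" and q: "q \<noteq> []"
    show ?thesis
    proof
      assume "hd (q @ [(j, f)]) = letter_inv (last ((i, e) # p))"
      then have "hd q = (i, \<not> e)" using p q by simp
      then obtain q' where "q = (i, \<not> e) # q'" using q by (cases q) auto
      then have *: "letters (W j) = word_inv q' @ (i, e) # letters (W i)" using Wj pcq(1) p by simp
      show False
      proof (cases "i = j")
        case True
        then show False using arg_cong[OF *, of length] by simp
      qed (use nr[OF ij(2,1)] * in auto)
    qed
  next
    assume p: "p \<noteq> []" and q: "q = []"
    show ?thesis
    proof
      assume "hd (q @ [(j, f)]) = letter_inv (last ((i, e) # p))"
      then have "last p = (j, \<not> f)" using p q by (cases "last p") auto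
      then obtain p' where "p = p' @ [(j, \<not> f)]" using p by (metis append_butlast_last_id)
      then have *: "letters (W i) = p' @ (j, \<not> f) # letters (W j)" using Wj pcq(1) q by simp
      show False
      proof (cases "i = j")
        case True
        then show False using arg_cong[OF *, of length] by simp
      qed (use nr[OF ij] * in auto)
    qed
  next
    assume "p \<noteq> []" "q \<noteq> []"
    then show ?thesis using pcq(3) by (auto simp: successively_append_iff)
  qed
  have R: "reduced ((word_inv (letters (W i)) @ (i, e) # p) @ (q @ (j, f) # V))"
    unfolding successively_append_iff[of _ "word_inv (letters (W i)) @ (i, e) # p"]
    using A B junction by (cases q) auto
  have "letters (word_eval ?t ((i, e) # b # v)) =
      freduce ((word_inv (letters (W i)) @ (i, e) # letters (W i)) @ (word_inv (letters (W j)) @ (j, f) # V))"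
    unfolding b word_eval.simps(2)[of ?t "(i, e)"] letters_plus L V ..
  also have "\<dots> = freduce ((word_inv (letters (W i)) @ (i, e) # p) @ (freduce (word_inv c @ c) @ (q @ (j, f) # V)))"
    unfolding freduce_middle using pcq(1,2) by simp
  also have "\<dots> = (word_inv (letters (W i)) @ (i, e) # p) @ (q @ (j, f) # V)"
    unfolding freduce_word_inv_left using freduce_reduced[OF R] by simp
  finally show ?case by auto
qed

lemma images_mccool_inv:
  assumes "i < n" "j < n" "i \<noteq> j"
  shows "images n (inv\<^bsub>PSigma n\<^esub> mccool n i j) = x(i := conj_by (- x j) i)"
proof -
  interpret P: group "PSigma n" by (rule PSigma_group)
  let ?c = "images n (inv\<^bsub>PSigma n\<^esub> mccool n i j)"
  have "subst ?c (images n (mccool n i j) k) = x k" for k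
    using images_PSigma_mult[OF P.inv_closed[OF mccool_closed[of n i j]] mccool_closed[of n i j]]
      P.l_inv[OF mccool_closed[of n i j]] images_PSigma_one[of n]
    by (simp only: fun_eq_iff)
  then have *: "subst ?c ((x(i := conj_by (x j) i)) k) = x k" for k
    using assms unfolding images_mccool by simp
  show ?thesis
  proof
    fix k
    show "?c k = (x(i := conj_by (- x j) i)) k"
    proof (cases "k = i")
      case True
      have j: "?c j = x j" using *[of j] assms by simp
      have "- x j + ?c i + x j = x i" using *[of i] j by (simp add: conj_by_subst)
      then have "x j + (- x j + ?c i + x j) + - x j = x j + x i + - x j" by simp
      then show ?thesis using True by (simp add: conj_by_def add.assoc)
    qed (use *[of k] in simp)
  qed
qed

theorem mccool_generate: "generate (PSigma n) (range (case_prod (mccool n))) = carrier (PSigma n)"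
proof
  interpret P: group "PSigma n" by (rule PSigma_group)
  have sub: "range (case_prod (mccool n)) \<subseteq> carrier (PSigma n)" using mccool_closed by auto
  show "generate (PSigma n) (range (case_prod (mccool n))) \<subseteq> carrier (PSigma n)"
    using P.generate_incl[OF sub] .
  have gens: "mccool n i j \<in> generate (PSigma n) (range (case_prod (mccool n)))"
    "inv\<^bsub>PSigma n\<^esub> mccool n i j \<in> generate (PSigma n) (range (case_prod (mccool n)))" for i j
    by (rule generate.incl, force) (rule generate.inv, force)
  have main: "\<phi> \<in> generate (PSigma n) (range (case_prod (mccool n)))"
    if "\<phi> \<in> carrier (PSigma n)" "\<And>i. i < n \<Longrightarrow> images n \<phi> i = conj_by (W i) i"
      "\<And>i. i < n \<Longrightarrow> letters_below n (W i)" "\<And>i. i < n \<Longrightarrow> no_leading i (W i)" for \<phi> W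
    using that
  proof (induction "\<Sum>i<n. length (letters (W i))" arbitrary: \<phi> W rule: less_induct)
    case less
    show ?case
    proof (cases "\<exists>i j e p. i < n \<and> j < n \<and> i \<noteq> j \<and> letters (W i) = p @ (j, e) # letters (W j)")
      case True
      then obtain i j e p where ij: "i < n" "j < n" "i \<noteq> j" and p: "letters (W i) = p @ (j, e) # letters (W j)" by blast
      \<comment> \<open>Composition with \<open>\<beta>\<close> multiplies the conjugator
        \<open>W i\<close> on the right by the conjugate by \<open>W j\<close> of x_j or its
        inverse. The sign is chosen so that the letter \<open>(j, e)\<close> cancels, which leaves
        \<open>p\<close> followed by \<open>W j\<close>.\<close>
      define \<beta> where "\<beta> = (if e then inv\<^bsub>PSigma n\<^esub> mccool n i j else mccool n i j)"
      have \<beta>: "\<beta> \<in> carrier (PSigma n)" "inv\<^bsub>PSigma n\<^esub> \<beta> \<in> generate (PSigma n) (range (case_prod (mccool n)))"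
        using mccool_closed[of n i j] gens[of i j] by (auto simp: \<beta>_def simp del: PSigma_simps)
      define \<psi> where "\<psi> = \<phi> \<otimes>\<^bsub>PSigma n\<^esub> \<beta>"
      have \<psi>: "\<psi> \<in> carrier (PSigma n)" unfolding \<psi>_def using less.prems(1) \<beta>(1) by (rule P.m_closed)
      define w where "w = fw p + W j"
      have Wi: "W i = fw p + letter_value x (j, e) + W j"
        using arg_cong[OF p, of fw] by (simp add: fw_append fw_Cons add.assoc)
      have below: "letters_below n w"
      proof -
        have "\<forall>a\<in>set p. fst a < n" using less.prems(3)[OF ij(1)] unfolding letters_below_def p by simp
        then show ?thesis unfolding w_def using letters_below_fw less.prems(3)[OF ij(2)] letters_below_plus by blast
      qed
      have len: "length (letters w) < length (letters (W i))"
      proof -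
        have rp: "reduced p" using reduced_letters[of "W i"] unfolding p by (simp add: successively_append_iff del: reduced_letters)
        have "length (freduce u) \<le> length u" for u
          by (induction u) (auto simp: freduce.simps(2) split: list.splits)
        from this[of "letters (fw p) @ letters (W j)"] show ?thesis
          unfolding w_def letters_plus p using freduce_reduced[OF rp] by simp
      qed
      have img: "images n \<psi> = (\<lambda>k. subst (images n \<phi>) ((x(i := conj_by (if e then - x j else x j) i)) k))"
        unfolding \<psi>_def images_PSigma_mult[OF less.prems(1) \<beta>(1)]
        unfolding \<beta>_def using images_mccool_inv[OF ij] images_mccool[of n i j] ij by (auto simp del: PSigma_simps)
      have "images n \<psi> i = conj_by w i"
        unfolding img using less.prems(2)[OF ij(1)] less.prems(2)[OF ij(2)] unfolding Wi w_def
        by (simp add: conj_by_subst) (simp add: conj_by_def letter_value_def minus_add add.assoc diff_conv_add_uminus del: add_uminus_conv_diff)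
      moreover obtain w' where w': "conj_by w' i = conj_by w i" "letters_below n w'" "no_leading i w'"
          "length (letters w') \<le> length (letters w)"
        using conj_by_no_leading[OF below] by blast
      ultimately have imgs: "images n \<psi> k = conj_by ((W(i := w')) k) k" if "k < n" for k
        using less.prems(2)[OF that] by (cases "k = i") (auto simp: img)
      have "(\<Sum>k<n. length (letters ((W(i := w')) k))) < (\<Sum>k<n. length (letters (W k)))"
        using w'(4) len ij(1) by (intro sum_strict_mono_ex1) auto
      then have "\<psi> \<in> generate (PSigma n) (range (case_prod (mccool n)))"
        using \<psi> imgs w'(2,3) less.prems(3,4) by (intro less.hyps[of "W(i := w')"]) auto
      then have "\<psi> \<otimes>\<^bsub>PSigma n\<^esub> inv\<^bsub>PSigma n\<^esub> \<beta> \<in> generate (PSigma n) (range (case_prod (mccool n)))"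
        using \<beta>(2) by (rule generate.eng)
      also have "\<psi> \<otimes>\<^bsub>PSigma n\<^esub> inv\<^bsub>PSigma n\<^esub> \<beta> = \<phi>"
        unfolding \<psi>_def using less.prems(1) \<beta>(1) by (simp only: P.m_assoc P.inv_closed P.r_inv P.r_one)
      finally show ?thesis .
    next
      case False
      have au: "\<phi> \<in> auto (free_group n)" using less.prems(1) by (rule PSigma_auto)
      \<comment> \<open>By surjectivity x_j has a preimage. Its image, a single letter, contains by
        \<open>no_cancellation\<close> the inverse of a conjugator, a central letter and a tail that
        is nonempty unless the preimage has length one. So the preimage has length one and the
        conjugator is trivial.\<close>
      have W0: "letters (W j) = []" if j: "j < n" for j
      proof -
        have "\<phi> ` carrier (free_group n) = carrier (free_group n)"
          using au unfolding auto_def Bij_def bij_betw_def by simp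
        then obtain w where w: "letters_below n w" "\<phi> (letters w) = letters (x j)"
          using carrier_letters letters_carrier[of "x j" n] j letters_below_x by (metis (no_types, opaque_lifting) imageE)
        have s: "subst (images n \<phi>) w = x j" using auto_letters[OF au w(1)] w(2) by (simp add: letters_inject del: letters_x)
        then have ne: "letters w \<noteq> []" by (auto simp: subst_def dest: arg_cong[of _ _ letters])
        then obtain i e v where v: "letters w = (i, e) # v" by (metis list.exhaust surj_pair)
        have "word_eval (images n \<phi>) (letters w) = word_eval (\<lambda>i. conj_by (W i) i) (letters w)"
          using w(1) less.prems(2) by (intro word_eval_cong) (auto simp: letters_below_def)
        then have e1: "letters (word_eval (\<lambda>i. conj_by (W i) i) ((i, e) # v)) = [(j, True)]"
          using s unfolding subst_def v by simp
        obtain V where V: "letters (word_eval (\<lambda>i. conj_by (W i) i) ((i, e) # v)) = word_inv (letters (W i)) @ (i, e) # V"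
            "v = [] \<longrightarrow> V = letters (W i)" "v \<noteq> [] \<longrightarrow> V \<noteq> []"
          using no_cancellation[of n W i e v] less.prems(4) False reduced_letters[of w] w(1) unfolding v letters_below_def by blast
        show ?thesis using e1 V by (cases "word_inv (letters (W i))") auto
      qed
      have "images n \<phi> = x"
      proof
        fix i
        show "images n \<phi> i = x i"
        proof (cases "i < n")
          case True
          then have "W i = 0" using W0 by (intro fword_eqI) simp
          then show ?thesis using less.prems(2)[OF True] by (simp add: conj_by_def)
        qed (simp add: images_def)
      qed
      then have "\<phi> = \<one>\<^bsub>PSigma n\<^esub>"
        using PSigma_eqI[OF less.prems(1) P.one_closed] images_PSigma_one by metis
      then show ?thesis using generate.one by metis
    qed
  qed
  show "carrier (PSigma n) \<subseteq> generate (PSigma n) (range (case_prod (mccool n)))"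
  proof
    fix \<phi> assume \<phi>: "\<phi> \<in> carrier (PSigma n)"
    then have "\<forall>i<n. \<exists>w. images n \<phi> i = conj_by w i \<and> letters_below n w \<and> no_leading i w"
      unfolding PSigma_carrier using conj_by_no_leading by metis
    then obtain W where "\<And>i. i < n \<Longrightarrow> images n \<phi> i = conj_by (W i) i \<and> letters_below n (W i) \<and> no_leading i (W i)"
      by metis
    then show "\<phi> \<in> generate (PSigma n) (range (case_prod (mccool n)))" using main[OF \<phi>, of W] by blast
  qed
qed

section \<open>Powers of a letter\<close>

definition xpow :: "nat \<Rightarrow> int \<Rightarrow> fword" where
  "xpow i m = fw (replicate (nat \<bar>m\<bar>) (i, m > 0))"

lemma xpow_0 [simp]: "xpow i 0 = 0"
  by (simp add: xpow_def zero_fword_def)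

lemma xpow_1 [simp]: "xpow i 1 = x i"
  by (simp add: xpow_def x_def)

lemma xpow_add_1: "xpow i (m + 1) = x i + xpow i m"
proof (cases "m \<ge> 0")
  case True
  then have "nat \<bar>m + 1\<bar> = Suc (nat \<bar>m\<bar>)" by simp
  moreover have "m = 0 \<or> m > 0" using True by auto
  ultimately show ?thesis using True unfolding xpow_def by (auto simp: fw_Cons letter_value_def zero_fword_def)
next
  case False
  define k where "k = nat (- m) - 1"
  have k: "nat \<bar>m\<bar> = Suc k" "nat \<bar>m + 1\<bar> = k" using False unfolding k_def by auto
  have "xpow i m = - x i + fw (replicate k (i, False))"
    using False unfolding xpow_def k by (simp add: fw_Cons letter_value_def)
  moreover have "xpow i (m + 1) = fw (replicate k (i, False))"
    using False unfolding xpow_def k by simp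
  ultimately show ?thesis by (simp add: add.assoc[symmetric])
qed

lemma xpow_minus_1: "xpow i (m - 1) = - x i + xpow i m"
  using xpow_add_1[of i "m - 1"] by (simp add: add.assoc[symmetric])

lemma xpow_add: "xpow i (m + k) = xpow i m + xpow i k"
proof (induction m rule: int_induct[of _ 0])
  case (step1 m)
  have "xpow i (m + 1 + k) = x i + xpow i (m + k)" using xpow_add_1[of i "m + k"] by (simp add: ac_simps)
  then show ?case using step1 by (simp add: xpow_add_1 add.assoc)
next
  case (step2 m)
  have "xpow i (m - 1 + k) = - x i + xpow i (m + k)" using xpow_minus_1[of i "m + k"] by (simp add: algebra_simps)
  then show ?case using step2 by (simp add: xpow_minus_1 add.assoc)
qed simp

lemma xpow_uminus: "xpow i (- m) = - xpow i m"
  using xpow_add[of i "- m" m] by (simp add: eq_neg_iff_add_eq_0)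

lemma xpow_induct:
  assumes "P 0" "\<And>w. P w \<Longrightarrow> P (x i + w)" "\<And>w. P w \<Longrightarrow> P (- x i + w)"
  shows "P (xpow i m)"
  by (induction m rule: int_induct[of _ 0]) (auto simp: xpow_add_1 xpow_minus_1 assms)

section \<open>The initial run of a letter\<close>

text \<open>For reduced \<open>w\<close> this is the position, on the axis of x_i in the Cayley tree
  formed by the powers of x_i, of the point closest to \<open>w\<close>.\<close>

definition run :: "nat \<Rightarrow> letter list \<Rightarrow> int" where
  "run i w = sum_list (map (\<lambda>a. if snd a then 1 else - 1) (takeWhile (\<lambda>a. fst a = i) w))"

lemma run_simps [simp]:
  "run i [] = 0"
  "run i (a # w) = (if fst a = i then (if snd a then 1 else - 1) + run i w else 0)"
  by (simp_all add: run_def)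

lemma run_append_same: "(\<forall>a\<in>set u. fst a = i) \<Longrightarrow> run i (u @ w) = run i u + run i w"
  by (induction u) auto

lemma run_append_other: "(\<exists>a\<in>set u. fst a \<noteq> i) \<Longrightarrow> run i (u @ w) = run i u"
  by (induction u) auto

lemma run_append_diff: "w = [] \<or> fst (hd w) \<noteq> i \<Longrightarrow> run i (u @ w) = run i u"
proof (induction u)
  case Nil
  then show ?case by (cases w) auto
qed auto

lemma run_x_plus: "run i (letters (x i + g)) = run i (letters g) + 1"
proof -
  have "letters (x i + g) = freduce ((i, True) # letters g)" by (simp add: letters_plus)
  then show ?thesis by (auto simp: freduce.simps(2) inverse_letters_iff split: list.splits)
qed

lemma run_xpow_plus: "run i (letters (xpow i m + g)) = run i (letters g) + m"
proof (induction m rule: int_induct[of _ 0])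
  case (step1 m)
  then show ?case using run_x_plus[of i "xpow i m + g"] by (simp add: xpow_add_1 add.assoc)
next
  case (step2 m)
  then show ?case using run_x_plus[of i "- x i + (xpow i m + g)"]
    by (simp add: xpow_minus_1 add.assoc)
qed simp

text \<open>An edge labelled by another generator does not change the projection to the axis of x_i.
  Hence a whole translate of the axis of x_j projects to one point.\<close>

lemma run_plus_x:
  assumes "j \<noteq> i"
  shows "run i (letters (g + x j)) = run i (letters g)"
proof (cases "\<exists>v. letters g = v @ [(j, False)]")
  case True
  then obtain v where v: "letters g = v @ [(j, False)]" by blast
  have "freduce [(j, False), (j, True)] = []" using freduce_cancel[of "(j, False)" "[]"] by simp
  then have "letters (g + x j) = freduce v"
    using freduce_append_right[of v "[(j, False), (j, True)]"] by (simp add: letters_plus v)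
  also have "\<dots> = v" using reduced_letters[of g] unfolding v by (rule freduce_reduced[OF reduced_prefix])
  finally show ?thesis using assms unfolding v by (simp add: run_append_diff)
next
  case False
  have "reduced (letters g @ [(j, True)])"
  proof (cases "letters g" rule: rev_cases)
    case (snoc u a)
    then have "a \<noteq> (j, False)" using False by auto
    then show ?thesis using reduced_letters[of g] unfolding snoc by (cases a) (auto simp: successively_append_iff simp del: reduced_letters)
  qed simp
  then have "letters (g + x j) = letters g @ [(j, True)]" by (simp add: letters_plus freduce_reduced)
  then show ?thesis using assms by (simp add: run_append_diff)
qed

lemma run_plus_xpow:
  assumes "j \<noteq> i"
  shows "run i (letters (g + xpow j m)) = run i (letters g)"
proof -
  have "\<forall>g. run i (letters (g + xpow j m)) = run i (letters g)"
  proof (rule xpow_induct)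
    fix w assume IH: "\<forall>g. run i (letters (g + w)) = run i (letters g)"
    show "\<forall>g. run i (letters (g + (x j + w))) = run i (letters g)"
      using IH run_plus_x[OF assms] by (simp add: add.assoc[symmetric])
    show "\<forall>g. run i (letters (g + (- x j + w))) = run i (letters g)"
    proof
      fix g
      have "run i (letters (g + (- x j + w))) = run i (letters (g + - x j))"
        using IH by (simp only: add.assoc[symmetric])
      also have "\<dots> = run i (letters (g + - x j + x j))" using run_plus_x[OF assms] by (simp only:)
      finally show "run i (letters (g + (- x j + w))) = run i (letters g)" by simp
    qed
  qed simp
  then show ?thesis by blast
qed

text \<open>Geometrically: if \<open>g\<close> and \<open>g + h\<close> have different projections
  to the axis of x_i, then 0 and \<open>g + h\<close> have the same projection to the translate by
  \<open>g\<close> of the axis of x_j. In terms of words, the uncancelled part \<open>p\<close> has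
  only letters \<open>i\<close>, and the run of \<open>j\<close> in \<open>h\<close> and in
  \<open>- g\<close> is decided by the common prefix \<open>c\<close>.\<close>

lemma run_ping_pong:
  assumes ij: "i \<noteq> j" and ne: "run i (letters g) \<noteq> run i (letters (g + h))"
  shows "run j (letters h) = run j (letters (- g))"
proof -
  obtain p c q where pcq: "letters g = p @ word_inv c" "letters h = c @ q" "reduced (p @ q)"
    using cancellation[of "letters g" "letters h"] by auto
  have "letters (g + h) = freduce (p @ freduce (word_inv c @ c) @ q)"
    unfolding letters_plus freduce_middle pcq by simp
  then have gh: "letters (g + h) = p @ q" using freduce_reduced[OF pcq(3)] by (simp add: freduce_word_inv_left)
  have mg: "letters (- g) = c @ word_inv p" using pcq(1) by simp
  \<comment> \<open>Any other letter in \<open>p\<close>, a common prefix of both words, would stop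
    both runs at the same place.\<close>
  have p: "\<forall>a\<in>set p. fst a = i" using ne run_append_other[of p i] unfolding gh pcq(1) by metis
  show ?thesis
  proof (cases "\<forall>a\<in>set c. fst a = j")
    case True
    have "word_inv c = [] \<or> fst (hd (word_inv c)) \<noteq> i"
    proof (cases c rule: rev_cases)
      case (snoc c' a)
      then show ?thesis using True ij by auto
    qed simp
    then have "run i q \<noteq> 0" using ne run_append_diff[of "word_inv c" i p] run_append_same[OF p, of q]
      unfolding gh pcq(1) by auto
    then have "fst (hd q) \<noteq> j" using ij by (cases q) (auto split: if_splits)
    moreover have "word_inv p = [] \<or> fst (hd (word_inv p)) \<noteq> j"
    proof (cases p rule: rev_cases)
      case (snoc p' a)
      then show ?thesis using p ij by auto
    qed simp
    ultimately show ?thesis unfolding pcq(2) mg by (simp add: run_append_diff)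
  next
    case False
    then show ?thesis unfolding pcq(2) mg using run_append_other[of c j] by simp
  qed
qed

lemma xpow_no_leading: "\<exists>m v. w = xpow i m + v \<and> no_leading i v"
proof (induction "length (letters w)" arbitrary: w rule: less_induct)
  case less
  show ?case
  proof (cases "no_leading i w")
    case True
    then show ?thesis by (intro exI[of _ 0] exI[of _ w]) simp
  next
    case False
    then obtain e u where u: "letters w = (i, e) # u"
      unfolding no_leading_def by (cases "letters w") auto
    have "reduced u" using reduced_letters[of w] unfolding u by (auto simp: successively_Cons simp del: reduced_letters)
    then have lu: "letters (fw u) = u" by (simp add: freduce_reduced)
    then obtain m v where mv: "fw u = xpow i m + v" "no_leading i v" using less.hyps[of "fw u"] u by auto
    have "w = letter_value x (i, e) + fw u" using fw_letters[of w] unfolding u fw_Cons by simp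
    also have "\<dots> = xpow i (if e then m + 1 else m - 1) + v"
      unfolding mv(1) by (simp add: letter_value_def xpow_add_1 xpow_minus_1 add.assoc)
    finally show ?thesis using mv(2) by blast
  qed
qed

lemma conj_by_xpow: "conj_by (xpow i m + v) i = conj_by v i"
proof -
  have "xpow i (- m) + x i + xpow i m = x i"
    using xpow_add[of i "- m" 1] xpow_add[of i "- m + 1" m] by simp
  then have "- xpow i m + (x i + (xpow i m + v)) = x i + v"
    unfolding xpow_uminus by (simp only: add.assoc[symmetric])
  then show ?thesis
    unfolding conj_by_def by (simp add: minus_add add.assoc diff_conv_add_uminus del: add_uminus_conv_diff)
qed

lemma conj_by_eq_x:
  assumes "conj_by w i = x i"
  shows "\<exists>m. w = xpow i m"
proof -
  obtain m v where w: "w = xpow i m + v" "no_leading i v" using xpow_no_leading by blast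
  have "letters (conj_by v i) = [(i, True)]" using assms unfolding w(1) conj_by_xpow by simp
  then have "letters v = []" unfolding letters_conj_by(1)[OF w(2)] by (cases "word_inv (letters v)") auto
  then have "v = 0" by (intro fword_eqI) simp
  then show ?thesis using w by auto
qed

section \<open>Homomorphisms on the basis-conjugating automorphism group\<close>

text \<open>\<open>\<alpha>\<close> prescribes the images of three free generators. The letters
  \<open>i\<close>, \<open>j\<close>, \<open>k\<close> are only required to be distinct; the maps
  for pairs are obtained with a third letter outside \<open>F_n\<close>.\<close>

locale triple_state = group M for M :: "('m, 'c) monoid_scheme" (structure) +
  fixes i j k :: nat and \<alpha> :: "nat \<Rightarrow> 'm"
  assumes dist: "distinct [i, j, k]" and \<alpha>_closed [simp]: "\<alpha> a \<in> carrier M"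
begin

definition T where "T = {i, j, k}"
definition nx where "nx a = (if a = i then j else if a = j then k else i)"
definition nn where "nn a = (if a = i then k else if a = j then i else j)"

lemma nx_nn: "a \<in> T \<Longrightarrow> nx a \<in> T \<and> nn a \<in> T \<and> nx a \<noteq> a \<and> nn a \<noteq> a \<and> nx a \<noteq> nn a \<and> T = {a, nx a, nn a}"
  using dist unfolding T_def nx_def nn_def by auto

text \<open>The states (w_i, w_j, w_k) describe the conjugates of x_i, x_j, x_k by the w's
  up to simultaneous conjugation.\<close>
definition equiv_state :: "(nat \<Rightarrow> fword) \<Rightarrow> (nat \<Rightarrow> fword) \<Rightarrow> bool" where
  "equiv_state S S' \<longleftrightarrow> (\<exists>h q. \<forall>b\<in>T. S' b = xpow b (q b) + S b + h)"

text \<open>In terms of conjugates, the one with index \<open>nx a\<close> is conjugated by the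
  power \<open>m\<close> of the a-th one.\<close>

definition shift :: "(nat \<Rightarrow> fword) \<Rightarrow> nat \<Rightarrow> int \<Rightarrow> nat \<Rightarrow> fword" where
  "shift S a m = S(nx a := S (nx a) - S a + xpow a m + S a)"

text \<open>The signed distance along the axis of the a-th conjugate, in the Cayley tree, between
  the projections of the axes of the other two conjugates.\<close>
definition disp :: "(nat \<Rightarrow> fword) \<Rightarrow> nat \<Rightarrow> int" where
  "disp S a = run a (letters (S a - S (nx a))) - run a (letters (S a - S (nn a)))"

lemma equiv_refl: "equiv_state S S"
  unfolding equiv_state_def by (intro exI[of _ 0] exI[of _ "\<lambda>_. 0"]) simp

lemma equiv_trans:
  assumes "equiv_state S S'" "equiv_state S' S''" shows "equiv_state S S''"
proof -
  obtain h q where hq: "\<And>b. b \<in> T \<Longrightarrow> S' b = xpow b (q b) + S b + h"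
    using assms(1) unfolding equiv_state_def by blast
  obtain h' q' where hq': "\<And>b. b \<in> T \<Longrightarrow> S'' b = xpow b (q' b) + S' b + h'"
    using assms(2) unfolding equiv_state_def by blast
  have "S'' b = xpow b (q' b + q b) + S b + (h + h')" if "b \<in> T" for b
    using hq[OF that] hq'[OF that] by (simp add: xpow_add add.assoc)
  then show ?thesis unfolding equiv_state_def by (intro exI[of _ "h + h'"] exI[of _ "\<lambda>b. q' b + q b"]) blast
qed

text \<open>The common factor \<open>h\<close> cancels in differences, a power of x_a on the left
  shifts both runs by the same amount, and a power of another letter on the right is invisible by
  \<open>run_plus_xpow\<close>.\<close>

lemma disp_equiv:
  assumes "equiv_state S S'" and a: "a \<in> T"
  shows "disp S' a = disp S a"
proof -
  obtain h q where hq: "\<And>b. b \<in> T \<Longrightarrow> S' b = xpow b (q b) + S b + h"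
    using assms(1) unfolding equiv_state_def by blast
  have "run a (letters (S' a - S' b)) = run a (letters (S a - S b)) + q a" if "b \<in> T" "b \<noteq> a" for b
  proof -
    have "S' a - S' b = xpow a (q a) + ((S a - S b) + xpow b (- q b))"
      unfolding hq[OF a] hq[OF that(1)] xpow_uminus
      by (simp add: diff_conv_add_uminus minus_add add.assoc del: add_uminus_conv_diff)
    then show ?thesis using run_plus_xpow[OF that(2)] by (simp add: run_xpow_plus)
  qed
  then show ?thesis using nx_nn[OF a] unfolding disp_def by simp
qed

lemma disp_shift: "a \<in> T \<Longrightarrow> disp (shift S a m) a = disp S a - m"
proof -
  assume a: "a \<in> T"
  have "S a - (S (nx a) - S a + xpow a m + S a) = xpow a (- m) + (S a - S (nx a))"
    unfolding xpow_uminus by (simp add: diff_conv_add_uminus minus_add add.assoc del: add_uminus_conv_diff)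
  then show ?thesis using nx_nn[OF a] unfolding disp_def shift_def by (simp add: run_xpow_plus)
qed

lemma equiv_shift:
  assumes "equiv_state S S'" and a: "a \<in> T"
  shows "equiv_state (shift S a m) (shift S' a m)"
proof -
  obtain h q where hq: "\<And>b. b \<in> T \<Longrightarrow> S' b = xpow b (q b) + S b + h"
    using assms(1) unfolding equiv_state_def by blast
  have nT: "nx a \<in> T" "a \<noteq> nx a" using nx_nn[OF a] by auto
  have "shift S' a m b = xpow b (q b) + shift S a m b + h" if b: "b \<in> T" for b
  proof (cases "b = nx a")
    case True
    have "- xpow a (q a) + (xpow a m + xpow a (q a)) = xpow a m"
      by (simp add: xpow_uminus[symmetric] xpow_add[symmetric])
    then have *: "- xpow a (q a) + (xpow a m + (xpow a (q a) + w)) = xpow a m + w" for w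
      by (simp only: add.assoc[symmetric])
    have "S' (nx a) - S' a + xpow a m + S' a =
       xpow (nx a) (q (nx a)) + (S (nx a) - S a + xpow a m + S a) + h"
      unfolding hq[OF a] hq[OF nT(1)]
      by (simp add: diff_conv_add_uminus minus_add add.assoc * del: add_uminus_conv_diff)
    then show ?thesis unfolding shift_def True by simp
  qed (use hq[OF b] in \<open>simp add: shift_def\<close>)
  then show ?thesis unfolding equiv_state_def by (intro exI[of _ h] exI[of _ q]) blast
qed

lemma shift_shift: "a \<in> T \<Longrightarrow> shift (shift S a m) a m' = shift S a (m + m')"
  using nx_nn[of a] unfolding shift_def
  by (auto simp: xpow_add diff_conv_add_uminus minus_add add.assoc fun_eq_iff simp del: add_uminus_conv_diff)

lemma shift_0 [simp]: "shift S a 0 = S"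
  by (simp add: shift_def)

text \<open>This is \<open>run_ping_pong\<close> for the differences \<open>S a - S b\<close> and
  \<open>S b - S c\<close>, with \<open>c\<close> the third letter: at most one displacement of a
  state is nonzero.\<close>

lemma ping_pong:
  assumes ab: "a \<in> T" "b \<in> T" "a \<noteq> b" and ne: "disp S a \<noteq> 0"
  shows "disp S b = 0"
proof -
  define c where "c = (if b = nx a then nn a else nx a)"
  have c: "c \<noteq> a" "c \<noteq> b" "T = {a, b, c}" and a': "{nx a, nn a} = {b, c}"
    using nx_nn[OF ab(1)] ab(2,3) unfolding c_def by auto
  have b': "{nx b, nn b} = {a, c}" using nx_nn[OF ab(2)] c ab by auto
  have "run a (letters (S a - S b)) \<noteq> run a (letters ((S a - S b) + (S b - S c)))"
    using ne a' unfolding disp_def by (auto simp: doubleton_eq_iff diff_conv_add_uminus add.assoc simp del: add_uminus_conv_diff)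
  from run_ping_pong[OF ab(3) this] have "run b (letters (S b - S c)) = run b (letters (S b - S a))"
    by simp
  then show ?thesis using b' unfolding disp_def by (auto simp: doubleton_eq_iff)
qed

text \<open>\<open>f\<close> is the value of a product of nonzero powers of the
  \<open>\<alpha> a\<close> that leads to the state \<open>S\<close>. A step requires displacement
  zero at \<open>a\<close> and leaves \<open>- m\<close> there; by \<open>ping_pong\<close> this is
  then the only nonzero displacement, so the last syllable can be read off from the state.\<close>

inductive good :: "(nat \<Rightarrow> fword) \<Rightarrow> 'm \<Rightarrow> bool" where
  base: "equiv_state (\<lambda>_. 0) S \<Longrightarrow> good S \<one>"
| step: "good S f \<Longrightarrow> a \<in> T \<Longrightarrow> disp S a = 0 \<Longrightarrow> m \<noteq> 0 \<Longrightarrow> equiv_state (shift S a m) S' \<Longrightarrow>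
    good S' (f \<otimes> \<alpha> a [^] (m :: int))"

lemma good_closed: "good S f \<Longrightarrow> f \<in> carrier M"
  by (induction rule: good.induct) auto

lemma good_equiv: "good S f \<Longrightarrow> equiv_state S S' \<Longrightarrow> good S' f"
  by (cases rule: good.cases) (auto intro: good.intros equiv_trans)

text \<open>If the displacement at \<open>a\<close> is nonzero, the last syllable is a power of
  \<open>\<alpha> a\<close>, and the new power is merged with it, possibly deleting it. Otherwise a
  new syllable is appended.\<close>

lemma good_shift:
  assumes g: "good S f" and a: "a \<in> T"
  shows "good (shift S a m) (f \<otimes> \<alpha> a [^] (m :: int))"
proof (cases "m = 0 \<or> disp S a = 0")
  case True
  then show ?thesis using good_closed[OF g] g a equiv_refl good.step[of S f a m] by (cases "m = 0") auto
next
  case False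
  from g show ?thesis
  proof cases
    case base
    have "disp S a = disp (\<lambda>_. 0) a" by (rule disp_equiv) (use base a in auto)
    then show ?thesis using False by (simp add: disp_def)
  next
    case (step S0 f0 b m0)
    have "disp S b = - m0"
      using disp_equiv[OF step(6) step(3)] disp_shift[OF step(3)] step(4) by simp
    then have b: "b = a" using ping_pong[OF step(3) a] step(5) False by auto
    have eq: "equiv_state (shift S0 a (m0 + m)) (shift S a m)"
      using equiv_shift[OF step(6)[unfolded b] a, of m] by (simp add: shift_shift[OF a])
    have f0: "f0 \<in> carrier M" using good_closed[OF step(2)] .
    have f: "f \<otimes> \<alpha> a [^] m = f0 \<otimes> \<alpha> a [^] (m0 + m)"
      unfolding step(1) b using f0 by (simp add: int_pow_mult m_assoc)
    show ?thesis
    proof (cases "m0 + m = 0")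
      case True
      then show ?thesis using good_equiv[OF step(2)] eq f f0 by simp
    next
      case False
      then show ?thesis unfolding f using step(2,4) a eq unfolding b by (intro good.step)
    qed
  qed
qed

text \<open>A last syllable would have left a nonzero displacement, so there is none.\<close>

lemma good_zero:
  assumes g: "good S f" and z: "\<And>a. a \<in> T \<Longrightarrow> disp S a = 0"
  shows "f = \<one>"
  using g
proof cases
  case (step S0 f0 b m0)
  have "disp S b = - m0"
    using disp_equiv[OF step(6) step(3)] disp_shift[OF step(3)] step(4) by simp
  then show ?thesis using z[OF step(3)] step(5) by simp
qed

text \<open>Up to equivalence, moving the conjugate with index nn a along the axis of the a-th
  conjugate has the opposite effect of moving the one with index nx a.\<close>
lemma good_move:
  assumes g: "good S f" and a: "a \<in> T"
  shows "good (S(nx a := S (nx a) - S a + xpow a m + S a)) (f \<otimes> \<alpha> a [^] (m :: int))"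
    and "good (S(nn a := S (nn a) - S a + xpow a m + S a)) (f \<otimes> inv (\<alpha> a) [^] (m :: int))"
proof -
  show "good (S(nx a := S (nx a) - S a + xpow a m + S a)) (f \<otimes> \<alpha> a [^] (m :: int))"
    using good_shift[OF assms] unfolding shift_def .
  let ?S = "S(nn a := S (nn a) - S a + xpow a m + S a)"
  have n: "T = {a, nx a, nn a}" "nx a \<noteq> a" "nn a \<noteq> a" "nx a \<noteq> nn a" using nx_nn[OF a] by auto
  have "\<forall>b\<in>T. ?S b = xpow b (if b = a then - m else 0) + shift S a (- m) b + (- S a + xpow a m + S a)"
  proof
    fix b assume "b \<in> T"
    then consider "b = a" | "b = nx a" | "b = nn a" using n(1) by blast
    then show "?S b = xpow b (if b = a then - m else 0) + shift S a (- m) b + (- S a + xpow a m + S a)"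
    proof cases
      case 1
      have "xpow a (- m) + (xpow a m + w) = w" for w
        by (simp add: add.assoc[symmetric] xpow_add[symmetric])
      then show ?thesis using 1 n unfolding shift_def
        by (simp add: diff_conv_add_uminus minus_add add.assoc del: add_uminus_conv_diff)
    next
      case 2
      then show ?thesis using n unfolding shift_def xpow_uminus
        by (simp add: diff_conv_add_uminus minus_add add.assoc del: add_uminus_conv_diff)
    next
      case 3
      then show ?thesis using n unfolding shift_def
        by (simp add: diff_conv_add_uminus minus_add add.assoc del: add_uminus_conv_diff)
    qed
  qed
  then have "equiv_state (shift S a (- m)) ?S" unfolding equiv_state_def
    by (intro exI[of _ "- S a + xpow a m + S a"] exI[of _ "\<lambda>b. if b = a then - m else 0"])
  moreover have "\<alpha> a [^] (- m) = inv (\<alpha> a) [^] m" by (simp add: int_pow_neg int_pow_inv)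
  ultimately show "good ?S (f \<otimes> inv (\<alpha> a) [^] m)"
    using good_equiv[OF good_shift[OF assms, of "- m"]] by simp
qed

end

text \<open>The subgroup of the product generated by the pairs \<open>(g i, \<alpha> i)\<close> is
  the graph of a homomorphism as soon as its fibre over one is trivial. This takes the place of
  checking the relations of a presentation.\<close>

lemma hom_from_graph:
  fixes g :: "'i \<Rightarrow> 'a" and \<alpha> :: "'i \<Rightarrow> 'm"
  assumes G: "group G" and M: "group M"
    and g: "\<And>i. g i \<in> carrier G" and \<alpha>: "\<And>i. \<alpha> i \<in> carrier M"
    and gen: "generate G (range g) = carrier G"
    and one: "\<And>f. (\<one>\<^bsub>G\<^esub>, f) \<in> generate (G \<times>\<times> M) (range (\<lambda>i. (g i, \<alpha> i))) \<Longrightarrow> f = \<one>\<^bsub>M\<^esub>"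
  shows "\<exists>h \<in> hom G M. \<forall>i. h (g i) = \<alpha> i"
proof -
  interpret G: group G by (rule G)
  interpret M: group M by (rule M)
  interpret GM: group "G \<times>\<times> M" by (rule DirProd_group[OF G M])
  define K where "K = generate (G \<times>\<times> M) (range (\<lambda>i. (g i, \<alpha> i)))"
  have sub: "range (\<lambda>i. (g i, \<alpha> i)) \<subseteq> carrier (G \<times>\<times> M)" using g \<alpha> by auto
  have Kc: "K \<subseteq> carrier G \<times> carrier M" unfolding K_def using GM.generate_incl[OF sub] by simp
  have Kg: "(g i, \<alpha> i) \<in> K" for i unfolding K_def by (rule generate.incl) blast
  have Km: "(u \<otimes>\<^bsub>G\<^esub> v, f \<otimes>\<^bsub>M\<^esub> f') \<in> K" if "(u, f) \<in> K" "(v, f') \<in> K" for u v f f'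
    using generate.eng[OF that[unfolded K_def]] unfolding K_def by simp
  have Ki: "(inv\<^bsub>G\<^esub> u, inv\<^bsub>M\<^esub> f) \<in> K" if "(u, f) \<in> K" for u f
    using GM.generate_m_inv_closed[OF sub that[unfolded K_def]] Kc that inv_DirProd[OF G M] unfolding K_def by auto
  have total: "\<exists>f. (u, f) \<in> K" if "u \<in> carrier G" for u
  proof -
    from that have "u \<in> generate G (range g)" unfolding gen .
    then show ?thesis
    proof (induction rule: generate.induct)
      case one
      have "\<one>\<^bsub>G \<times>\<times> M\<^esub> \<in> K" unfolding K_def by (rule generate.one)
      then show ?case by auto
    next
      case (incl u)
      then show ?case using Kg by auto
    next
      case (inv u)
      then show ?case using Ki[OF Kg] by auto
    next
      case (eng u v)
      then show ?case using Km by blast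
    qed
  qed
  have unique: "f = f'" if "(u, f) \<in> K" "(u, f') \<in> K" for u f f'
  proof -
    have c: "u \<in> carrier G" "f \<in> carrier M" "f' \<in> carrier M" using that Kc by auto
    have "(u \<otimes>\<^bsub>G\<^esub> inv\<^bsub>G\<^esub> u, f \<otimes>\<^bsub>M\<^esub> inv\<^bsub>M\<^esub> f') \<in> K" using Km[OF that(1) Ki[OF that(2)]] .
    then have "f \<otimes>\<^bsub>M\<^esub> inv\<^bsub>M\<^esub> f' = \<one>\<^bsub>M\<^esub>" using one c unfolding K_def by simp
    then show ?thesis using c M.inv_equality M.inv_inv by (metis M.inv_closed)
  qed
  define h where "h u = (SOME f. (u, f) \<in> K)" for u
  have hK: "(u, h u) \<in> K" if "u \<in> carrier G" for u
    unfolding h_def using total[OF that] by (rule someI_ex)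
  have "h \<in> hom G M"
  proof (rule homI)
    show "h u \<in> carrier M" if "u \<in> carrier G" for u using hK[OF that] Kc by auto
    show "h (u \<otimes>\<^bsub>G\<^esub> v) = h u \<otimes>\<^bsub>M\<^esub> h v" if "u \<in> carrier G" "v \<in> carrier G" for u v
      using unique[OF hK[OF G.m_closed[OF that]] Km[OF hK[OF that(1)] hK[OF that(2)]]] .
  qed
  moreover have "h (g i) = \<alpha> i" for i using unique[OF hK[OF g] Kg] .
  ultimately show ?thesis by blast
qed

context triple_state
begin

text \<open>The retraction to the free group on the triple. It makes generators conjugating by an
  outer letter invisible, because every conjugate of that letter is sent to 0.\<close>

definition restrict_letters :: "fword \<Rightarrow> fword" where
  "restrict_letters = subst (\<lambda>b. if b \<in> T then x b else 0)"

definition represents :: "nat \<Rightarrow> (letter list \<Rightarrow> letter list) \<Rightarrow> (nat \<Rightarrow> fword) \<Rightarrow> bool" where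
  "represents n \<phi> S \<longleftrightarrow> (\<forall>b\<in>T. restrict_letters (images n \<phi> b) = conj_by (S b) b)"

text \<open>The two generators conjugating by x_q receive inverse values, since moving all
  conjugates along the same axis changes a state only up to equivalence.\<close>

definition mccool_value :: "nat \<Rightarrow> nat \<Rightarrow> nat \<Rightarrow> 'm" where
  "mccool_value n p q = (if p < n \<and> q < n \<and> p \<noteq> q \<and> p \<in> T \<and> q \<in> T
     then (if p = nx q then \<alpha> q else inv (\<alpha> q)) else \<one>)"

lemma mccool_value_closed: "mccool_value n p q \<in> carrier M"
  unfolding mccool_value_def by simp

lemma restrict_letters_simps [simp]:
  "restrict_letters 0 = 0" "restrict_letters (u + v) = restrict_letters u + restrict_letters v"
  "restrict_letters (- u) = - restrict_letters u" "restrict_letters (x b) = (if b \<in> T then x b else 0)"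
  by (simp_all add: restrict_letters_def)

lemma good_mult_one: "good S f \<Longrightarrow> good S (f \<otimes> \<one>)"
  using good_closed[of S f] by simp

text \<open>Composing with a generator on the right conjugates the p-th conjugate by the q-th one.
  If both indices lie in the triple, this is the move of \<open>good_move\<close>; otherwise the
  state does not change.\<close>

lemma represents_step:
  assumes \<phi>: "\<phi> \<in> carrier (PSigma n)" and r: "represents n \<phi> S" and g: "good S f"
    and \<beta>: "\<beta> \<in> carrier (PSigma n)" and m: "m = 1 \<or> m = (- 1 :: int)" and pq: "p < n" "q < n" "p \<noteq> q"
    and img: "images n \<beta> = x(p := conj_by (xpow q m) p)"
  shows "\<exists>S'. represents n (\<phi> \<otimes>\<^bsub>PSigma n\<^esub> \<beta>) S' \<and> good S' (f \<otimes> mccool_value n p q [^] m)"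
proof -
  have im: "images n (\<phi> \<otimes>\<^bsub>PSigma n\<^esub> \<beta>) b = subst (images n \<phi>) ((x(p := conj_by (xpow q m) p)) b)" for b
    unfolding images_PSigma_mult[OF \<phi> \<beta>] img ..
  have other: "restrict_letters (images n (\<phi> \<otimes>\<^bsub>PSigma n\<^esub> \<beta>) b) = conj_by (S b) b" if "b \<in> T" "b \<noteq> p" for b
    using r that unfolding im represents_def by simp
  define v where "v = restrict_letters (subst (images n \<phi>) (xpow q m))"
  have xq: "xpow q m = (if m = 1 then x q else - x q)" using m xpow_uminus[of q 1] by auto
  have new: "restrict_letters (images n (\<phi> \<otimes>\<^bsub>PSigma n\<^esub> \<beta>) p) = conj_by (S p + v) p" if "p \<in> T"
    using r that unfolding im represents_def v_def
    by (simp add: conj_by_subst) (simp add: conj_by_def minus_add add.assoc diff_conv_add_uminus del: add_uminus_conv_diff)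
  consider "p \<notin> T" | "p \<in> T" "q \<notin> T" | "p \<in> T" "q \<in> T" by blast
  then show ?thesis
  proof cases
    case 1
    then show ?thesis using other good_mult_one[OF g] by (intro exI[of _ S]) (auto simp: represents_def mccool_value_def)
  next
    case 2
    obtain w where "images n \<phi> q = conj_by w q" using \<phi> pq(2) unfolding PSigma_carrier by blast
    then have "restrict_letters (images n \<phi> q) = 0" using 2 by (simp add: conj_by_def)
    then have "v = 0" unfolding v_def xq by simp
    then show ?thesis using other new 2 good_mult_one[OF g] by (intro exI[of _ S]) (auto simp: represents_def mccool_value_def)
  next
    case 3
    have "restrict_letters (images n \<phi> q) = - S q + x q + S q" using r 3 unfolding represents_def conj_by_def by blast
    then have v: "S p + v = S p - S q + xpow q m + S q"
      unfolding v_def xq by (simp add: minus_add add.assoc diff_conv_add_uminus del: add_uminus_conv_diff)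
    have "represents n (\<phi> \<otimes>\<^bsub>PSigma n\<^esub> \<beta>) (S(p := S p - S q + xpow q m + S q))"
      unfolding represents_def using other new 3(1) v by simp
    moreover have "good (S(p := S p - S q + xpow q m + S q)) (f \<otimes> mccool_value n p q [^] m)"
    proof (cases "p = nx q")
      case True
      then show ?thesis using good_move(1)[OF g 3(2), of m] 3 pq by (simp add: mccool_value_def)
    next
      case False
      then have "p = nn q" using nx_nn[OF 3(2)] 3(1) pq(3) by auto
      then show ?thesis using good_move(2)[OF g 3(2), of m] 3 pq False by (simp add: mccool_value_def)
    qed
    ultimately show ?thesis by blast
  qed
qed

lemma represents_generator:
  assumes \<phi>: "\<phi> \<in> carrier (PSigma n)" and r: "represents n \<phi> S" and g: "good S f"
  shows "\<exists>S'. represents n (\<phi> \<otimes>\<^bsub>PSigma n\<^esub> mccool n p q) S' \<and> good S' (f \<otimes> mccool_value n p q)"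
    and "\<exists>S'. represents n (\<phi> \<otimes>\<^bsub>PSigma n\<^esub> inv\<^bsub>PSigma n\<^esub> mccool n p q) S' \<and> good S' (f \<otimes> inv (mccool_value n p q))"
proof -
  interpret P: group "PSigma n" by (rule PSigma_group)
  have "(\<exists>S'. represents n (\<phi> \<otimes>\<^bsub>PSigma n\<^esub> mccool n p q) S' \<and> good S' (f \<otimes> mccool_value n p q)) \<and>
    (\<exists>S'. represents n (\<phi> \<otimes>\<^bsub>PSigma n\<^esub> inv\<^bsub>PSigma n\<^esub> mccool n p q) S' \<and> good S' (f \<otimes> inv (mccool_value n p q)))"
  proof (cases "p < n \<and> q < n \<and> p \<noteq> q")
    case True
    then have pq: "p < n" "q < n" "p \<noteq> q" by auto
    have 1: "images n (mccool n p q) = x(p := conj_by (xpow q 1) p)" using images_mccool[of n p q] True by simp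
    have 2: "images n (inv\<^bsub>PSigma n\<^esub> mccool n p q) = x(p := conj_by (xpow q (- 1)) p)"
      using images_mccool_inv[OF pq] xpow_uminus[of q 1] by simp
    have "mccool_value n p q [^] (- 1 :: int) = inv (mccool_value n p q)"
      using mccool_value_closed by (simp add: int_pow_neg)
    then show ?thesis
      using represents_step[OF \<phi> r g mccool_closed disjI1[OF refl] pq 1]
        represents_step[OF \<phi> r g P.inv_closed[OF mccool_closed] disjI2[OF refl] pq 2] mccool_value_closed
      by simp
  next
    case False
    then have 1: "mccool n p q = \<one>\<^bsub>PSigma n\<^esub>" unfolding mccool_def by (rule if_not_P)
    have 2: "mccool_value n p q = \<one>" using False by (auto simp: mccool_value_def)
    show ?thesis unfolding 1 2 P.inv_one inv_one P.r_one[OF \<phi>] using r good_mult_one[OF g] by blast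
  qed
  then show "\<exists>S'. represents n (\<phi> \<otimes>\<^bsub>PSigma n\<^esub> mccool n p q) S' \<and> good S' (f \<otimes> mccool_value n p q)"
    and "\<exists>S'. represents n (\<phi> \<otimes>\<^bsub>PSigma n\<^esub> inv\<^bsub>PSigma n\<^esub> mccool n p q) S' \<and> good S' (f \<otimes> inv (mccool_value n p q))"
    by blast+
qed

theorem PSigma_hom: "\<exists>h \<in> hom (PSigma n) M. \<forall>p q. h (mccool n p q) = mccool_value n p q"
proof -
  interpret P: group "PSigma n" by (rule PSigma_group)
  interpret PM: group "PSigma n \<times>\<times> M" by (rule DirProd_group[OF PSigma_group is_group])
  let ?X = "range (\<lambda>pq. (case_prod (mccool n) pq, case_prod (mccool_value n) pq))"
  have c: "case_prod (mccool n) pq \<in> carrier (PSigma n)" "case_prod (mccool_value n) pq \<in> carrier M" for pq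
    using mccool_closed mccool_value_closed by (auto split: prod.splits)
  have sub: "?X \<subseteq> carrier (PSigma n \<times>\<times> M)" using c by auto
  \<comment> \<open>The starting point is arbitrary so that the factors of a product can be applied
    one after the other.\<close>
  have closed: "\<exists>S'. represents n (\<phi> \<otimes>\<^bsub>PSigma n\<^esub> fst z) S' \<and> good S' (f \<otimes> snd z)"
    if "z \<in> generate (PSigma n \<times>\<times> M) ?X" "\<phi> \<in> carrier (PSigma n)" "represents n \<phi> S" "good S f" for z \<phi> S f
    using that
  proof (induction arbitrary: \<phi> S f rule: generate.induct)
    case one
    then show ?case using good_mult_one P.r_one by (auto simp del: PSigma_simps)
  next
    case (incl z)
    then obtain p q where "z = (mccool n p q, mccool_value n p q)" by auto
    then show ?case using represents_generator(1)[OF incl(2-4)] by simp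
  next
    case (inv z)
    then obtain p q where z: "z = (mccool n p q, mccool_value n p q)" by auto
    then have "inv\<^bsub>PSigma n \<times>\<times> M\<^esub> z = (inv\<^bsub>PSigma n\<^esub> mccool n p q, inv (mccool_value n p q))"
      using inv_DirProd[OF PSigma_group is_group mccool_closed mccool_value_closed] by simp
    then show ?case using represents_generator(2)[OF inv(2-4)] by simp
  next
    case (eng z w)
    have zc: "fst z \<in> carrier (PSigma n)" "snd z \<in> carrier M" "fst w \<in> carrier (PSigma n)" "snd w \<in> carrier M"
      using PM.generate_in_carrier[OF sub eng.hyps(1)] PM.generate_in_carrier[OF sub eng.hyps(2)] by auto
    obtain S1 where S1: "represents n (\<phi> \<otimes>\<^bsub>PSigma n\<^esub> fst z) S1" "good S1 (f \<otimes> snd z)"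
      using eng.IH(1)[OF eng.prems] by blast
    obtain S2 where S2: "represents n ((\<phi> \<otimes>\<^bsub>PSigma n\<^esub> fst z) \<otimes>\<^bsub>PSigma n\<^esub> fst w) S2" "good S2 ((f \<otimes> snd z) \<otimes> snd w)"
      using eng.IH(2)[OF P.m_closed[OF eng.prems(1) zc(1)] S1] by blast
    have "fst (z \<otimes>\<^bsub>PSigma n \<times>\<times> M\<^esub> w) = fst z \<otimes>\<^bsub>PSigma n\<^esub> fst w" "snd (z \<otimes>\<^bsub>PSigma n \<times>\<times> M\<^esub> w) = snd z \<otimes> snd w"
      by (simp_all add: DirProd_def case_prod_beta)
    then show ?case
      using S2 P.m_assoc[OF eng.prems(1) zc(1,3)] m_assoc[OF good_closed[OF eng.prems(3)] zc(2,4)] by metis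
  qed
  \<comment> \<open>When the automorphism is the identity, each \<open>S b\<close> commutes with x_b
    and is a power of it. The state is then equivalent to the trivial one, and all displacements
    vanish.\<close>
  have one: "f = \<one>" if f: "(\<one>\<^bsub>PSigma n\<^esub>, f) \<in> generate (PSigma n \<times>\<times> M) ?X" for f
  proof -
    have r0: "represents n \<one>\<^bsub>PSigma n\<^esub> (\<lambda>_. 0)"
      unfolding represents_def images_PSigma_one by (simp add: conj_by_def)
    have fc: "f \<in> carrier M" using PM.generate_in_carrier[OF sub f] by simp
    obtain S where S: "represents n (\<one>\<^bsub>PSigma n\<^esub> \<otimes>\<^bsub>PSigma n\<^esub> \<one>\<^bsub>PSigma n\<^esub>) S" "good S (\<one> \<otimes> f)"
      using closed[OF f P.one_closed r0 base[OF equiv_refl]] by (simp only: fst_conv snd_conv) blast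
    have "restrict_letters (x b) = conj_by (S b) b" if "b \<in> T" for b
      using S(1) that unfolding P.r_one[OF P.one_closed] represents_def images_PSigma_one by blast
    then have "\<forall>b\<in>T. \<exists>m. S b = xpow b m" using conj_by_eq_x by (metis restrict_letters_simps(4))
    then obtain q where "\<forall>b\<in>T. S b = xpow b (q b)" by metis
    then have e: "equiv_state (\<lambda>_. 0) S" unfolding equiv_state_def by (intro exI[of _ 0] exI[of _ q]) simp
    have "disp S a = 0" if "a \<in> T" for a
      using disp_equiv[OF e that] by (simp add: disp_def)
    then show ?thesis using good_zero[OF S(2)] fc by simp
  qed
  obtain h where "h \<in> hom (PSigma n) M" "\<forall>pq. h (case_prod (mccool n) pq) = case_prod (mccool_value n) pq"
    using hom_from_graph[of "PSigma n" M "case_prod (mccool n)" "case_prod (mccool_value n)",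
        OF PSigma_group is_group c mccool_generate one] by blast
  then show ?thesis by (intro bexI[of _ h]) auto
qed

end

lemma mccool_group_PSigma: "mccool_group_with_quotients (PSigma n) (mccool n) n"
proof -
  interpret P: group "PSigma n" by (rule PSigma_group)
  show ?thesis
  proof (unfold_locales, goal_cases)
    case (1 i j)
    then show ?case by (rule mccool_closed)
  next
    case (2 i j)
    then show ?case unfolding mccool_def by (rule if_not_P)
  next
    case 3
    then show ?case by (rule mccool_generate)
  next
    case (4 i j k l)
    then show ?case by (rule mccool_disj)
  next
    case (5 i j k)
    then show ?case by (rule mccool_same)
  next
    case (6 i j k)
    then show ?case by (rule mccool_mix)
  next
    case (7 i j a1 a2)
    \<comment> \<open>The map for a pair is the triple map for \<open>i\<close>, \<open>j\<close>
      and the letter \<open>n\<close>, which \<open>images\<close> leaves fixed. Since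
      \<open>nx j\<close> is \<open>n\<close>, the generator with indices \<open>i\<close>,
      \<open>j\<close> gets the inverse of \<open>\<alpha> j\<close>, hence the inverse of
      \<open>a1\<close> here.\<close>
    define \<alpha> where "\<alpha> a = (if a = i then a2 else if a = j then inv\<^bsub>affine_group\<^esub> a1 else \<one>\<^bsub>affine_group\<^esub>)" for a
    have "\<alpha> a \<in> carrier affine_group" for a unfolding \<alpha>_def using 7(3,4) Aff.inv_closed[OF 7(3)] Aff.one_closed by presburger
    then interpret t: triple_state affine_group i j n \<alpha> using 7(1,2) by unfold_locales auto
    obtain h where h: "h \<in> hom (PSigma n) affine_group" "\<And>p q. h (mccool n p q) = t.mccool_value n p q"
      using t.PSigma_hom[of n] by blast
    have "t.mccool_value n i j = a1" "t.mccool_value n j i = a2"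
      using 7 Aff.inv_inv[OF 7(3)] by (simp_all add: t.mccool_value_def t.T_def t.nx_def \<alpha>_def del: affine_carrier)
    moreover have "t.mccool_value n p q = \<one>\<^bsub>affine_group\<^esub>" if "{p, q} \<noteq> {i, j}" for p q
    proof -
      have "\<not> (p < n \<and> q < n \<and> p \<noteq> q \<and> p \<in> t.T \<and> q \<in> t.T)" using that by (auto simp: t.T_def)
      then show ?thesis unfolding t.mccool_value_def by (rule if_not_P)
    qed
    ultimately show ?case using h by (intro bexI[of _ h]) simp_all
  next
    case (8 i j k a1 a2 a3)
    define \<alpha> where "\<alpha> a = (if a = i then a1 else if a = j then a2 else a3)" for a
    have "\<alpha> a \<in> carrier affine_group" for a unfolding \<alpha>_def using 8 by presburger
    then interpret t: triple_state affine_group i j k \<alpha> using 8 by unfold_locales auto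
    obtain h where h: "h \<in> hom (PSigma n) affine_group" "\<And>p q. h (mccool n p q) = t.mccool_value n p q"
      using t.PSigma_hom[of n] by blast
    have "t.mccool_value n p q = \<one>\<^bsub>affine_group\<^esub>" if "\<not> (p \<in> {i, j, k} \<and> q \<in> {i, j, k})" for p q
    proof -
      have "\<not> (p < n \<and> q < n \<and> p \<noteq> q \<and> p \<in> t.T \<and> q \<in> t.T)" using that by (auto simp: t.T_def)
      then show ?thesis unfolding t.mccool_value_def by (rule if_not_P)
    qed
    moreover have "t.mccool_value n j i = a1" "t.mccool_value n k i = inv\<^bsub>affine_group\<^esub> a1"
      "t.mccool_value n k j = a2" "t.mccool_value n i j = inv\<^bsub>affine_group\<^esub> a2"
      "t.mccool_value n i k = a3" "t.mccool_value n j k = inv\<^bsub>affine_group\<^esub> a3"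
      using 8(1-3) by (simp_all add: t.mccool_value_def t.T_def t.nx_def \<alpha>_def del: affine_carrier)
    ultimately show ?case using h by (intro bexI[of _ h]) simp_all
  qed
qed

theorem theorem1p2:
  fixes n :: nat
  shows "\<exists>k0. \<forall>k \<ge> k0.
           int (chen_rank (PSigma n) k) =
             (int k - 1) * int (n choose 2) + (int k ^ 2 - 1) * int (n choose 3)"
proof (intro exI[of _ 5] allI impI)
  fix k :: nat assume k: "k \<ge> 5"
  have "int (chen_rank (PSigma n) k) = int (k - 1) * int (n choose 2) + int (k - 1) * int (k + 1) * int (n choose 3)"
    unfolding mccool_group_with_quotients.chen_rank_eq[OF mccool_group_PSigma k] by (simp only: of_nat_add of_nat_mult)
  moreover have "int (k - 1) = int k - 1" using k by simp
  ultimately show "int (chen_rank (PSigma n) k) =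
      (int k - 1) * int (n choose 2) + (int k ^ 2 - 1) * int (n choose 3)"
    by (simp add: power2_eq_square algebra_simps)
qed

end
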